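(* Let $(X,\|\cdot\|)$ be an extended Banach space with $X=X_{fin}\oplus M$ (algebraic direct sum, $M$ a linear subspace), and let $A\subseteq X$ be weakly closed. Consider the following statements: (1) $A$ is weakly compact; (2) $A$ is weakly sequentially compact (every sequence in $A$ has a weakly convergent subsequence); (3) $A$ is weakly countably compact (every countably infinite subset of $A$ has a cluster point in the weak topology); (4) for every $f\in X^*$, there is an $x_0\in A$ such that $|f(x_0)|=\sup_{x\in A}|f(x)|$. Then $(1)\Leftrightarrow(2)\Leftrightarrow(3)\Rightarrow(4)$. In particular, if $A$ is convex, then $(4)\Rightarrow(1)$.
   Context: Vector spaces are over $\mathbb{K}$, where $\mathbb{K}$ is $\mathbb{R}$ or $\mathbb{C}$. An extended norm on $X$ is a map $\|\cdot\|:X\to[0,\infty]$ with $\|x\|=0$ iff $x=0$, $\|\alpha x\|=|\alpha|\|x\|$ (convention $0\cdot\infty=0$) and $\|x+y\|\le\|x\|+\|y\|$. An extended normed linear space is a vector space with an extended norm, topologized by the metric $d(x,y)=\min\{1,\|x-y\|\}$; it is an extended Banach space if it is complete for $d$. $X_{fin}=\{x\in X:\|x\|<\infty\}$. $X^*$ is the set of all continuous linear functionals $X\to\mathbb{K}$. The weak topology on $X$ is induced by the seminorms $x\mapsto|f(x)|$, $f\in X^*$; "weakly" refers to this topology. *)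

theory Defs
  imports "HOL-Analysis.Analysis"
begin

section \<open>The scalar field\<close>

text \<open>Up to isometric isomorphism of normed fields, the instances of this class are exactly the real
  and the complex numbers.\<close>

class real_or_complex = real_normed_field +
  assumes real_or_complex:
    "(\<exists>\<phi> :: real \<Rightarrow> 'a. bij \<phi> \<and>
        (\<forall>x y. \<phi> (x + y) = \<phi> x + \<phi> y \<and> \<phi> (x * y) = \<phi> x * \<phi> y) \<and> (\<forall>x. norm (\<phi> x) = norm x)) \<or>
     (\<exists>\<phi> :: complex \<Rightarrow> 'a. bij \<phi> \<and>
        (\<forall>x y. \<phi> (x + y) = \<phi> x + \<phi> y \<and> \<phi> (x * y) = \<phi> x * \<phi> y) \<and> (\<forall>x. norm (\<phi> x) = norm x))"

instance real :: real_or_complex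
  by standard (rule disjI1, rule exI[of _ id], simp)

instance complex :: real_or_complex
  by standard (rule disjI2, rule exI[of _ id], simp)

section \<open>Extended normed spaces\<close>

text \<open>In \<open>ennreal\<close> the product of \<open>0\<close> and \<open>\<infinity>\<close> is \<open>0\<close>, as homogeneity requires.\<close>

locale extended_normed_space = vector_space scl
  for scl :: "'k::real_or_complex \<Rightarrow> 'v::ab_group_add \<Rightarrow> 'v" +
  fixes nrm :: "'v \<Rightarrow> ennreal"
  assumes nrm_eq_0_iff: "nrm x = 0 \<longleftrightarrow> x = 0"
    and nrm_scale: "nrm (scl a x) = ennreal (norm a) * nrm x"
    and nrm_triangle: "nrm (x + y) \<le> nrm x + nrm y"

definition ext_dist :: "('v::ab_group_add \<Rightarrow> ennreal) \<Rightarrow> 'v \<Rightarrow> 'v \<Rightarrow> real"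
  where "ext_dist nrm x y = enn2real (min 1 (nrm (x - y)))"

lemma (in extended_normed_space) Metric_space_ext_dist: "Metric_space UNIV (ext_dist nrm)"
proof
  fix x y z :: 'v
  have fin: "min 1 (nrm u) < top" for u
    by (simp add: min_less_iff_disj)
  show "0 \<le> ext_dist nrm x y"
    by (simp add: ext_dist_def)
  have "nrm (x - y) = nrm (scl (-1) (x - y))"
    by (simp only: nrm_scale) simp
  then show "ext_dist nrm x y = ext_dist nrm y x"
    by (simp add: ext_dist_def)
  show "ext_dist nrm x y = 0 \<longleftrightarrow> x = y"
    using fin[of "x - y"] nrm_eq_0_iff[of "x - y"]
    by (auto simp: ext_dist_def enn2real_eq_0_iff min_def split: if_splits)
  have "nrm (x - z) \<le> nrm (x - y) + nrm (y - z)"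
    using nrm_triangle[of "x - y" "y - z"] by simp
  moreover have "min 1 c \<le> min 1 a + min 1 b" if "c \<le> a + b" for a b c :: ennreal
    using that by (auto simp: min_def add_increasing add_increasing2 intro: order_trans)
  ultimately have "min 1 (nrm (x - z)) \<le> min 1 (nrm (x - y)) + min 1 (nrm (y - z))"
    by blast
  then have "enn2real (min 1 (nrm (x - z))) \<le>
      enn2real (min 1 (nrm (x - y)) + min 1 (nrm (y - z)))"
    using fin by (intro enn2real_mono) auto
  then show "ext_dist nrm x z \<le> ext_dist nrm x y + ext_dist nrm y z"
    using fin by (simp add: ext_dist_def enn2real_plus)
qed

definition norm_topology :: "('v::ab_group_add \<Rightarrow> ennreal) \<Rightarrow> 'v topology"
  where "norm_topology nrm = Metric_space.mtopology UNIV (ext_dist nrm)"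

locale extended_banach_space = extended_normed_space +
  assumes complete: "Metric_space.mcomplete UNIV (ext_dist nrm)"

definition finite_part :: "('v \<Rightarrow> ennreal) \<Rightarrow> 'v set"
  where "finite_part nrm = {x. nrm x < \<infinity>}"

section \<open>Duality and the weak topology\<close>

definition cont_dual ::
    "('k::real_or_complex \<Rightarrow> 'v::ab_group_add \<Rightarrow> 'v) \<Rightarrow> ('v \<Rightarrow> ennreal) \<Rightarrow> ('v \<Rightarrow> 'k) set"
  where "cont_dual scl nrm =
    {f. Vector_Spaces.linear scl (*) f \<and> continuous_map (norm_topology nrm) euclidean f}"

text \<open>The open balls of the seminorms \<open>\<lambda>x. norm (f x)\<close> form a subbasis.\<close>

definition weak_topology ::
    "('k::real_or_complex \<Rightarrow> 'v::ab_group_add \<Rightarrow> 'v) \<Rightarrow> ('v \<Rightarrow> ennreal) \<Rightarrow> 'v topology"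
  where "weak_topology scl nrm =
    topology_generated_by {{y. norm (f (y - x)) < r} | f x r. f \<in> cont_dual scl nrm \<and> 0 < r}"

lemma (in extended_normed_space) topspace_weak_topology: "topspace (weak_topology scl nrm) = UNIV"
proof -
  have "Vector_Spaces.linear scl (*) (\<lambda>_. 0)"
    by unfold_locales (simp_all add: algebra_simps)
  then have "(\<lambda>_. 0) \<in> cont_dual scl nrm"
    by (simp add: cont_dual_def)
  then have "{y. norm ((\<lambda>_. 0 :: 'k) (y - 0)) < 1} \<in>
      {{y. norm (f (y - x)) < r} | f x r. f \<in> cont_dual scl nrm \<and> 0 < r}"
    by (intro CollectI exI[of _ "\<lambda>_. 0"] exI[of _ 0] exI[of _ 1]) simp
  then show ?thesis
    unfolding weak_topology_def topology_generated_by_topspace by auto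
qed

section \<open>Direct sums, convexity and compactness notions\<close>

definition direct_sum_decomposition ::
    "('k::field \<Rightarrow> 'v::ab_group_add \<Rightarrow> 'v) \<Rightarrow> 'v set \<Rightarrow> 'v set \<Rightarrow> bool"
  where "direct_sum_decomposition scl U V \<longleftrightarrow>
    module.subspace scl U \<and> module.subspace scl V \<and>
    {u + v | u v. u \<in> U \<and> v \<in> V} = UNIV \<and> U \<inter> V = {0}"

definition convex_wrt :: "('k::real_or_complex \<Rightarrow> 'v::ab_group_add \<Rightarrow> 'v) \<Rightarrow> 'v set \<Rightarrow> bool"
  where "convex_wrt scl A \<longleftrightarrow>
    (\<forall>x\<in>A. \<forall>y\<in>A. \<forall>t::real. 0 \<le> t \<and> t \<le> 1 \<longrightarrow>
      scl (of_real (1 - t)) x + scl (of_real t) y \<in> A)"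

text \<open>The limit of the subsequence, and the cluster point of the subset, need not lie in \<open>A\<close>;
  they do when \<open>A\<close> is closed in \<open>T\<close>. The derived set of \<open>B\<close> is the set of cluster points of \<open>B\<close>:
  every neighbourhood of such a point meets \<open>B\<close> in a different point.\<close>

definition seq_compactin :: "'a topology \<Rightarrow> 'a set \<Rightarrow> bool"
  where "seq_compactin T A \<longleftrightarrow>
    (\<forall>\<sigma> :: nat \<Rightarrow> 'a. range \<sigma> \<subseteq> A \<longrightarrow>
      (\<exists>l r. strict_mono (r :: nat \<Rightarrow> nat) \<and> limitin T (\<sigma> \<circ> r) l sequentially))"

definition countably_compactin :: "'a topology \<Rightarrow> 'a set \<Rightarrow> bool"
  where "countably_compactin T A \<longleftrightarrow>
    (\<forall>B \<subseteq> A. countable B \<and> infinite B \<longrightarrow> T derived_set_of B \<noteq> {})"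

text \<open>The supremum is taken in the extended reals: if \<open>norm \<circ> f\<close> is unbounded on \<open>A\<close>, it is
  infinite and not attained.\<close>

definition attains_sup_norm :: "('v \<Rightarrow> 'k::real_normed_vector) \<Rightarrow> 'v set \<Rightarrow> bool"
  where "attains_sup_norm f A \<longleftrightarrow> (\<exists>x\<^sub>0\<in>A. ereal (norm (f x\<^sub>0)) = (SUP x\<in>A. ereal (norm (f x))))"

end

theory Submission
  imports Defs "HOL-Library.Function_Algebras" "HOL-Library.Diagonal_Subsequence"
begin

text \<open>The theorem combines the Eberlein--Smulian theorem and James' theorem; the proof reduces both to
  complete seminormed real spaces.

  \<^bold>\<open>Reduction.\<close> A scalar functional is determined by its real part, so the weak topology is induced
  by the real functionals that are bounded by the norm on the finite part and arbitrary elsewhere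
  (\<open>weak_eq_pullback\<close>). Each of the four conditions makes all these functionals bounded on \<open>A\<close>. As their
  values off the finite part are free, this confines \<open>A\<close> to the sum of the finite part and a
  finite-dimensional space (\<open>weakly_bounded_finite_dimensional\<close>). That sum is a Banach space with the same
  functionals, and its complement is put into the kernel of a complete seminorm
  (\<open>adapted_weakly_bounded\<close>). By Tychonoff's theorem a weakly closed bounded \<open>A\<close> is weakly compact once
  every functional \<open>\<phi>\<close> on the dual that lies in the pointwise closure of \<open>A\<close> is an evaluation at a vector
  (\<open>compact_if_closure_represented\<close>).

  \<^bold>\<open>The array.\<close> If some \<open>\<phi>\<close> in this closure is not an evaluation, completeness gives it positive distance
  from the evaluations, and Helly's theorem yields functionals \<open>f\<^sub>m\<close> of norm at most one and \<open>x\<^sub>n \<in> A\<close> with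
  \<open>f\<^sub>m x\<^sub>n > \<theta>\<close> for \<open>m \<le> n\<close> and \<open>f\<^sub>m x\<^sub>n = 0\<close> for \<open>n < m\<close> (\<open>james_array\<close>). Such a sequence \<open>x\<^sub>n\<close> has no weak
  accumulation point (\<open>seq_accumulating_represented\<close>), so countable compactness implies compactness.
  Countable compactness also yields convergent subsequences, since countably many functionals separate the
  closed span of a sequence (\<open>seq_accumulating_convergent_subsequence\<close>). Conversely the limit of a
  subsequence of an injective sequence is a cluster point.

  \<^bold>\<open>Attained suprema.\<close> Compact sets attain suprema by continuity. For the converse, Pryce's argument
  builds from the array a functional that does not attain its supremum (\<open>james\<close>). It is applied to the union
  of all rotations of \<open>A\<close>, where the real part of a functional has as its supremum the supremum of the
  modulus on \<open>A\<close>.\<close>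

section \<open>Linear functionals dominated by sublinear ones\<close>

locale real_vs = vector_space sc
  for sc :: "real \<Rightarrow> 'b::ab_group_add \<Rightarrow> 'b"
begin

definition lin :: "('b \<Rightarrow> real) \<Rightarrow> bool"
  where "lin f \<longleftrightarrow> (\<forall>x y. f (x + y) = f x + f y) \<and> (\<forall>c x. f (sc c x) = c * f x)"

definition sublin :: "('b \<Rightarrow> real) \<Rightarrow> bool"
  where "sublin p \<longleftrightarrow> (\<forall>x y. p (x + y) \<le> p x + p y) \<and> (\<forall>c x. 0 < c \<longrightarrow> p (sc c x) \<le> c * p x)"

lemma lin_add: "lin f \<Longrightarrow> f (x + y) = f x + f y"
  and lin_sc: "lin f \<Longrightarrow> f (sc c x) = c * f x"
  by (auto simp: lin_def)

lemma lin_0: "lin f \<Longrightarrow> f 0 = 0"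
  using lin_sc[of f 0 0] by simp

lemma lin_minus: "lin f \<Longrightarrow> f (- x) = - f x"
  using lin_sc[of f "-1" x] by simp

lemma lin_diff: "lin f \<Longrightarrow> f (x - y) = f x - f y"
  using lin_add[of f x "- y"] by (simp add: lin_minus)

lemma lin_comb:
  assumes "lin f" "lin g" shows "lin (\<lambda>x. a * f x + b * g x)"
  using assms by (simp add: lin_def algebra_simps)

lemma lin_eq_linear: "lin f \<longleftrightarrow> Vector_Spaces.linear sc (*) f"
proof -
  have "vector_space ((*) :: real \<Rightarrow> real \<Rightarrow> real)"
    by unfold_locales (auto simp: algebra_simps)
  then show ?thesis
    using vector_space_axioms by (auto simp: lin_def Vector_Spaces.linear_iff)
qed

lemma sublin_add: "sublin p \<Longrightarrow> p (x + y) \<le> p x + p y"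
  by (auto simp: sublin_def)

lemma sublin_sc_le: "sublin p \<Longrightarrow> 0 < c \<Longrightarrow> p (sc c x) \<le> c * p x"
  by (auto simp: sublin_def)

lemma sublin_0:
  assumes "sublin p" shows "p 0 = 0"
  using sublin_sc_le[OF assms, of 2 0] sublin_sc_le[OF assms, of "1/2" 0] by simp

lemma sublin_sc:
  assumes p: "sublin p" and c: "0 \<le> c" shows "p (sc c x) = c * p x"
proof (cases "c = 0")
  case False
  then have "p x \<le> inverse c * p (sc c x)"
    using sublin_sc_le[OF p, of "inverse c" "sc c x"] c by simp
  then have "c * p x \<le> p (sc c x)"
    using False c by (simp add: field_simps)
  then show ?thesis
    using sublin_sc_le[OF p, of c x] False c by simp
qed (simp add: sublin_0[OF p])

lemma sublin_minus_le: "sublin p \<Longrightarrow> - p (- x) \<le> p x"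
  using sublin_add[of p x "- x"] sublin_0[of p] by simp

lemma lin_le_sublin_abs:
  assumes "lin f" "\<And>x. f x \<le> p x" "\<And>x. p (- x) = p x"
  shows "\<bar>f x\<bar> \<le> p x"
  using assms(2)[of x] assms(2)[of "- x"] assms(3)[of x] lin_minus[OF assms(1), of x] by auto

definition ray :: "'b \<Rightarrow> real \<Rightarrow> ('b \<times> real) set"
  where "ray y r = {(sc t y, t * r) | t. 0 \<le> t}"

definition pair_cone :: "('b \<times> real) set \<Rightarrow> bool"
  where "pair_cone G \<longleftrightarrow> (0, 0) \<in> G \<and>
    (\<forall>y r z t. (y, r) \<in> G \<longrightarrow> (z, t) \<in> G \<longrightarrow> (y + z, r + t) \<in> G) \<and>
    (\<forall>c y r. 0 < c \<longrightarrow> (y, r) \<in> G \<longrightarrow> (sc c y, c * r) \<in> G)"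

lemma self_in_ray: "(y, r) \<in> ray y r"
  by (auto simp: ray_def intro!: exI[of _ "1::real"])

lemma pair_cone_ray: "pair_cone (ray y r)"
  unfolding pair_cone_def
proof (intro conjI allI impI)
  show "(0, 0) \<in> ray y r"
    by (auto simp: ray_def intro!: exI[of _ "0::real"])
next
  fix a s b t
  assume "(a, s) \<in> ray y r" "(b, t) \<in> ray y r"
  then obtain u v where "0 \<le> u" "0 \<le> v" "a = sc u y" "s = u * r" "b = sc v y" "t = v * r"
    by (auto simp: ray_def)
  then show "(a + b, s + t) \<in> ray y r"
    by (auto simp: ray_def scale_left_distrib algebra_simps intro!: exI[of _ "u + v"])
next
  fix c :: real and a s
  assume "0 < c" "(a, s) \<in> ray y r"
  then obtain u where "0 \<le> u" "a = sc u y" "s = u * r"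
    by (auto simp: ray_def)
  then show "(sc c a, c * s) \<in> ray y r"
    using \<open>0 < c\<close> by (auto simp: ray_def intro!: exI[of _ "c * u"])
qed

lemma ray_le_sublin: "sublin p \<Longrightarrow> (a, s) \<in> ray y (p y) \<Longrightarrow> s \<le> p a"
  by (auto simp: ray_def sublin_sc)

text \<open>Given prescribed lower bounds \<open>r\<close> at vectors \<open>y\<close>, collected in a cone \<open>G\<close> of pairs, the
  infimal convolution \<open>x \<mapsto> inf (p (x + y) - r)\<close> shrinks \<open>p\<close> so far that every linear functional
  below it obeys these bounds.\<close>

lemma sublin_below_cone:
  assumes p: "sublin p"
    and G: "pair_cone G"
    and Gle: "\<And>y r. (y, r) \<in> G \<Longrightarrow> r \<le> p y"
  obtains s where "sublin s" "\<And>x. s x \<le> p x" "\<And>y r. (y, r) \<in> G \<Longrightarrow> s (- y) \<le> - r"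
proof -
  have G0: "(0, 0) \<in> G"
    and Gadd: "\<And>y r z t. (y, r) \<in> G \<Longrightarrow> (z, t) \<in> G \<Longrightarrow> (y + z, r + t) \<in> G"
    and Gsc: "\<And>c y r. 0 < c \<Longrightarrow> (y, r) \<in> G \<Longrightarrow> (sc c y, c * r) \<in> G"
    using G by (auto simp: pair_cone_def)
  define T where "T x = {p (x + y) - r | y r. (y, r) \<in> G}" for x
  define s where "s x = Inf (T x)" for x
  have ne: "T x \<noteq> {}" for x
    using G0 by (auto simp: T_def)
  have "- p (- x) \<le> t" if "t \<in> T x" for x t
  proof -
    obtain y r where y: "(y, r) \<in> G" "t = p (x + y) - r"
      using \<open>t \<in> T x\<close> by (auto simp: T_def)
    have "p y \<le> p (x + y) + p (- x)"
      using sublin_add[OF p, of "x + y" "- x"] by simp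
    then show ?thesis
      using Gle[OF y(1)] y(2) by simp
  qed
  then have bdd: "bdd_below (T x)" for x
    by (meson bdd_below.I)
  have low: "s x \<le> p (x + y) - r" if "(y, r) \<in> G" for x y r
    unfolding s_def by (rule cInf_lower[OF _ bdd]) (use that in \<open>auto simp: T_def\<close>)
  have near: "\<exists>y r. (y, r) \<in> G \<and> p (x + y) - r < s x + e" if "0 < e" for x e
  proof -
    have "Inf (T x) < s x + e"
      using that by (simp add: s_def)
    from cInf_lessD[OF ne this] show ?thesis
      by (auto simp: T_def)
  qed
  have "s (x + x') \<le> s x + s x'" for x x'
  proof (rule field_le_epsilon)
    fix e :: real assume "0 < e"
    then obtain y r y' r' where *: "(y, r) \<in> G" "p (x + y) - r < s x + e/2"
        "(y', r') \<in> G" "p (x' + y') - r' < s x' + e/2"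
      using near[of "e/2" x] near[of "e/2" x'] by auto
    have "s (x + x') \<le> p ((x + x') + (y + y')) - (r + r')"
      using * by (intro low Gadd)
    moreover have "p ((x + x') + (y + y')) \<le> p (x + y) + p (x' + y')"
      using sublin_add[OF p, of "x + y" "x' + y'"] by (simp add: algebra_simps)
    ultimately show "s (x + x') \<le> s x + s x' + e"
      using * by simp
  qed
  moreover have "s (sc c x) \<le> c * s x" if "0 < c" for c x
  proof (rule field_le_epsilon)
    fix e :: real assume "0 < e"
    then obtain y r where *: "(y, r) \<in> G" "p (x + y) - r < s x + e/c"
      using near[of "e/c" x] \<open>0 < c\<close> by auto
    have "s (sc c x) \<le> p (sc c x + sc c y) - c * r"
      using * \<open>0 < c\<close> by (intro low Gsc)
    also have "\<dots> \<le> c * (p (x + y) - r)"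
      using sublin_sc_le[OF p \<open>0 < c\<close>, of "x + y"] by (simp add: algebra_simps)
    also have "\<dots> \<le> c * (s x + e/c)"
      using * \<open>0 < c\<close> by (intro mult_left_mono) auto
    finally show "s (sc c x) \<le> c * s x + e"
      using \<open>0 < c\<close> by (simp add: algebra_simps)
  qed
  ultimately have "sublin s"
    by (auto simp: sublin_def)
  moreover have "s x \<le> p x" for x
    using low[OF G0, of x] by simp
  moreover have "s (- y) \<le> - r" if "(y, r) \<in> G" for y r
    using low[OF that, of "- y"] sublin_0[OF p] by simp
  ultimately show ?thesis
    using that by blast
qed

text \<open>A minimal sublinear functional cannot be shrunk along the ray through \<open>y\<close>, so it is odd, and
  an odd sublinear functional is linear.\<close>

lemma minimal_sublin_lin:
  assumes m: "sublin m" and min: "\<And>s. sublin s \<Longrightarrow> (\<And>x. s x \<le> m x) \<Longrightarrow> s = m"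
  shows "lin m"
proof -
  have odd: "m (- y) = - m y" for y
  proof -
    obtain s where s: "sublin s" "\<And>x. s x \<le> m x" "\<And>z r. (z, r) \<in> ray y (m y) \<Longrightarrow> s (- z) \<le> - r"
      using sublin_below_cone[OF m pair_cone_ray[of y "m y"]] ray_le_sublin[OF m, of _ _ y] by metis
    have "m (- y) \<le> - m y"
      using s(3)[OF self_in_ray] min[OF s(1,2)] by simp
    then show ?thesis
      using sublin_minus_le[OF m, of y] by simp
  qed
  have "m (x + y) = m x + m y" for x y
    using sublin_add[OF m, of x y] sublin_add[OF m, of "x + y" "- y"] odd[of y] by simp
  moreover have "m (sc c x) = c * m x" for c x
  proof (cases "0 \<le> c")
    case False
    then show ?thesis
      using sublin_sc[OF m, of "- c" x] odd[of "sc c x"] by simp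
  qed (rule sublin_sc[OF m])
  ultimately show ?thesis
    by (simp add: lin_def)
qed

text \<open>Zorn's lemma: along a chain the pointwise infimum is again sublinear.\<close>

lemma exists_lin_le_sublin:
  assumes p: "sublin p"
  obtains g where "lin g" "\<And>x. g x \<le> p x"
proof -
  define S where "S = {s. sublin s \<and> (\<forall>x. s x \<le> p x)}"
  define P where "P a b \<longleftrightarrow> (\<forall>x. b x \<le> a x)" for a b :: "'b \<Rightarrow> real"
  have "\<exists>m\<in>S. \<forall>a\<in>S. P m a \<longrightarrow> a = m"
  proof (rule predicate_Zorn)
    show "partial_order_on S (relation_of P S)"
      by (rule partial_order_on_relation_ofI) (auto simp: P_def fun_eq_iff intro: order_trans antisym)
    fix C assume "C \<in> Chains (relation_of P S)"
    then have CS: "C \<subseteq> S" and chain: "\<And>a b. a \<in> C \<Longrightarrow> b \<in> C \<Longrightarrow> P a b \<or> P b a"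
      by (auto simp: Chains_def relation_of_def)
    show "\<exists>u\<in>S. \<forall>a\<in>C. P a u"
    proof (cases "C = {}")
      case True
      then show ?thesis
        using p by (auto simp: S_def)
    next
      case False
      define u where "u x = (INF s\<in>C. s x)" for x
      have "- p (- x) \<le> s x" if "s \<in> C" for s x
      proof -
        have "sublin s" "s (- x) \<le> p (- x)"
          using CS that by (auto simp: S_def)
        then show ?thesis
          using sublin_minus_le[of s x] by linarith
      qed
      then have bdd: "bdd_below ((\<lambda>s. s x) ` C)" for x
        by (meson bdd_below.I2)
      have low: "u x \<le> s x" if "s \<in> C" for s x
        unfolding u_def using bdd that by (rule cINF_lower)
      have near: "\<exists>s\<in>C. s x < u x + e" if "0 < e" for x and e :: real
        using cINF_less_iff[OF False bdd, of x "u x + e"] that by (simp add: u_def)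
      have "u (x + y) \<le> u x + u y" for x y
      proof (rule field_le_epsilon)
        fix e :: real assume "0 < e"
        then obtain s t where *: "s \<in> C" "s x < u x + e/2" "t \<in> C" "t y < u y + e/2"
          using near[of "e/2" x] near[of "e/2" y] by auto
        obtain w where w: "w \<in> C" "w x \<le> s x" "w y \<le> t y"
          using chain[OF *(1,3)] *(1,3) by (auto simp: P_def)
        then have "u (x + y) \<le> w x + w y"
          using low[OF w(1), of "x + y"] CS sublin_add[of w x y] by (force simp: S_def)
        then show "u (x + y) \<le> u x + u y + e"
          using * w by linarith
      qed
      moreover have "u (sc c x) \<le> c * u x" if "0 < c" for c x
      proof (rule field_le_epsilon)
        fix e :: real assume "0 < e"
        then obtain s where *: "s \<in> C" "s x < u x + e/c"
          using near[of "e/c" x] \<open>0 < c\<close> by auto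
        have "u (sc c x) \<le> c * s x"
          using low[OF *(1), of "sc c x"] CS *(1) sublin_sc_le[of s c x] \<open>0 < c\<close> by (force simp: S_def)
        also have "\<dots> \<le> c * (u x + e/c)"
          using * \<open>0 < c\<close> by (intro mult_left_mono) auto
        finally show "u (sc c x) \<le> c * u x + e"
          using \<open>0 < c\<close> by (simp add: algebra_simps)
      qed
      ultimately have "sublin u"
        by (auto simp: sublin_def)
      moreover have "u x \<le> p x" for x
      proof -
        obtain s where s: "s \<in> C" using False by blast
        then have "s x \<le> p x"
          using CS by (auto simp: S_def)
        then show ?thesis
          using low[OF s, of x] by linarith
      qed
      ultimately have "u \<in> S"
        by (auto simp: S_def)
      then show ?thesis
        using low by (auto simp: P_def)
    qed
  qed
  then obtain m where m: "m \<in> S" "\<And>a. a \<in> S \<Longrightarrow> P m a \<Longrightarrow> a = m"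
    by blast
  have "lin m"
  proof (rule minimal_sublin_lin)
    show "sublin m"
      using m(1) by (simp add: S_def)
    show "s = m" if "sublin s" "\<And>x. s x \<le> m x" for s
      using m(1) that by (intro m(2)) (auto simp: S_def P_def intro: order_trans)
  qed
  then show ?thesis
    using that m(1) by (auto simp: S_def)
qed

text \<open>This form of the Hahn--Banach theorem, due to Mazur and Orlicz, covers both the extension of
  a functional from a subspace (\<open>G\<close> its graph) and supporting functionals (\<open>G\<close> a ray).\<close>

theorem mazur_orlicz:
  assumes p: "sublin p"
    and G: "pair_cone G"
    and Gle: "\<And>y r. (y, r) \<in> G \<Longrightarrow> r \<le> p y"
  obtains g where "lin g" "\<And>x. g x \<le> p x" "\<And>y r. (y, r) \<in> G \<Longrightarrow> r \<le> g y"
proof -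
  obtain s where s: "sublin s" "\<And>x. s x \<le> p x" "\<And>y r. (y, r) \<in> G \<Longrightarrow> s (- y) \<le> - r"
    using sublin_below_cone[OF p G Gle] by blast
  obtain g where g: "lin g" "\<And>x. g x \<le> s x"
    using exists_lin_le_sublin[OF s(1)] by blast
  have "r \<le> g y" if "(y, r) \<in> G" for y r
    using s(3)[OF that] g(2)[of "- y"] lin_minus[OF g(1), of y] by simp
  then show ?thesis
    using that g s(2) order_trans by metis
qed

lemma supporting_functional:
  assumes p: "sublin p"
  obtains g where "lin g" "\<And>x. g x \<le> p x" "g y = p y"
proof -
  obtain g where g: "lin g" "\<And>x. g x \<le> p x" "\<And>z r. (z, r) \<in> ray y (p y) \<Longrightarrow> r \<le> g z"
    using mazur_orlicz[OF p pair_cone_ray[of y "p y"]] ray_le_sublin[OF p, of _ _ y] by metis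
  have "g y = p y"
    using g(2)[of y] g(3)[OF self_in_ray] by simp
  then show ?thesis
    using that g by blast
qed

text \<open>The relation below means that \<open>liminf f\<^sub>k \<le> g \<le> limsup f\<^sub>k\<close> pointwise, in a form that needs no
  boundedness. Such \<open>g\<close> play the role of cluster points of the sequence.\<close>

definition env :: "(nat \<Rightarrow> 'b \<Rightarrow> real) \<Rightarrow> ('b \<Rightarrow> real) \<Rightarrow> bool"
  where "env f g \<longleftrightarrow>
    (\<forall>a c. (\<forall>\<^sub>F k in sequentially. f k a \<le> c) \<longrightarrow> g a \<le> c) \<and>
    (\<forall>a c. (\<forall>\<^sub>F k in sequentially. c \<le> f k a) \<longrightarrow> c \<le> g a)"

lemma env_upper: "env f g \<Longrightarrow> \<forall>\<^sub>F k in sequentially. f k a \<le> c \<Longrightarrow> g a \<le> c"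
  and env_lower: "env f g \<Longrightarrow> \<forall>\<^sub>F k in sequentially. c \<le> f k a \<Longrightarrow> c \<le> g a"
  by (auto simp: env_def)

text \<open>For bounded sequences \<open>x \<mapsto> limsup f\<^sub>k x\<close> is sublinear; linear functionals below it are generalised
  limits, which saves an appeal to weak-star compactness.\<close>

lemma exists_generalised_limit:
  assumes f: "\<And>k. lin (f k)" and bound: "\<And>k x. \<bar>f k x\<bar> \<le> C x"
  obtains g where "lin g" "env f g"
proof -
  define T where "T x = {c. \<forall>\<^sub>F k in sequentially. f k x \<le> c}" for x
  define p where "p x = Inf (T x)" for x
  have "f k x \<le> C x" for k x
    using bound[of k x] by linarith
  then have "C x \<in> T x" for x
    by (simp add: T_def)
  then have ne: "T x \<noteq> {}" for x
    by auto
  have "- C x \<le> c" if "c \<in> T x" for x c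
  proof -
    have "\<forall>\<^sub>F k in sequentially. f k x \<le> c"
      using that by (simp add: T_def)
    then obtain k where "f k x \<le> c"
      using eventually_happens by force
    then show ?thesis
      using bound[of k x] by linarith
  qed
  then have bdd: "bdd_below (T x)" for x
    by (meson bdd_below.I)
  have low: "p x \<le> c" if "\<forall>\<^sub>F k in sequentially. f k x \<le> c" for x c
    unfolding p_def by (rule cInf_lower[OF _ bdd]) (use that in \<open>simp add: T_def\<close>)
  have near: "\<forall>\<^sub>F k in sequentially. f k x \<le> p x + e" if e: "0 < e" for x and e :: real
  proof -
    have "Inf (T x) < p x + e"
      using e by (simp add: p_def)
    from cInf_lessD[OF ne this] obtain c where "c \<in> T x" "c < p x + e"
      by auto
    then show ?thesis
      by (auto simp: T_def elim: eventually_mono)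
  qed
  have "sublin p"
    unfolding sublin_def
  proof (intro conjI allI impI)
    fix x y
    show "p (x + y) \<le> p x + p y"
    proof (rule field_le_epsilon)
      fix e :: real assume "0 < e"
      then have "\<forall>\<^sub>F k in sequentially. f k x \<le> p x + e/2" "\<forall>\<^sub>F k in sequentially. f k y \<le> p y + e/2"
        using near by simp_all
      then have "\<forall>\<^sub>F k in sequentially. f k (x + y) \<le> p x + p y + e"
        by eventually_elim (simp add: lin_add[OF f])
      then show "p (x + y) \<le> p x + p y + e"
        by (rule low)
    qed
  next
    fix c x
    assume "0 < (c::real)"
    show "p (sc c x) \<le> c * p x"
    proof (rule field_le_epsilon)
      fix e :: real assume "0 < e"
      then have "\<forall>\<^sub>F k in sequentially. f k x \<le> p x + e/c"
        using near \<open>0 < c\<close> by simp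
      then have "\<forall>\<^sub>F k in sequentially. f k (sc c x) \<le> c * p x + e"
        by eventually_elim (use \<open>0 < c\<close> in \<open>simp add: lin_sc[OF f] field_simps\<close>)
      then show "p (sc c x) \<le> c * p x + e"
        by (rule low)
    qed
  qed
  then obtain g where g: "lin g" "\<And>x. g x \<le> p x"
    using exists_lin_le_sublin by blast
  have "g a \<le> c" if "\<forall>\<^sub>F k in sequentially. f k a \<le> c" for a c
    using low[OF that] g(2)[of a] by linarith
  moreover have "c \<le> g a" if "\<forall>\<^sub>F k in sequentially. c \<le> f k a" for a c
  proof -
    have "\<forall>\<^sub>F k in sequentially. f k (- a) \<le> - c"
      using that by eventually_elim (simp add: lin_minus[OF f])
    then have "g (- a) \<le> - c"
      using low g(2)[of "- a"] by fastforce
    then show ?thesis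
      by (simp add: lin_minus[OF g(1)])
  qed
  ultimately have "env f g"
    by (auto simp: env_def)
  with g(1) that show ?thesis
    by blast
qed

end

section \<open>Complete seminormed spaces and their duals\<close>

text \<open>Seminorms rather than norms, so that a complement of the subspace of interest can be put into
  the kernel instead of restricting all functionals to a carrier set.\<close>

locale complete_seminormed = real_vs sc
  for sc :: "real \<Rightarrow> 'v::ab_group_add \<Rightarrow> 'v" +
  fixes q :: "'v \<Rightarrow> real"
  assumes q_add: "q (x + y) \<le> q x + q y"
    and q_sc: "q (sc c x) = \<bar>c\<bar> * q x"
    and complete: "(\<And>e. 0 < e \<Longrightarrow> \<exists>N::nat. \<forall>m\<ge>N. \<forall>n\<ge>N. q (\<sigma> m - \<sigma> n) < e) \<Longrightarrow>
      \<exists>x. (\<lambda>n. q (\<sigma> n - x)) \<longlonglongrightarrow> 0"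
begin

lemma q_0: "q 0 = 0"
  using q_sc[of 0 0] by simp

lemma q_minus: "q (- x) = q x"
  using q_sc[of "-1" x] by simp

lemma q_minus_commute: "q (x - y) = q (y - x)"
  using q_minus[of "x - y"] by simp

lemma q_nonneg: "0 \<le> q x"
  using q_add[of x "- x"] by (simp add: q_0 q_minus)

lemma q_triangle: "q (x - z) \<le> q (x - y) + q (y - z)"
  using q_add[of "x - y" "y - z"] by simp

lemma sublin_q: "sublin q"
  by (simp add: sublin_def q_add q_sc)

definition dual :: "('v \<Rightarrow> real) set"
  where "dual = {f. lin f \<and> (\<exists>C. \<forall>x. \<bar>f x\<bar> \<le> C * q x)}"

definition uball :: "('v \<Rightarrow> real) set"
  where "uball = {f. lin f \<and> (\<forall>x. \<bar>f x\<bar> \<le> q x)}"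

lemma dual_lin: "f \<in> dual \<Longrightarrow> lin f"
  and uball_lin: "f \<in> uball \<Longrightarrow> lin f"
  and uball_le: "f \<in> uball \<Longrightarrow> \<bar>f x\<bar> \<le> q x"
  by (auto simp: dual_def uball_def)

lemma uball_dual: "f \<in> uball \<Longrightarrow> f \<in> dual"
  by (auto simp: uball_def dual_def intro!: exI[of _ 1])

lemma dualE:
  assumes "f \<in> dual"
  obtains C where "0 < C" "\<And>x. \<bar>f x\<bar> \<le> C * q x"
proof -
  obtain C where C: "\<And>x. \<bar>f x\<bar> \<le> C * q x"
    using assms by (auto simp: dual_def)
  have "\<bar>f x\<bar> \<le> (\<bar>C\<bar> + 1) * q x" for x
  proof -
    have "C * q x \<le> (\<bar>C\<bar> + 1) * q x"
      by (rule mult_right_mono) (auto simp: q_nonneg)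
    then show ?thesis
      using C[of x] by linarith
  qed
  then show ?thesis
    using that[of "\<bar>C\<bar> + 1"] by simp
qed

lemma dual_comb:
  assumes "f \<in> dual" "g \<in> dual" shows "(\<lambda>x. a * f x + b * g x) \<in> dual"
proof -
  obtain C where C: "\<And>x. \<bar>f x\<bar> \<le> C * q x"
    using dualE[OF assms(1)] by blast
  obtain C' where C': "\<And>x. \<bar>g x\<bar> \<le> C' * q x"
    using dualE[OF assms(2)] by blast
  have "\<bar>a * f x + b * g x\<bar> \<le> (\<bar>a\<bar> * C + \<bar>b\<bar> * C') * q x" for x
  proof -
    have "\<bar>a * f x + b * g x\<bar> \<le> \<bar>a\<bar> * \<bar>f x\<bar> + \<bar>b\<bar> * \<bar>g x\<bar>"
      by (metis abs_mult abs_triangle_ineq)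
    also have "\<dots> \<le> \<bar>a\<bar> * (C * q x) + \<bar>b\<bar> * (C' * q x)"
      by (intro add_mono mult_left_mono C C') auto
    finally show ?thesis
      by (simp add: algebra_simps)
  qed
  then show ?thesis
    using lin_comb[of f g a b] assms by (auto simp: dual_def)
qed

lemma dual_add: "f \<in> dual \<Longrightarrow> g \<in> dual \<Longrightarrow> (\<lambda>x. f x + g x) \<in> dual"
  using dual_comb[of f g 1 1] by simp

lemma dual_sc: "f \<in> dual \<Longrightarrow> (\<lambda>x. c * f x) \<in> dual"
  using dual_comb[of f f c 0] by simp

lemma uball_minus: "f \<in> uball \<Longrightarrow> (\<lambda>x. - f x) \<in> uball"
  using lin_comb[of f f "-1" 0] by (simp add: uball_def)

lemma dual_scaled_uball:
  assumes "f \<in> dual"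
  obtains C g where "0 < C" "g \<in> uball" "f = (\<lambda>x. C * g x)"
proof -
  obtain C where C: "0 < C" "\<And>x. \<bar>f x\<bar> \<le> C * q x"
    using dualE[OF assms] by blast
  have "(\<lambda>x. f x / C) \<in> uball"
    using lin_comb[of f f "1/C" 0] dual_lin[OF assms] C
    by (auto simp: uball_def field_simps abs_mult)
  then show ?thesis
    using that[of C "\<lambda>x. f x / C"] C(1) by simp
qed

lemma norming_functional:
  obtains f where "f \<in> uball" "f x = q x"
proof -
  obtain f where f: "lin f" "\<And>y. f y \<le> q y" "f x = q x"
    using supporting_functional[OF sublin_q] by blast
  then have "f \<in> uball"
    using lin_le_sublin_abs[of f q] q_minus by (auto simp: uball_def)
  then show ?thesis
    using that f(3) by blast
qed

lemma separating_functional: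
  assumes S: "subspace S" and d: "\<And>y. y \<in> S \<Longrightarrow> d \<le> q (x - y)"
  obtains f where "f \<in> uball" "\<And>y. y \<in> S \<Longrightarrow> f y = 0" "d \<le> f x"
proof -
  let ?G = "{(y + sc t x, t * d) | y t. y \<in> S \<and> 0 \<le> t}"
  have cone: "pair_cone ?G"
    unfolding pair_cone_def
  proof (intro conjI allI impI)
    show "(0, 0) \<in> ?G"
      using subspace_0[OF S] by (auto intro!: exI[of _ "0 :: 'v"] exI[of _ "0::real"])
  next
    fix a r b s
    assume "(a, r) \<in> ?G" "(b, s) \<in> ?G"
    then obtain y t y' t' where *: "y \<in> S" "0 \<le> t" "a = y + sc t x" "r = t * d"
        "y' \<in> S" "0 \<le> t'" "b = y' + sc t' x" "s = t' * d"
      by auto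
    then have "(a + b, r + s) = ((y + y') + sc (t + t') x, (t + t') * d)" "y + y' \<in> S"
      using subspace_add[OF S] by (auto simp: scale_left_distrib algebra_simps)
    then show "(a + b, r + s) \<in> ?G"
      using * by force
  next
    fix c :: real and a r
    assume "0 < c" "(a, r) \<in> ?G"
    then obtain y t where *: "y \<in> S" "0 \<le> t" "a = y + sc t x" "r = t * d"
      by auto
    then have "(sc c a, c * r) = (sc c y + sc (c * t) x, (c * t) * d)" "sc c y \<in> S"
      using subspace_scale[OF S] by (auto simp: scale_right_distrib)
    then show "(sc c a, c * r) \<in> ?G"
      using * \<open>0 < c\<close> by force
  qed
  have le: "r \<le> q a" if aG: "(a, r) \<in> ?G" for a r
  proof -
    obtain y t where *: "y \<in> S" "0 \<le> t" "a = y + sc t x" "r = t * d"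
      using aG by auto
    show ?thesis
    proof (cases "t = 0")
      case False
      have "sc (- inverse t) y \<in> S"
        using * subspace_scale[OF S] by blast
      then have "t * d \<le> t * q (x - sc (- inverse t) y)"
        using d *(2) by (intro mult_left_mono)
      also have "\<dots> = q (sc t (x - sc (- inverse t) y))"
        using * by (simp add: q_sc)
      also have "sc t (x - sc (- inverse t) y) = a"
        using * False by (simp add: scale_right_distrib scale_right_diff_distrib add.commute)
      finally show ?thesis
        using * by simp
    qed (use * q_nonneg in auto)
  qed
  obtain f where f: "lin f" "\<And>y. f y \<le> q y" "\<And>y r. (y, r) \<in> ?G \<Longrightarrow> r \<le> f y"
    using mazur_orlicz[OF sublin_q cone le] by blast
  have "f \<in> uball"
    using lin_le_sublin_abs[of f q] q_minus f by (auto simp: uball_def)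
  moreover have "f y = 0" if "y \<in> S" for y
  proof -
    have "(z, 0) \<in> ?G" if "z \<in> S" for z
      using that by (auto intro!: exI[of _ z] exI[of _ "0::real"])
    then have "0 \<le> f y" "0 \<le> f (- y)"
      using f(3) that subspace_neg[OF S] by blast+
    then show ?thesis
      using lin_minus[OF f(1)] by simp
  qed
  moreover have "d \<le> f x"
    using f(3)[of x d] subspace_0[OF S] by (force intro!: exI[of _ "0::'v"] exI[of _ "1::real"])
  ultimately show ?thesis
    using that by blast
qed

definition dual_linear :: "(('v \<Rightarrow> real) \<Rightarrow> real) \<Rightarrow> bool"
  where "dual_linear \<phi> \<longleftrightarrow>
    (\<forall>f\<in>dual. \<forall>g\<in>dual. \<forall>a b. \<phi> (\<lambda>x. a * f x + b * g x) = a * \<phi> f + b * \<phi> g)"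

definition represented :: "(('v \<Rightarrow> real) \<Rightarrow> real) \<Rightarrow> bool"
  where "represented \<phi> \<longleftrightarrow> (\<exists>x. \<forall>f\<in>dual. \<phi> f = f x)"

lemma dual_linearD:
  "dual_linear \<phi> \<Longrightarrow> f \<in> dual \<Longrightarrow> g \<in> dual \<Longrightarrow> \<phi> (\<lambda>x. a * f x + b * g x) = a * \<phi> f + b * \<phi> g"
  by (auto simp: dual_linear_def)

lemma dual_linear_sc: "dual_linear \<phi> \<Longrightarrow> f \<in> dual \<Longrightarrow> \<phi> (\<lambda>x. c * f x) = c * \<phi> f"
  using dual_linearD[of \<phi> f f c 0] by simp

text \<open>Induction on the number of vectors: if some \<open>f\<close> annihilating \<open>S\<close> does not annihilate \<open>x\<close>,
  subtracting a multiple of the evaluation at \<open>x\<close> removes \<open>x\<close>.\<close>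

lemma vanishing_on_annihilator_represented:
  assumes "finite S" "dual_linear \<phi>"
    and "\<And>f. f \<in> dual \<Longrightarrow> (\<And>x. x \<in> S \<Longrightarrow> f x = 0) \<Longrightarrow> \<phi> f = 0"
  shows "represented \<phi>"
  using assms
proof (induction S arbitrary: \<phi> rule: finite_induct)
  case empty
  then show ?case
    using lin_0 dual_lin by (auto simp: represented_def intro!: exI[of _ 0])
next
  case (insert x S)
  show ?case
  proof (cases "\<exists>f0\<in>dual. (\<forall>y\<in>S. f0 y = 0) \<and> f0 x \<noteq> 0")
    case False
    then show ?thesis
      using insert.prems by (intro insert.IH) auto
  next
    case True
    then obtain f1 where f1: "f1 \<in> dual" "\<And>y. y \<in> S \<Longrightarrow> f1 y = 0" "f1 x \<noteq> 0"
      by blast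
    define f0 where "f0 y = (1 / f1 x) * f1 y" for y
    have f0: "f0 \<in> dual" "\<And>y. y \<in> S \<Longrightarrow> f0 y = 0" "f0 x = 1"
      using dual_sc[OF f1(1), of "1 / f1 x"] f1 by (auto simp: f0_def[abs_def])
    let ?\<phi> = "\<lambda>f. \<phi> f - \<phi> f0 * f x"
    have "dual_linear ?\<phi>"
      using dual_linearD[OF insert.prems(1)] by (simp add: dual_linear_def algebra_simps)
    moreover have "?\<phi> f = 0" if f: "f \<in> dual" "\<And>y. y \<in> S \<Longrightarrow> f y = 0" for f
    proof -
      let ?g = "\<lambda>y. 1 * f y + (- f x) * f0 y"
      have "\<phi> ?g = 0"
        using f f0 dual_comb[OF f(1) f0(1), of 1 "- f x"] by (intro insert.prems(2)) auto
      then show ?thesis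
        unfolding dual_linearD[OF insert.prems(1) f(1) f0(1)] by simp
    qed
    ultimately have "represented ?\<phi>"
      by (rule insert.IH)
    then obtain y where y: "\<forall>f\<in>dual. ?\<phi> f = f y"
      by (auto simp: represented_def)
    then have "\<phi> f = f (y + sc (\<phi> f0) x)" if "f \<in> dual" for f
      using that by (auto simp: lin_add[OF dual_lin] lin_sc[OF dual_lin] algebra_simps)
    then show ?thesis
      by (auto simp: represented_def)
  qed
qed

definition dnorm :: "('v \<Rightarrow> real) \<Rightarrow> real"
  where "dnorm f = (SUP x\<in>{x. q x \<le> 1}. \<bar>f x\<bar>)"

lemma dnorm_upper:
  assumes "f \<in> dual" "q x \<le> 1" shows "\<bar>f x\<bar> \<le> dnorm f"
proof -
  obtain C where C: "0 < C" "\<And>x. \<bar>f x\<bar> \<le> C * q x"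
    using dualE[OF assms(1)] by blast
  have "\<bar>f x\<bar> \<le> C" if "q x \<le> 1" for x
    using C(2)[of x] mult_left_mono[OF that, of C] C(1) by linarith
  then have "bdd_above ((\<lambda>x. \<bar>f x\<bar>) ` {x. q x \<le> 1})"
    by (auto intro!: bdd_aboveI2)
  then show ?thesis
    unfolding dnorm_def by (rule cSUP_upper2[where x=x]) (use assms in auto)
qed

lemma dnorm_least: "(\<And>x. q x \<le> 1 \<Longrightarrow> \<bar>f x\<bar> \<le> c) \<Longrightarrow> dnorm f \<le> c"
  unfolding dnorm_def by (rule cSUP_least) (auto intro!: exI[of _ 0] simp: q_0)

lemma dnorm_bound:
  assumes "f \<in> dual" shows "\<bar>f x\<bar> \<le> dnorm f * q x"
proof (cases "q x = 0")
  case True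
  then show ?thesis
    using dualE[OF assms] by (metis abs_le_zero_iff mult_zero_right)
next
  case False
  then have "0 < q x"
    using q_nonneg[of x] by simp
  then have "\<bar>f (sc (1 / q x) x)\<bar> \<le> dnorm f"
    by (intro dnorm_upper[OF assms]) (simp add: q_sc)
  then show ?thesis
    using \<open>0 < q x\<close> by (simp add: lin_sc[OF dual_lin[OF assms]] abs_mult field_simps)
qed

text \<open>Helly's theorem in dual form. If \<open>\<phi>\<close> is at most \<open>\<theta>\<close> on the unit ball of the annihilator of
  finitely many vectors, extend its restriction there with the same norm bound; the difference
  vanishes on the annihilator and is therefore an evaluation. The projection \<open>\<pi>\<close> onto the dual makes
  the dual norm a sublinear functional on all functions.\<close>

lemma helly:
  assumes \<phi>: "dual_linear \<phi>" and S: "finite S" and \<theta>: "0 \<le> \<theta>"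
    and bound: "\<And>f. f \<in> uball \<Longrightarrow> (\<And>x. x \<in> S \<Longrightarrow> f x = 0) \<Longrightarrow> \<phi> f \<le> \<theta>"
  shows "\<exists>x. \<forall>f\<in>uball. \<phi> f - f x \<le> \<theta>"
proof -
  interpret fs: real_vs "\<lambda>c (f :: 'v \<Rightarrow> real) x. c * f x"
    by unfold_locales (auto simp: fun_eq_iff algebra_simps)
  interpret fsp: vector_space_pair "\<lambda>c (f :: 'v \<Rightarrow> real) x. c * f x" "\<lambda>c (f :: 'v \<Rightarrow> real) x. c * f x"
    by unfold_locales
  have sub: "fs.subspace dual"
    unfolding fs.subspace_def
    using dual_add dual_sc by (auto simp: dual_def lin_def plus_fun_def intro!: exI[of _ 0])
  have "Vector_Spaces.linear (\<lambda>c (f :: 'v \<Rightarrow> real) x. c * f x) (\<lambda>c f x. c * f x) (\<lambda>f. f)"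
    by (auto simp: Vector_Spaces.linear_iff fs.vector_space_axioms)
  from fsp.linear_exists_left_inverse_on[OF this sub]
  obtain \<pi> where \<pi>: "range \<pi> \<subseteq> dual" "\<And>f. f \<in> dual \<Longrightarrow> \<pi> f = f"
    "Vector_Spaces.linear (\<lambda>c (f :: 'v \<Rightarrow> real) x. c * f x) (\<lambda>c f x. c * f x) \<pi>"
    by (auto simp: inj_on_def)
  have \<pi>_dual: "\<pi> f \<in> dual" for f
    using \<pi>(1) by auto
  have \<pi>_add: "\<pi> (f + g) = \<pi> f + \<pi> g" and \<pi>_sc: "\<pi> (\<lambda>x. c * f x) = (\<lambda>x. c * \<pi> f x)" for f g c
    using \<pi>(3) by (auto simp: Vector_Spaces.linear_iff)
  define p where "p f = \<theta> * dnorm (\<pi> f)" for f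
  have p: "fs.sublin p"
    unfolding fs.sublin_def
  proof (intro conjI allI impI)
    fix f g
    have "dnorm (\<pi> (f + g)) \<le> dnorm (\<pi> f) + dnorm (\<pi> g)"
    proof (rule dnorm_least)
      fix x assume x: "q x \<le> 1"
      show "\<bar>\<pi> (f + g) x\<bar> \<le> dnorm (\<pi> f) + dnorm (\<pi> g)"
        using dnorm_upper[OF \<pi>_dual x, of f] dnorm_upper[OF \<pi>_dual x, of g] by (simp add: \<pi>_add)
    qed
    then show "p (f + g) \<le> p f + p g"
      using \<theta> by (simp add: p_def mult_left_mono flip: distrib_left)
  next
    fix c :: real and f
    assume "0 < c"
    have "dnorm (\<pi> (\<lambda>x. c * f x)) \<le> c * dnorm (\<pi> f)"
    proof (rule dnorm_least)
      fix x assume x: "q x \<le> 1"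
      show "\<bar>\<pi> (\<lambda>x. c * f x) x\<bar> \<le> c * dnorm (\<pi> f)"
        using dnorm_upper[OF \<pi>_dual x, of f] \<open>0 < c\<close> by (simp add: \<pi>_sc abs_mult)
    qed
    then show "p (\<lambda>x. c * f x) \<le> c * p f"
      using mult_left_mono[OF _ \<theta>] by (fastforce simp: p_def mult.left_commute)
  qed
  let ?G = "{(f, \<phi> f) | f. f \<in> dual \<and> (\<forall>x\<in>S. f x = 0)}"
  have zero: "(\<lambda>x. 0) \<in> dual" "\<phi> (\<lambda>x. 0) = 0"
    using fs.subspace_0[OF sub] dual_linear_sc[OF \<phi>, of "\<lambda>x. 0" 0] by (auto simp: zero_fun_def)
  have cone: "fs.pair_cone ?G"
    unfolding fs.pair_cone_def
  proof (intro conjI allI impI)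
    show "(0, 0) \<in> ?G"
      using zero by (auto simp: zero_fun_def)
  next
    fix f r g s
    assume "(f, r) \<in> ?G" "(g, s) \<in> ?G"
    then show "(f + g, r + s) \<in> ?G"
      using dual_add[of f g] dual_linearD[OF \<phi>, of f g 1 1] by (auto simp: plus_fun_def)
  next
    fix c :: real and f r
    assume "0 < c" "(f, r) \<in> ?G"
    then show "((\<lambda>x. c * f x), c * r) \<in> ?G"
      using dual_sc[of f c] dual_linear_sc[OF \<phi>, of f c] by auto
  qed
  have le: "r \<le> p f" if "(f, r) \<in> ?G" for f r
  proof -
    have f: "f \<in> dual" "\<And>x. x \<in> S \<Longrightarrow> f x = 0" "r = \<phi> f"
      using that by auto
    have n: "0 \<le> dnorm f"
      using dnorm_upper[OF f(1), of 0] by (simp add: q_0)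
    show ?thesis
    proof (cases "dnorm f = 0")
      case True
      then have "f = (\<lambda>x. 0)"
        using dnorm_bound[OF f(1)] by (auto simp: fun_eq_iff)
      then show ?thesis
        using f zero True by (simp add: p_def \<pi>(2))
    next
      case False
      then have n': "0 < dnorm f" using n by simp
      let ?g = "\<lambda>x. (1 / dnorm f) * f x"
      have "?g \<in> uball"
        unfolding uball_def using dual_lin[OF dual_sc[OF f(1), of "1 / dnorm f"]] dnorm_bound[OF f(1)] n'
        by (auto simp: divide_simps abs_mult mult.commute)
      then have "\<phi> ?g \<le> \<theta>"
        using f by (intro bound) auto
      then have "(1 / dnorm f) * \<phi> f \<le> \<theta>"
        unfolding dual_linear_sc[OF \<phi> f(1)] .
      then show ?thesis
        using n' f by (simp add: p_def \<pi>(2) field_simps)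
    qed
  qed
  obtain \<psi> where \<psi>: "fs.lin \<psi>" "\<And>f. \<psi> f \<le> p f" "\<And>f r. (f, r) \<in> ?G \<Longrightarrow> r \<le> \<psi> f"
    using fs.mazur_orlicz[OF p cone le] by blast
  have \<psi>_comb: "\<psi> (\<lambda>x. a * f x + b * g x) = a * \<psi> f + b * \<psi> g" for a b f g
    using fs.lin_add[OF \<psi>(1), of "\<lambda>x. a * f x" "\<lambda>x. b * g x"] fs.lin_sc[OF \<psi>(1)]
    by (simp add: plus_fun_def)
  have "represented (\<lambda>f. \<phi> f - \<psi> f)"
  proof (rule vanishing_on_annihilator_represented[OF S])
    show "dual_linear (\<lambda>f. \<phi> f - \<psi> f)"
      using dual_linearD[OF \<phi>] by (simp add: dual_linear_def \<psi>_comb algebra_simps)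
    fix f assume f: "f \<in> dual" "\<And>x. x \<in> S \<Longrightarrow> f x = 0"
    have "(f, \<phi> f) \<in> ?G" "((\<lambda>x. -1 * f x), \<phi> (\<lambda>x. -1 * f x)) \<in> ?G"
      using f dual_sc[OF f(1), of "-1"] by auto
    then have "\<phi> f \<le> \<psi> f" "\<phi> (\<lambda>x. -1 * f x) \<le> \<psi> (\<lambda>x. -1 * f x)"
      using \<psi>(3) by blast+
    then show "\<phi> f - \<psi> f = 0"
      using dual_linear_sc[OF \<phi> f(1), of "-1"] fs.lin_sc[OF \<psi>(1), of "-1" f] by simp
  qed
  then obtain x where x: "\<And>f. f \<in> dual \<Longrightarrow> \<phi> f - \<psi> f = f x"
    by (auto simp: represented_def)
  have "\<phi> f - f x \<le> \<theta>" if f: "f \<in> uball" for f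
  proof -
    have "dnorm f \<le> 1"
      using uball_le[OF f] by (intro dnorm_least) (meson order_trans)
    then have "p f \<le> \<theta>"
      using \<theta> mult_left_mono[of "dnorm f" 1 \<theta>] by (simp add: p_def \<pi>(2)[OF uball_dual[OF f]])
    then show ?thesis
      using x[OF uball_dual[OF f]] \<psi>(2)[of f] by linarith
  qed
  then show ?thesis
    by blast
qed

text \<open>By completeness the evaluations form a norm closed subspace of the bidual.\<close>

lemma not_represented_dist:
  assumes \<phi>: "dual_linear \<phi>" and nr: "\<not> represented \<phi>"
  obtains \<theta> where "0 < \<theta>" "\<And>x. \<exists>f\<in>uball. \<theta> < \<phi> f - f x"
proof (rule ccontr)
  assume contra: "\<not> thesis"
  have "\<exists>x. \<forall>f\<in>uball. \<phi> f - f x \<le> inverse (real (Suc n))" for n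
    using contra that[of "inverse (real (Suc n))"] by (force simp: not_less)
  then obtain \<sigma> where \<sigma>: "\<And>n f. f \<in> uball \<Longrightarrow> \<phi> f - f (\<sigma> n) \<le> inverse (real (Suc n))"
    by metis
  have \<sigma>_abs: "\<bar>\<phi> f - f (\<sigma> n)\<bar> \<le> inverse (real (Suc n))" if f: "f \<in> uball" for f n
    using \<sigma>[OF f, of n] \<sigma>[OF uball_minus[OF f], of n]
      dual_linear_sc[OF \<phi> uball_dual[OF f], of "-1"] by (simp add: abs_le_iff)
  have q_le: "q (\<sigma> m - \<sigma> n) \<le> inverse (real (Suc m)) + inverse (real (Suc n))" for m n
  proof -
    obtain f where f: "f \<in> uball" "f (\<sigma> m - \<sigma> n) = q (\<sigma> m - \<sigma> n)"
      using norming_functional by blast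
    then show ?thesis
      using \<sigma>_abs[OF f(1), of m] \<sigma>_abs[OF f(1), of n]
      by (simp add: lin_diff[OF uball_lin] abs_le_iff)
  qed
  have "\<exists>x. (\<lambda>n. q (\<sigma> n - x)) \<longlonglongrightarrow> 0"
  proof (rule complete)
    fix e :: real assume "0 < e"
    then obtain N where N: "inverse (real (Suc N)) < e/2"
      using reals_Archimedean[of "e/2"] by auto
    have "q (\<sigma> m - \<sigma> n) < e" if "N \<le> m" "N \<le> n" for m n
    proof -
      have "inverse (real (Suc k)) \<le> inverse (real (Suc N))" if "N \<le> k" for k
        using that by (intro le_imp_inverse_le) auto
      from this[of m] this[of n] show ?thesis
        using that q_le[of m n] N by linarith
    qed
    then show "\<exists>N. \<forall>m\<ge>N. \<forall>n\<ge>N. q (\<sigma> m - \<sigma> n) < e"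
      by blast
  qed
  then obtain x where x: "(\<lambda>n. q (\<sigma> n - x)) \<longlonglongrightarrow> 0"
    by blast
  have on_uball: "\<phi> f = f x" if f: "f \<in> uball" for f
  proof -
    have "(\<lambda>n. inverse (real (Suc n)) + q (\<sigma> n - x)) \<longlonglongrightarrow> 0"
      using tendsto_add[OF LIMSEQ_inverse_real_of_nat x] by simp
    moreover have "\<bar>\<phi> f - f x\<bar> \<le> inverse (real (Suc n)) + q (\<sigma> n - x)" for n
      using \<sigma>_abs[OF f, of n] uball_le[OF f, of "\<sigma> n - x"] lin_diff[OF uball_lin[OF f]] by simp
    ultimately have "\<bar>\<phi> f - f x\<bar> \<le> 0"
      by (intro LIMSEQ_le_const) auto
    then show ?thesis by simp
  qed
  have "\<phi> f = f x" if f: "f \<in> dual" for f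
  proof -
    obtain C g where "0 < C" "g \<in> uball" "f = (\<lambda>x. C * g x)"
      using dual_scaled_uball[OF f] by blast
    then show ?thesis
      using on_uball dual_linear_sc[OF \<phi> uball_dual] by simp
  qed
  then show False
    using nr by (auto simp: represented_def)
qed

definition bidual_closure :: "'v set \<Rightarrow> (('v \<Rightarrow> real) \<Rightarrow> real) \<Rightarrow> bool"
  where "bidual_closure A \<phi> \<longleftrightarrow>
    (\<forall>G \<epsilon>. finite G \<longrightarrow> G \<subseteq> dual \<longrightarrow> 0 < \<epsilon> \<longrightarrow> (\<exists>a\<in>A. \<forall>g\<in>G. \<bar>g a - \<phi> g\<bar> < \<epsilon>))"

lemma bidual_closureD:
  "bidual_closure A \<phi> \<Longrightarrow> finite G \<Longrightarrow> G \<subseteq> dual \<Longrightarrow> 0 < \<epsilon> \<Longrightarrow> \<exists>a\<in>A. \<forall>g\<in>G. \<bar>g a - \<phi> g\<bar> < \<epsilon>"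
  by (simp add: bidual_closure_def)

lemma bidual_closure_linear:
  assumes "bidual_closure A \<phi>" shows "dual_linear \<phi>"
  unfolding dual_linear_def
proof (intro ballI allI)
  fix f g a b
  assume fg: "f \<in> dual" "g \<in> dual"
  let ?h = "\<lambda>x. a * f x + b * g x"
  have "\<bar>\<phi> ?h - (a * \<phi> f + b * \<phi> g)\<bar> \<le> 0 + e" if e: "0 < e" for e
  proof -
    define d where "d = e / (1 + \<bar>a\<bar> + \<bar>b\<bar>)"
    have pos: "0 < 1 + \<bar>a\<bar> + \<bar>b\<bar>"
      by simp
    then have "d * (1 + \<bar>a\<bar> + \<bar>b\<bar>) = e" "0 < d"
      using e by (simp_all add: d_def)
    moreover have "d * (1 + \<bar>a\<bar> + \<bar>b\<bar>) = d + \<bar>a\<bar> * d + \<bar>b\<bar> * d"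
      by (simp add: algebra_simps)
    ultimately have d: "0 < d" "e = d + \<bar>a\<bar> * d + \<bar>b\<bar> * d"
      by simp_all
    have "finite {f, g, ?h}" "{f, g, ?h} \<subseteq> dual"
      using fg dual_comb[OF fg, of a b] by auto
    from bidual_closureD[OF assms this d(1)] obtain x where
      x: "\<bar>f x - \<phi> f\<bar> < d" "\<bar>g x - \<phi> g\<bar> < d" "\<bar>?h x - \<phi> ?h\<bar> < d"
      by auto
    have "\<bar>a * (f x - \<phi> f)\<bar> \<le> \<bar>a\<bar> * d" "\<bar>b * (g x - \<phi> g)\<bar> \<le> \<bar>b\<bar> * d"
      using x(1,2) by (auto simp only: abs_mult intro!: mult_left_mono)
    moreover have "\<phi> ?h - (a * \<phi> f + b * \<phi> g) =
        - (?h x - \<phi> ?h) + a * (f x - \<phi> f) + b * (g x - \<phi> g)"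
      by (simp add: algebra_simps)
    ultimately show ?thesis
      using x(3) d(2) by linarith
  qed
  then have "\<bar>\<phi> ?h - (a * \<phi> f + b * \<phi> g)\<bar> \<le> 0"
    by (rule field_le_epsilon)
  then show "\<phi> ?h = a * \<phi> f + b * \<phi> g"
    by simp
qed

text \<open>The triangular array of James: \<open>f\<^sub>m\<close> is chosen by Helly's theorem to annihilate the earlier
  \<open>x\<^sub>n\<close> while \<open>\<phi> f\<^sub>m\<close> stays above \<open>\<theta>\<close>, and \<open>x\<^sub>n\<close> then imitates \<open>\<phi>\<close> on the functionals found so far.\<close>

lemma james_array:
  assumes \<phi>: "bidual_closure A \<phi>" and nr: "\<not> represented \<phi>"
  obtains \<theta> f x where "0 < \<theta>" "\<And>n::nat. f n \<in> uball" "\<And>n::nat. x n \<in> A"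
    "\<And>m n. m \<le> n \<Longrightarrow> \<theta> < f m (x n)" "\<And>m n. n < m \<Longrightarrow> f m (x n) = 0"
proof -
  have lin\<phi>: "dual_linear \<phi>"
    using \<phi> by (rule bidual_closure_linear)
  obtain \<theta> where \<theta>: "0 < \<theta>" "\<And>x. \<exists>f\<in>uball. \<theta> < \<phi> f - f x"
    using not_represented_dist[OF lin\<phi> nr] by blast
  define P where "P s \<longleftrightarrow> (case s of (f, x, S, T) \<Rightarrow>
      finite S \<and> S \<subseteq> A \<and> finite T \<and> T \<subseteq> uball \<and> (\<forall>g\<in>T. \<theta> < \<phi> g) \<and> f \<in> T \<and> x \<in> S \<and> (\<forall>g\<in>T. \<theta> < g x))"
    for s :: "('v \<Rightarrow> real) \<times> 'v \<times> 'v set \<times> ('v \<Rightarrow> real) set"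
  define Q where "Q s s' \<longleftrightarrow> (case s of (f, x, S, T) \<Rightarrow> case s' of (f', x', S', T') \<Rightarrow>
      S \<subseteq> S' \<and> T \<subseteq> T' \<and> (\<forall>y\<in>S. f' y = 0))"
    for s s' :: "('v \<Rightarrow> real) \<times> 'v \<times> 'v set \<times> ('v \<Rightarrow> real) set"
  have step: "\<exists>f' x'. P (f', x', insert x' S, insert f' T) \<and> (\<forall>y\<in>S. f' y = 0)"
    if S: "finite S" "S \<subseteq> A" and T: "finite T" "T \<subseteq> uball" "\<And>g. g \<in> T \<Longrightarrow> \<theta> < \<phi> g" for S T
  proof -
    have "\<not> (\<forall>f\<in>uball. (\<forall>x\<in>S. f x = 0) \<longrightarrow> \<phi> f \<le> \<theta>)"
      using helly[OF lin\<phi> S(1), of \<theta>] \<theta> by (metis less_imp_le not_le)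
    then obtain f' where f': "f' \<in> uball" "\<And>x. x \<in> S \<Longrightarrow> f' x = 0" "\<theta> < \<phi> f'"
      by force
    define \<epsilon> where "\<epsilon> = Min ((\<lambda>g. \<phi> g - \<theta>) ` insert f' T)"
    have \<epsilon>: "0 < \<epsilon>" "\<And>g. g \<in> insert f' T \<Longrightarrow> \<epsilon> \<le> \<phi> g - \<theta>"
      using T f' by (auto simp: \<epsilon>_def)
    have "insert f' T \<subseteq> dual"
      using T f' uball_dual by auto
    from bidual_closureD[OF \<phi> _ this \<epsilon>(1)] T(1)
    obtain x' where x': "x' \<in> A" "\<And>g. g \<in> insert f' T \<Longrightarrow> \<bar>g x' - \<phi> g\<bar> < \<epsilon>"
      by auto
    have "\<theta> < g x'" if "g \<in> insert f' T" for g
      using \<epsilon>(2)[OF that] x'(2)[OF that] by linarith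
    then have "P (f', x', insert x' S, insert f' T)"
      using S T f' x'(1) by (auto simp: P_def)
    then show ?thesis
      using f'(2) by blast
  qed
  have "\<exists>\<sigma>. \<forall>n. P (\<sigma> n) \<and> Q (\<sigma> n) (\<sigma> (Suc n))"
  proof (rule dependent_nat_choice[of "\<lambda>_. P" "\<lambda>_. Q"])
    show "\<exists>s. P s"
      using step[of "{}" "{}"] by auto
    fix s assume "P s"
    obtain f x S T where s: "s = (f, x, S, T)"
      by (metis prod_cases4)
    have "\<exists>f' x'. P (f', x', insert x' S, insert f' T) \<and> (\<forall>y\<in>S. f' y = 0)"
      using \<open>P s\<close> by (intro step) (auto simp: P_def s)
    then obtain f' x' where "P (f', x', insert x' S, insert f' T)" "\<forall>y\<in>S. f' y = 0"
      by blast
    then show "\<exists>s'. P s' \<and> Q s s'"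
      by (intro exI[of _ "(f', x', insert x' S, insert f' T)"]) (auto simp: Q_def s)
  qed
  then obtain \<sigma> where \<sigma>: "\<And>n. P (\<sigma> n)" "\<And>n. Q (\<sigma> n) (\<sigma> (Suc n))"
    by blast
  define f where "f n = fst (\<sigma> n)" for n
  define x where "x n = fst (snd (\<sigma> n))" for n
  define S where "S n = fst (snd (snd (\<sigma> n)))" for n
  define T where "T n = snd (snd (snd (\<sigma> n)))" for n
  note defs = f_def x_def S_def T_def
  have P: "S n \<subseteq> A" "T n \<subseteq> uball" "f n \<in> T n" "x n \<in> S n" "\<And>g. g \<in> T n \<Longrightarrow> \<theta> < g (x n)" for n
    using \<sigma>(1)[of n] by (auto simp: P_def defs split: prod.splits)
  have Q: "S n \<subseteq> S (Suc n)" "T n \<subseteq> T (Suc n)" "\<And>y. y \<in> S n \<Longrightarrow> f (Suc n) y = 0" for n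
    using \<sigma>(2)[of n] by (auto simp: Q_def defs split: prod.splits)
  have Smono: "S m \<subseteq> S n" and Tmono: "T m \<subseteq> T n" if "m \<le> n" for m n
    using lift_Suc_mono_le[of S, OF Q(1) that] lift_Suc_mono_le[of T, OF Q(2) that] by blast+
  show ?thesis
  proof (rule that[OF \<theta>(1)])
    show "f n \<in> uball" "x n \<in> A" for n
      using P(1-4) by blast+
    show "\<theta> < f m (x n)" if "m \<le> n" for m n
      using Tmono[OF that] P by blast
    show "f m (x n) = 0" if "n < m" for m n
    proof -
      obtain k where k: "m = Suc k" "n \<le> k"
        using \<open>n < m\<close> by (metis less_Suc_eq_le lessE)
      then show ?thesis
        using Smono[OF k(2)] P(4) Q(3) by blast
    qed
  qed
qed

end

section \<open>Accumulation points and weakly convergent subsequences\<close>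

definition accumulates :: "('v \<Rightarrow> real) set \<Rightarrow> (nat \<Rightarrow> 'v) \<Rightarrow> 'v \<Rightarrow> bool"
  where "accumulates D \<sigma> z \<longleftrightarrow>
    (\<forall>G \<epsilon>. finite G \<longrightarrow> G \<subseteq> D \<longrightarrow> 0 < \<epsilon> \<longrightarrow> (\<exists>\<^sub>\<infinity>n. \<forall>g\<in>G. \<bar>g (\<sigma> n) - g z\<bar> < \<epsilon>))"

definition seq_accumulating :: "('v \<Rightarrow> real) set \<Rightarrow> 'v set \<Rightarrow> bool"
  where "seq_accumulating D A \<longleftrightarrow> (\<forall>\<sigma>. range \<sigma> \<subseteq> A \<longrightarrow> (\<exists>z. accumulates D \<sigma> z))"

lemma accumulatesD:
  assumes "accumulates D \<sigma> z" "f \<in> D" "0 < \<epsilon>"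
  obtains n where "N \<le> n" "\<bar>f (\<sigma> n) - f z\<bar> < \<epsilon>"
proof -
  have "\<exists>\<^sub>\<infinity>n. \<forall>g\<in>{f}. \<bar>g (\<sigma> n) - g z\<bar> < \<epsilon>"
    using assms unfolding accumulates_def by blast
  then show ?thesis
    using that by (auto simp: INFM_nat_le)
qed

lemma accumulates_limit:
  assumes z: "accumulates D \<sigma> z" "f \<in> D" and l: "(\<lambda>n. f (\<sigma> n)) \<longlonglongrightarrow> l"
  shows "f z = l"
proof (rule ccontr)
  assume "f z \<noteq> l"
  then have e: "0 < \<bar>f z - l\<bar> / 2" by simp
  obtain N where N: "\<And>n. N \<le> n \<Longrightarrow> \<bar>f (\<sigma> n) - l\<bar> < \<bar>f z - l\<bar> / 2"
    using LIMSEQ_D[OF l e] by auto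
  obtain n where n: "N \<le> n" "\<bar>f (\<sigma> n) - f z\<bar> < \<bar>f z - l\<bar> / 2"
    using accumulatesD[OF z e] by blast
  moreover have "\<bar>f z - l\<bar> \<le> \<bar>f (\<sigma> n) - l\<bar> + \<bar>f (\<sigma> n) - f z\<bar>"
    by linarith
  ultimately show False
    using N[OF n(1)] by argo
qed

lemma seq_accumulating_bounded:
  assumes "seq_accumulating D A" "f \<in> D"
  obtains C where "\<And>a. a \<in> A \<Longrightarrow> \<bar>f a\<bar> \<le> C"
proof (rule ccontr)
  assume contra: "\<not> thesis"
  have "\<exists>a\<in>A. real n < \<bar>f a\<bar>" for n
    using contra that[of "real n"] by force
  then obtain \<sigma> where \<sigma>: "\<And>n. \<sigma> n \<in> A" "\<And>n. real n < \<bar>f (\<sigma> n)\<bar>"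
    by metis
  from \<sigma>(1) have "range \<sigma> \<subseteq> A"
    by blast
  then obtain z where z: "accumulates D \<sigma> z"
    using assms(1) unfolding seq_accumulating_def by blast
  obtain N where N: "\<bar>f z\<bar> + 1 \<le> real N"
    using real_arch_simple by blast
  obtain n where "N \<le> n" "\<bar>f (\<sigma> n) - f z\<bar> < 1"
    using accumulatesD[OF z assms(2), of 1] by auto
  then show False
    using N \<sigma>(2)[of n] by linarith
qed

lemma seq_accumulating_mono: "seq_accumulating D A \<Longrightarrow> D' \<subseteq> D \<Longrightarrow> seq_accumulating D' A"
  by (meson accumulates_def seq_accumulating_def subset_trans)

lemma diagonal_convergent_subsequence:
  fixes u :: "nat \<Rightarrow> nat \<Rightarrow> real"
  assumes bound: "\<And>k n. \<bar>u k n\<bar> \<le> C k"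
  obtains r where "strict_mono r" "\<And>k. convergent (\<lambda>n. u k (r n))"
proof -
  interpret subseqs "\<lambda>k s. convergent (\<lambda>n. u k (s n))"
  proof
    fix k and s :: "nat \<Rightarrow> nat"
    have "bounded (range (\<lambda>n. u k (s n)))"
      using bound by (auto simp: bounded_iff)
    from bounded_imp_convergent_subsequence[OF this]
    obtain l r where "strict_mono r" "((\<lambda>n. u k (s n)) \<circ> r) \<longlonglongrightarrow> l"
      by auto
    then show "\<exists>r'. strict_mono r' \<and> convergent (\<lambda>n. u k ((s \<circ> r') n))"
      by (auto simp: convergent_def o_def)
  qed
  have "convergent (\<lambda>n. u k (diagseq n))" for k
  proof -
    have "convergent (\<lambda>n. u k ((diagseq \<circ> (+) (Suc k)) n))"
    proof (rule diagseq_holds)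
      fix r s :: "nat \<Rightarrow> nat" and k
      assume "strict_mono r" "convergent (\<lambda>n. u k (s n))"
      then show "convergent (\<lambda>n. u k ((s \<circ> r) n))"
        using convergent_subseq_convergent[of "\<lambda>n. u k (s n)" r] by (simp add: o_def)
    qed
    then have "convergent (\<lambda>n. u k (diagseq (n + Suc k)))"
      by (simp add: add.commute)
    then show ?thesis
      using convergent_ignore_initial_segment[of "\<lambda>n. u k (diagseq n)" "Suc k"] by simp
  qed
  then show ?thesis
    using that subseq_diagseq by blast
qed

context complete_seminormed
begin

text \<open>Mazur's theorem for subspaces.\<close>

lemma accumulation_in_closure:
  assumes z: "accumulates dual \<sigma> z" and S: "subspace S" "range \<sigma> \<subseteq> S" and "0 < e"
  obtains y where "y \<in> S" "q (z - y) < e"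
proof (rule ccontr)
  note that_y = that
  assume contra: "\<not> thesis"
  have "e \<le> q (z - y)" if "y \<in> S" for y
    using contra that_y[of y] that by force
  then obtain f where f: "f \<in> uball" "\<And>y. y \<in> S \<Longrightarrow> f y = 0" "e \<le> f z"
    using separating_functional[OF S(1)] by blast
  obtain n :: nat where "\<bar>f (\<sigma> n) - f z\<bar> < e"
    using accumulatesD[OF z uball_dual[OF f(1)] \<open>0 < e\<close>] by blast
  moreover have "f (\<sigma> n) = 0"
    using f(2) S(2) by blast
  ultimately show False
    using f(3) by simp
qed

text \<open>An accumulation point \<open>z\<close> of the sequence in the array has \<open>f\<^sub>m z \<ge> \<theta>\<close> for all \<open>m\<close>; yet it is
  norm close to a combination of the \<open>x\<^sub>n\<close>, which almost all \<open>f\<^sub>m\<close> annihilate.\<close>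

theorem seq_accumulating_represented:
  assumes A: "seq_accumulating dual A" and \<phi>: "bidual_closure A \<phi>"
  shows "represented \<phi>"
proof (rule ccontr)
  assume "\<not> represented \<phi>"
  then obtain \<theta> f x where \<theta>: "0 < \<theta>" and f: "\<And>n::nat. f n \<in> uball" and x: "\<And>n::nat. x n \<in> A"
    and big: "\<And>m n. m \<le> n \<Longrightarrow> \<theta> < f m (x n)" and zero: "\<And>m n. n < m \<Longrightarrow> f m (x n) = 0"
    using james_array[OF \<phi>] by blast
  obtain z where z: "accumulates dual x z"
    using A x unfolding seq_accumulating_def by (metis image_subset_iff)
  have fz: "\<theta> \<le> f m z" for m
  proof (rule field_le_epsilon)
    fix e :: real assume "0 < e"
    then obtain n where "m \<le> n" "\<bar>f m (x n) - f m z\<bar> < e"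
      using accumulatesD[OF z uball_dual[OF f]] by metis
    then show "\<theta> \<le> f m z + e"
      using big[of m n] by linarith
  qed
  obtain y where y: "y \<in> span (range x)" "q (z - y) < \<theta>"
    using accumulation_in_closure[OF z subspace_span span_superset \<theta>] by blast
  have "span (range x) \<subseteq> {y. \<forall>\<^sub>F m in sequentially. f m y = 0}"
  proof (rule span_minimal)
    show "range x \<subseteq> {y. \<forall>\<^sub>F m in sequentially. f m y = 0}"
    proof clarsimp
      fix n
      show "\<forall>\<^sub>F m in sequentially. f m (x n) = 0"
        using eventually_gt_at_top[of n] by eventually_elim (rule zero)
    qed
    show "subspace {y. \<forall>\<^sub>F m in sequentially. f m y = 0}"
      unfolding subspace_def
      by (auto simp: lin_0[OF uball_lin[OF f]] lin_add[OF uball_lin[OF f]] lin_sc[OF uball_lin[OF f]]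
          elim: eventually_elim2 eventually_mono)
  qed
  then have "\<forall>\<^sub>F m in sequentially. f m y = 0"
    using y(1) by blast
  then obtain m where "f m y = 0"
    using eventually_happens by force
  then show False
    using fz[of m] uball_le[OF f, of m "z - y"] lin_diff[OF uball_lin[OF f]] y(2) by simp
qed

lemma countable_dense_in_span:
  fixes x :: "nat \<Rightarrow> 'v"
  obtains Z where "countable Z" "\<And>y e. y \<in> span (range x) \<Longrightarrow> 0 < e \<Longrightarrow> \<exists>z\<in>Z. q (y - z) < e"
proof -
  define Z where "Z = range (\<lambda>l :: (rat \<times> nat) list. \<Sum>(c, i)\<leftarrow>l. sc (of_rat c) (x i))"
  have "\<forall>e>0. \<exists>z\<in>Z. q (y - z) < e" if "y \<in> span (range x)" for y
    using that
  proof (induction y rule: span_induct_alt)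
    case base
    have "0 \<in> Z"
      by (auto simp: Z_def intro!: image_eqI[of _ _ "[]"])
    then show ?case
      using q_0 by force
  next
    case (step c w y)
    then obtain i where i: "w = x i" by blast
    show ?case
    proof (intro allI impI)
      fix e :: real assume "0 < e"
      then obtain z where z: "z \<in> Z" "q (y - z) < e/2"
        using step.IH by (meson half_gt_zero)
      then obtain l where l: "z = (\<Sum>(c, i)\<leftarrow>l. sc (of_rat c) (x i))"
        by (auto simp: Z_def)
      define d where "d = e / 2 / (q (x i) + 1)"
      have qi: "0 < q (x i) + 1"
        using q_nonneg[of "x i"] by linarith
      then have "0 < d"
        using \<open>0 < e\<close> by (simp add: d_def)
      then obtain b where b: "c < of_rat b" "of_rat b < c + d"
        using of_rat_dense[of c "c + d"] by auto
      have "sc (of_rat b) (x i) + z \<in> Z"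
        unfolding Z_def l by (rule image_eqI[of _ _ "(b, i) # l"]) auto
      moreover have "q (sc c w + y - (sc (of_rat b) (x i) + z)) < e"
      proof -
        have "sc c w + y - (sc (of_rat b) (x i) + z) = sc (c - of_rat b) (x i) + (y - z)"
          unfolding i scale_left_diff_distrib by (simp only: algebra_simps)
        then have "q (sc c w + y - (sc (of_rat b) (x i) + z)) \<le> \<bar>c - of_rat b\<bar> * q (x i) + q (y - z)"
          by (metis q_add q_sc)
        moreover have "\<bar>c - of_rat b\<bar> * q (x i) \<le> d * (q (x i) + 1)"
          using b q_nonneg[of "x i"] by (intro mult_mono) auto
        moreover have "d * (q (x i) + 1) = e/2"
          using qi unfolding d_def by (metis less_irrefl nonzero_eq_divide_eq)
        ultimately show ?thesis
          using z(2) by linarith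
      qed
      ultimately show "\<exists>z\<in>Z. q (sc c w + y - z) < e"
        by blast
    qed
  qed
  moreover have "countable Z"
    by (simp add: Z_def)
  ultimately show ?thesis
    using that by blast
qed

text \<open>Norming functionals of a countable dense set.\<close>

lemma countable_separating:
  fixes x :: "nat \<Rightarrow> 'v"
  obtains h :: "nat \<Rightarrow> 'v \<Rightarrow> real" where "\<And>k. h k \<in> uball"
    "\<And>w. (\<And>e. 0 < e \<Longrightarrow> \<exists>y\<in>span (range x). q (w - y) < e) \<Longrightarrow> (\<And>k. h k w = 0) \<Longrightarrow> q w = 0"
proof -
  obtain Z where Z: "countable Z" "\<And>y e. y \<in> span (range x) \<Longrightarrow> 0 < e \<Longrightarrow> \<exists>z\<in>Z. q (y - z) < e"
    using countable_dense_in_span by blast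
  have "\<forall>z. \<exists>f. f \<in> uball \<and> f z = q z"
    using norming_functional by metis
  then obtain F where F: "\<And>z. F z \<in> uball" "\<And>z. F z z = q z"
    by metis
  have "Z \<noteq> {}"
    using Z(2)[OF span_zero, of 1] by auto
  define h where "h k = F (from_nat_into Z k)" for k
  have "q w = 0" if w: "\<And>e. 0 < e \<Longrightarrow> \<exists>y\<in>span (range x). q (w - y) < e" and hw: "\<And>k. h k w = 0" for w
  proof -
    have "q w \<le> 0 + e" if "0 < e" for e
    proof -
      obtain y where y: "y \<in> span (range x)" "q (w - y) < e/4"
        using w[of "e/4"] \<open>0 < e\<close> by (meson divide_pos_pos zero_less_numeral)
      obtain z where z: "z \<in> Z" "q (y - z) < e/4"
        using Z(2)[OF y(1), of "e/4"] \<open>0 < e\<close> by auto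
      have wz: "q (w - z) < e/2"
        using q_triangle[of w z y] y z by linarith
      obtain k where k: "from_nat_into Z k = z"
        using from_nat_into_surj[OF Z(1) z(1)] by blast
      have "F z w = 0"
        using hw[of k] k by (simp add: h_def)
      then have "q z \<le> q (w - z)"
        using uball_le[OF F(1), of z "w - z"] lin_diff[OF uball_lin[OF F(1)], of z w z] F(2)[of z] by simp
      then show ?thesis
        using wz q_add[of "w - z" z] by simp
    qed
    then have "q w \<le> 0"
      by (rule field_le_epsilon)
    then show ?thesis
      using q_nonneg[of w] by simp
  qed
  moreover have "h k \<in> uball" for k
    by (simp add: h_def F)
  ultimately show ?thesis
    using that by blast
qed

text \<open>A diagonal argument makes countably many functionals converge along a subsequence. If these
  separate the closed span of the sequence, the subsequence has essentially one accumulation point,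
  and having accumulation points along every further subsequence it must converge to it.\<close>

theorem seq_accumulating_convergent_subsequence:
  assumes A: "seq_accumulating dual A" and \<sigma>: "range \<sigma> \<subseteq> A"
  obtains r z where "strict_mono (r :: nat \<Rightarrow> nat)" "\<And>f. f \<in> dual \<Longrightarrow> (\<lambda>n. f (\<sigma> (r n))) \<longlonglongrightarrow> f z"
proof -
  obtain h where h: "\<And>k::nat. h k \<in> uball"
    and sep: "\<And>w. (\<And>e. 0 < e \<Longrightarrow> \<exists>y\<in>span (range \<sigma>). q (w - y) < e) \<Longrightarrow> (\<And>k. h k w = 0) \<Longrightarrow> q w = 0"
    using countable_separating[of \<sigma>] by blast
  have "\<exists>C. \<forall>a\<in>A. \<bar>h k a\<bar> \<le> C" for k
    using seq_accumulating_bounded[OF A uball_dual[OF h]] by metis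
  then obtain C where "\<And>k a. a \<in> A \<Longrightarrow> \<bar>h k a\<bar> \<le> C k"
    by metis
  then have hC: "\<bar>h k (\<sigma> n)\<bar> \<le> C k" for k n
    using \<sigma> by (meson range_subsetD)
  obtain r where r: "strict_mono r" "\<And>k. convergent (\<lambda>n. h k (\<sigma> (r n)))"
    by (rule diagonal_convergent_subsequence[of "\<lambda>k n. h k (\<sigma> n)", OF hC]) (rule that)
  have "range (\<sigma> \<circ> s) \<subseteq> range \<sigma>" for s :: "nat \<Rightarrow> nat"
    by auto
  note sub = order_trans[OF this \<sigma>] order_trans[OF this span_superset[of "range \<sigma>"]]
  obtain z where z: "accumulates dual (\<sigma> \<circ> r) z"
    using A sub unfolding seq_accumulating_def by blast
  have unique: "f z' = f z"
    if s: "strict_mono s" "accumulates dual (\<sigma> \<circ> r \<circ> s) z'" and f: "f \<in> dual" for s z' f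
  proof -
    have "q (z' - z) = 0"
    proof (rule sep)
      fix e :: real assume "0 < e"
      obtain y where y: "y \<in> span (range \<sigma>)" "q (z - y) < e/2"
        using accumulation_in_closure[OF z subspace_span sub(2), of "e/2"] \<open>0 < e\<close> by auto
      obtain y' where y': "y' \<in> span (range \<sigma>)" "q (z' - y') < e/2"
        using accumulation_in_closure[OF s(2)[unfolded comp_assoc] subspace_span sub(2), of "e/2"] \<open>0 < e\<close>
        by auto
      have "q ((z' - z) - (y' - y)) < e"
        using q_add[of "z' - y'" "y - z"] y(2) y'(2) q_minus_commute[of y z] by (simp add: algebra_simps)
      then show "\<exists>y\<in>span (range \<sigma>). q (z' - z - y) < e"
        using span_diff[OF y'(1) y(1)] by blast
    next
      fix k
      obtain l where l: "(\<lambda>n. h k (\<sigma> (r n))) \<longlonglongrightarrow> l"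
        using r(2) by (auto simp: convergent_def)
      have "h k z = l"
        using accumulates_limit[OF z uball_dual[OF h], of k l] l by simp
      moreover have "h k z' = l"
        using accumulates_limit[OF s(2) uball_dual[OF h], of k l] LIMSEQ_subseq_LIMSEQ[OF l s(1)]
        by (simp add: o_def)
      ultimately show "h k (z' - z) = 0"
        by (simp add: lin_diff[OF uball_lin[OF h]])
    qed
    then show ?thesis
      using dualE[OF f] lin_diff[OF dual_lin[OF f], of z' z]
      by (metis abs_le_zero_iff mult_zero_right right_minus_eq)
  qed
  have "(\<lambda>n. f (\<sigma> (r n))) \<longlonglongrightarrow> f z" if f: "f \<in> dual" for f
  proof (rule ccontr)
    assume "\<not> (\<lambda>n. f (\<sigma> (r n))) \<longlonglongrightarrow> f z"
    then obtain e where e: "0 < e" "\<And>N. \<exists>n\<ge>N. e \<le> \<bar>f (\<sigma> (r n)) - f z\<bar>"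
      by (auto simp: LIMSEQ_iff not_less)
    then have "infinite {n. e \<le> \<bar>f (\<sigma> (r n)) - f z\<bar>}"
      by (auto simp: infinite_nat_iff_unbounded_le)
    then obtain s :: "nat \<Rightarrow> nat" where s: "strict_mono s" "\<And>n. s n \<in> {n. e \<le> \<bar>f (\<sigma> (r n)) - f z\<bar>}"
      using infinite_enumerate by blast
    obtain z' where z': "accumulates dual (\<sigma> \<circ> r \<circ> s) z'"
      using A sub unfolding seq_accumulating_def comp_assoc by blast
    obtain n :: nat where "\<bar>f ((\<sigma> \<circ> r \<circ> s) n) - f z'\<bar> < e"
      using accumulatesD[OF z' f e(1)] by blast
    then show False
      using s(2)[of n] unique[OF s(1) z' f] by simp
  qed
  then show ?thesis
    using that r(1) by blast
qed

end

section \<open>Series of functionals and uniform boundedness\<close>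

lemma geometric_tail_bound:
  fixes u :: "nat \<Rightarrow> real"
  assumes u: "u sums s" and bound: "\<And>i. \<bar>u i\<bar> \<le> K * \<rho> ^ i" and \<rho>: "0 \<le> \<rho>" "\<rho> < 1"
  shows "\<bar>s - (\<Sum>i<n. u i)\<bar> \<le> K * \<rho> ^ n / (1 - \<rho>)"
proof -
  have tail: "(\<lambda>i. u (i + n)) sums (s - (\<Sum>i<n. u i))"
    using u by (simp add: sums_iff_shift)
  have geo: "(\<lambda>i. K * \<rho> ^ n * \<rho> ^ i) sums (K * \<rho> ^ n * (1 / (1 - \<rho>)))"
    using \<rho> by (intro sums_mult geometric_sums) simp
  have le: "\<bar>u (i + n)\<bar> \<le> K * \<rho> ^ n * \<rho> ^ i" for i
    using bound[of "i + n"] by (simp add: power_add algebra_simps)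
  have "s - (\<Sum>i<n. u i) \<le> K * \<rho> ^ n * (1 / (1 - \<rho>))"
    by (rule sums_le[OF _ tail geo]) (use le abs_le_D1 in blast)
  moreover have "- (s - (\<Sum>i<n. u i)) \<le> K * \<rho> ^ n * (1 / (1 - \<rho>))"
    by (rule sums_le[OF _ sums_minus[OF tail] geo]) (use le abs_le_D2 in blast)
  ultimately show ?thesis
    by (simp add: abs_le_iff)
qed

context complete_seminormed
begin

lemma geometric_series_dual:
  fixes c :: "nat \<Rightarrow> real"
  assumes f: "\<And>n. lin (f n)" "\<And>n x. \<bar>f n x\<bar> \<le> K * q x"
    and c: "\<And>n. \<bar>c n\<bar> \<le> \<rho> ^ n" and \<rho>: "0 \<le> \<rho>" "\<rho> < 1"
  obtains F where "F \<in> dual" "\<And>x. (\<lambda>n. c n * f n x) sums F x"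
proof -
  have le: "\<bar>c n * f n x\<bar> \<le> (K * q x) * \<rho> ^ n" for n x
    unfolding abs_mult using mult_mono[OF c[of n] f(2)[of n x]] \<rho> by (simp add: algebra_simps)
  have "summable (\<lambda>n. (K * q x) * \<rho> ^ n)" for x
    using \<rho> by (intro summable_mult summable_geometric) simp
  then have sm: "summable (\<lambda>n. c n * f n x)" for x
    by (rule summable_comparison_test'[where N = 0]) (use le in simp)
  define F where "F x = (\<Sum>n. c n * f n x)" for x
  have sums: "(\<lambda>n. c n * f n x) sums F x" for x
    unfolding F_def using sm by (rule summable_sums)
  have "F (x + y) = F x + F y" for x y
    using sums_unique2[OF sums[of "x + y"], of "F x + F y"] sums_add[OF sums[of x] sums[of y]]
    by (simp add: lin_add[OF f(1)] algebra_simps)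
  moreover have "F (sc a x) = a * F x" for a x
    using sums_unique2[OF sums[of "sc a x"], of "a * F x"] sums_mult[OF sums[of x], of a]
    by (simp add: lin_sc[OF f(1)] algebra_simps)
  moreover have "\<bar>F x\<bar> \<le> (K / (1 - \<rho>)) * q x" for x
    using geometric_tail_bound[OF sums le \<rho>, of x 0] by (simp add: mult.commute)
  ultimately have "F \<in> dual"
    unfolding dual_def lin_def by blast
  then show ?thesis
    using that sums by blast
qed

text \<open>A gliding hump: let \<open>f\<^sub>n\<close> norm some \<open>a\<^sub>n \<in> A\<close> with \<open>q a\<^sub>n > 4\<^sup>n\<close>. In \<open>\<Sum> \<plusminus>3\<^sup>-\<^sup>n f\<^sub>n\<close> one of the two
  signs makes the partial sum at least \<open>3\<^sup>-\<^sup>n q a\<^sub>n\<close> at \<open>a\<^sub>n\<close>, and the tail destroys only half of that.\<close>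

theorem uniform_boundedness:
  assumes bound: "\<And>f. f \<in> dual \<Longrightarrow> \<exists>C. \<forall>a\<in>A. f a \<le> C"
  obtains M where "\<And>a. a \<in> A \<Longrightarrow> q a \<le> M"
proof (rule ccontr)
  assume contra: "\<not> thesis"
  have "\<exists>a\<in>A. 4 ^ n < q a" for n :: nat
    using contra that[of "4 ^ n"] by force
  then obtain a where a: "\<And>n. a n \<in> A" "\<And>n::nat. 4 ^ n < q (a n)"
    by metis
  have "\<exists>f\<in>uball. f (a n) = q (a n)" for n
    using norming_functional by metis
  then obtain f where f: "\<And>n. f n \<in> uball" "\<And>n. f n (a n) = q (a n)"
    by metis
  let ?P = "\<lambda>n (g :: 'v \<Rightarrow> real). n = 0 \<longrightarrow> g = (\<lambda>x. 0)"
  let ?Q = "\<lambda>n g g'. \<exists>c. \<bar>c\<bar> = (1/3) ^ n \<and> g' = (\<lambda>x. g x + c * f n x) \<and> (1/3) ^ n * q (a n) \<le> \<bar>g' (a n)\<bar>"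
  have "\<exists>s. \<forall>n. ?P n (s n) \<and> ?Q n (s n) (s (Suc n))"
  proof (rule dependent_nat_choice)
    fix g and n :: nat
    let ?w = "(1/3) ^ n :: real"
    have "?w * q (a n) \<le> \<bar>g (a n) + ?w * f n (a n)\<bar> \<or> ?w * q (a n) \<le> \<bar>g (a n) + - ?w * f n (a n)\<bar>"
    proof -
      have "t \<le> \<bar>b + t\<bar> \<or> t \<le> \<bar>b - t\<bar>" if "0 \<le> t" for b t :: real
        using that by linarith
      from this[of "?w * q (a n)" "g (a n)"] show ?thesis
        using q_nonneg by (simp add: f(2))
    qed
    then obtain c where "\<bar>c\<bar> = ?w" "?w * q (a n) \<le> \<bar>g (a n) + c * f n (a n)\<bar>"
      by (metis abs_minus_cancel abs_of_nonneg zero_le_divide_1_iff zero_le_numeral zero_le_power)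
    then show "\<exists>g'. ?P (Suc n) g' \<and> ?Q n g g'"
      by (intro exI[of _ "\<lambda>x. g x + c * f n x"]) auto
  qed auto
  then obtain s where s0: "s 0 = (\<lambda>x. 0)" and s: "\<And>n. ?Q n (s n) (s (Suc n))"
    by blast
  then obtain c where c: "\<And>n. \<bar>c n\<bar> = (1/3) ^ n" "\<And>n. s (Suc n) = (\<lambda>x. s n x + c n * f n x)"
    and hump: "\<And>n. (1/3) ^ n * q (a n) \<le> \<bar>s (Suc n) (a n)\<bar>"
    by metis
  have s_sum: "s n x = (\<Sum>i<n. c i * f i x)" for n x
    by (induction n) (simp_all add: s0 c(2))
  obtain F where F: "F \<in> dual" "\<And>x. (\<lambda>n. c n * f n x) sums F x"
  proof (rule geometric_series_dual[of f 1 c "1/3"])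
    show "lin (f n)" "\<bar>f n x\<bar> \<le> 1 * q x" for n x
      using f(1) uball_lin uball_le by auto
    show "\<bar>c n\<bar> \<le> (1/3) ^ n" for n
      by (simp add: c(1))
  qed (simp_all add: that)
  have large: "(4/3) ^ n / 2 \<le> \<bar>F (a n)\<bar>" for n
  proof -
    have "\<bar>c i * f i (a n)\<bar> \<le> q (a n) * (1/3) ^ i" for i
      unfolding abs_mult c(1) using uball_le[OF f(1), of i "a n"] by (simp add: mult.commute mult_left_mono)
    from geometric_tail_bound[OF F(2) this, of "Suc n"]
    have "\<bar>F (a n) - s (Suc n) (a n)\<bar> \<le> q (a n) * (1/3) ^ Suc n / (1 - 1/3)"
      by (simp add: s_sum)
    also have "\<dots> = (1/3) ^ n * q (a n) / 2"
      by simp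
    finally have "(1/3) ^ n * q (a n) / 2 \<le> \<bar>F (a n)\<bar>"
      using hump[of n] by linarith
    moreover have "(4/3) ^ n / 2 \<le> (1/3) ^ n * q (a n) / 2"
      using a(2)[of n] by (simp add: power_divide divide_simps less_imp_le)
    ultimately show ?thesis by linarith
  qed
  obtain C where C: "\<forall>b\<in>A. F b \<le> C"
    using bound[OF F(1)] by blast
  obtain C' where C': "\<forall>b\<in>A. -1 * F b \<le> C'"
    using bound[OF dual_sc[OF F(1), of "-1"]] by blast
  obtain n where "2 * max C C' < (4/3) ^ n"
    using real_arch_pow[of "4/3" "2 * max C C'"] by auto
  then show False
    using large[of n] C C' a(1)[of n] by fastforce
qed

end

section \<open>Suprema over a set\<close>

definition bounded_abs_on :: "'a set \<Rightarrow> ('a \<Rightarrow> real) \<Rightarrow> bool"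
  where "bounded_abs_on A g \<longleftrightarrow> (\<exists>C. \<forall>a\<in>A. \<bar>g a\<bar> \<le> C)"

definition supr :: "'a set \<Rightarrow> ('a \<Rightarrow> real) \<Rightarrow> real"
  where "supr A g = (SUP a\<in>A. g a)"

lemma bounded_abs_onI: "(\<And>a. a \<in> A \<Longrightarrow> \<bar>g a\<bar> \<le> C) \<Longrightarrow> bounded_abs_on A g"
  by (auto simp: bounded_abs_on_def)

lemma bounded_abs_on_comb:
  assumes "bounded_abs_on A f" "bounded_abs_on A g"
  shows "bounded_abs_on A (\<lambda>x. r * f x + s * g x)"
proof -
  obtain C D where CD: "\<And>a. a \<in> A \<Longrightarrow> \<bar>f a\<bar> \<le> C" "\<And>a. a \<in> A \<Longrightarrow> \<bar>g a\<bar> \<le> D"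
    using assms by (auto simp: bounded_abs_on_def)
  show ?thesis
  proof (rule bounded_abs_onI)
    fix a assume "a \<in> A"
    have "\<bar>r * f a + s * g a\<bar> \<le> \<bar>r\<bar> * \<bar>f a\<bar> + \<bar>s\<bar> * \<bar>g a\<bar>"
      by (metis abs_mult abs_triangle_ineq)
    also have "\<dots> \<le> \<bar>r\<bar> * C + \<bar>s\<bar> * D"
      using CD \<open>a \<in> A\<close> by (intro add_mono mult_left_mono) auto
    finally show "\<bar>r * f a + s * g a\<bar> \<le> \<bar>r\<bar> * C + \<bar>s\<bar> * D" .
  qed
qed

lemma bounded_abs_on_add:
  "bounded_abs_on A f \<Longrightarrow> bounded_abs_on A g \<Longrightarrow> bounded_abs_on A (\<lambda>x. f x + s * g x)"
  using bounded_abs_on_comb[of A f g 1 s] by simp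

lemma bounded_abs_on_diff:
  "bounded_abs_on A f \<Longrightarrow> bounded_abs_on A g \<Longrightarrow> bounded_abs_on A (\<lambda>x. f x - s * g x)"
  using bounded_abs_on_comb[of A f g 1 "- s"] by simp

lemma supr_upper:
  assumes "bounded_abs_on A g" "a \<in> A" shows "g a \<le> supr A g"
proof -
  obtain C where "\<And>a. a \<in> A \<Longrightarrow> \<bar>g a\<bar> \<le> C"
    using assms(1) by (auto simp: bounded_abs_on_def)
  then have "bdd_above (g ` A)"
    by (meson abs_le_D1 bdd_aboveI2)
  then show ?thesis
    unfolding supr_def using assms(2) by (rule cSUP_upper2) simp
qed

lemma supr_least: "A \<noteq> {} \<Longrightarrow> (\<And>a. a \<in> A \<Longrightarrow> g a \<le> c) \<Longrightarrow> supr A g \<le> c"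
  unfolding supr_def by (rule cSUP_least)

text \<open>Pryce's lemma: if moving from \<open>u\<close> by \<open>\<beta>\<close> in any direction of a convex set \<open>C\<close> raises the supremum
  at rate above \<open>\<alpha>\<close>, then after a nearly optimal such step the same holds for a further step of length
  \<open>\<rho> \<beta>\<close>. The reason is convexity: the first step towards an average of two directions is an average of
  \<open>u\<close> and of the outcome of both steps.\<close>

lemma pryce_step:
  fixes u :: "'a \<Rightarrow> real"
  assumes A: "A \<noteq> {}" and u: "bounded_abs_on A u" and C: "C \<noteq> {}" "\<And>c. c \<in> C \<Longrightarrow> bounded_abs_on A c"
    and convex: "\<And>c d. c \<in> C \<Longrightarrow> d \<in> C \<Longrightarrow> (\<lambda>x. (c x + \<rho> * d x) / (1 + \<rho>)) \<in> C"
    and pos: "0 < \<beta>" "0 < \<rho>" and "\<alpha> < \<alpha>'"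
    and rate: "\<And>c. c \<in> C \<Longrightarrow> \<alpha>' * \<beta> + supr A u \<le> supr A (\<lambda>x. u x + \<beta> * c x)"
  shows "\<exists>c\<in>C. \<exists>\<alpha>''>\<alpha>. \<forall>d\<in>C. \<alpha>'' * (\<rho> * \<beta>) + supr A (\<lambda>x. u x + \<beta> * c x) \<le>
      supr A (\<lambda>x. u x + \<beta> * c x + (\<rho> * \<beta>) * d x)"
proof -
  define J where "J = (INF c\<in>C. supr A (\<lambda>x. u x + \<beta> * c x))"
  define \<alpha>'' where "\<alpha>'' = (\<alpha> + \<alpha>') / 2"
  have \<alpha>'': "\<alpha> < \<alpha>''" "\<alpha>'' < \<alpha>'"
    using \<open>\<alpha> < \<alpha>'\<close> by (auto simp: \<alpha>''_def)
  have bdd: "bdd_below ((\<lambda>c. supr A (\<lambda>x. u x + \<beta> * c x)) ` C)"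
    using rate by (rule bdd_belowI2)
  have J: "J \<le> supr A (\<lambda>x. u x + \<beta> * c x)" if "c \<in> C" for c
    unfolding J_def using bdd that by (rule cINF_lower)
  have rateJ: "\<alpha>' * \<beta> + supr A u \<le> J"
    unfolding J_def using C(1) rate by (rule cINF_greatest)
  have "J < J + \<rho> * \<beta> * (\<alpha>' - \<alpha>'')"
    using pos \<alpha>'' by simp
  then obtain c where c: "c \<in> C" "supr A (\<lambda>x. u x + \<beta> * c x) < J + \<rho> * \<beta> * (\<alpha>' - \<alpha>'')"
    unfolding J_def using cINF_less_iff[OF C(1) bdd] by blast
  have "\<alpha>'' * (\<rho> * \<beta>) + supr A (\<lambda>x. u x + \<beta> * c x) \<le> supr A (\<lambda>x. u x + \<beta> * c x + (\<rho> * \<beta>) * d x)"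
    if d: "d \<in> C" for d
  proof -
    define v where "v x = (c x + \<rho> * d x) / (1 + \<rho>)" for x
    have v: "v \<in> C"
      unfolding v_def using c(1) d by (rule convex)
    let ?w = "\<lambda>x. u x + \<beta> * c x + (\<rho> * \<beta>) * d x"
    have bw: "bounded_abs_on A ?w"
      by (intro bounded_abs_on_add u C(2) c(1) d)
    have "supr A (\<lambda>x. u x + \<beta> * v x) \<le> (\<rho> * supr A u + supr A ?w) / (1 + \<rho>)"
    proof (rule supr_least[OF A])
      fix a assume "a \<in> A"
      have "(1 + \<rho>) * (u a + \<beta> * v a) = \<rho> * u a + ?w a"
        using pos by (simp add: v_def field_simps)
      also have "\<dots> \<le> \<rho> * supr A u + supr A ?w"
        using supr_upper[OF u \<open>a \<in> A\<close>] supr_upper[OF bw \<open>a \<in> A\<close>] pos by (intro add_mono mult_left_mono) auto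
      finally show "u a + \<beta> * v a \<le> (\<rho> * supr A u + supr A ?w) / (1 + \<rho>)"
        using pos by (simp add: field_simps)
    qed
    then have "(1 + \<rho>) * supr A (\<lambda>x. u x + \<beta> * v x) \<le> \<rho> * supr A u + supr A ?w"
      using pos by (simp add: field_simps)
    moreover have "(1 + \<rho>) * J \<le> (1 + \<rho>) * supr A (\<lambda>x. u x + \<beta> * v x)"
      using J[OF v] pos by (intro mult_left_mono) auto
    moreover have "\<rho> * (\<alpha>' * \<beta> + supr A u) \<le> \<rho> * J"
      using rateJ pos by (intro mult_left_mono) auto
    ultimately show ?thesis
      using c(2) by (simp add: algebra_simps)
  qed
  then show ?thesis
    using c(1) \<alpha>''(1) by blast
qed

section \<open>Cones with rational coefficients\<close>

text \<open>Rational coefficients keep this family of conical combinations countable, so that one diagonal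
  sequence serves all of them; \<open>\<sigma>\<close> records the sum of the coefficients, and \<open>\<sigma> = 1\<close> singles out the
  convex combinations of a tail of the sequence.\<close>

inductive rcone :: "(nat \<Rightarrow> 'a \<Rightarrow> real) \<Rightarrow> nat \<Rightarrow> ('a \<Rightarrow> real) \<Rightarrow> real \<Rightarrow> bool"
  for f :: "nat \<Rightarrow> 'a \<Rightarrow> real" and n :: nat
  where
    zero: "rcone f n (\<lambda>x. 0) 0"
  | step: "0 \<le> c \<Longrightarrow> n \<le> k \<Longrightarrow> rcone f n h \<sigma> \<Longrightarrow>
      rcone f n (\<lambda>x. of_rat c * f k x + h x) (of_rat c + \<sigma>)"

lemma rcone_generator: "n \<le> k \<Longrightarrow> rcone f n (f k) 1"
  using rcone.step[of 1 n k f "\<lambda>x. 0" 0] rcone.zero[of f n] by simp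

lemma rcone_antimono: "rcone f n h \<sigma> \<Longrightarrow> m \<le> n \<Longrightarrow> rcone f m h \<sigma>"
  by (induction rule: rcone.induct) (auto intro: rcone.intros)

lemma rcone_subseq: "rcone (f \<circ> r) n h \<sigma> \<Longrightarrow> rcone f 0 h \<sigma>"
proof (induction rule: rcone.induct)
  case (step c k h \<sigma>)
  then show ?case
    using rcone.step[of c 0 "r k" f h \<sigma>] by simp
qed (rule rcone.zero)

lemma rcone_add:
  assumes "rcone f n h \<sigma>" "rcone f n h' \<sigma>'" shows "rcone f n (\<lambda>x. h x + h' x) (\<sigma> + \<sigma>')"
  using assms(1)
proof (induction rule: rcone.induct)
  case (step c k h \<sigma>)
  then show ?case
    using rcone.step[of c n k f "\<lambda>x. h x + h' x" "\<sigma> + \<sigma>'"] by (simp add: add.assoc)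
qed (use assms(2) in simp)

lemma rcone_scale:
  assumes "rcone f n h \<sigma>" "0 \<le> d" shows "rcone f n (\<lambda>x. of_rat d * h x) (of_rat d * \<sigma>)"
  using assms(1)
proof (induction rule: rcone.induct)
  case (step c k h \<sigma>)
  then show ?case
    using rcone.step[of "d * c" n k f "\<lambda>x. of_rat d * h x" "of_rat d * \<sigma>"] \<open>0 \<le> d\<close>
    by (simp add: of_rat_mult algebra_simps)
qed (auto intro: rcone.zero)

lemma rcone_nonneg: "rcone f n h \<sigma> \<Longrightarrow> 0 \<le> \<sigma>"
  by (induction rule: rcone.induct) auto

lemma rcone_upper:
  assumes "rcone f n h \<sigma>" "\<And>k. n \<le> k \<Longrightarrow> f k a \<le> b" shows "h a \<le> \<sigma> * b"
  using assms(1)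
proof (induction rule: rcone.induct)
  case (step c k h \<sigma>)
  then show ?case
    using mult_left_mono[OF assms(2)[of k], of "of_rat c"] by (simp add: distrib_right)
qed simp

lemma rcone_lower:
  assumes "rcone f n h \<sigma>" "\<And>k. n \<le> k \<Longrightarrow> b \<le> f k a" shows "\<sigma> * b \<le> h a"
  using assms(1)
proof (induction rule: rcone.induct)
  case (step c k h \<sigma>)
  then show ?case
    using mult_left_mono[OF assms(2)[of k], of "of_rat c"] by (simp add: distrib_right)
qed simp

lemma countable_rcone: "countable {(h, \<sigma>). rcone f n h \<sigma>}"
proof -
  define F where "F l = foldr (\<lambda>(c, k) (h, \<sigma>). ((\<lambda>x. of_rat c * f k x + h x), of_rat c + \<sigma>)) l ((\<lambda>x. 0), 0 :: real)"
    for l :: "(rat \<times> nat) list"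
  have "(h, \<sigma>) \<in> range F" if "rcone f n h \<sigma>" for h \<sigma>
    using that
  proof (induction rule: rcone.induct)
    case zero
    show ?case
      by (rule image_eqI[of _ _ "[]"]) (auto simp: F_def)
  next
    case (step c k h \<sigma>)
    then obtain l where "F l = (h, \<sigma>)" by auto
    then show ?case
      by (intro image_eqI[of _ _ "(c, k) # l"]) (auto simp: F_def)
  qed
  then have "{(h, \<sigma>). rcone f n h \<sigma>} \<subseteq> range F"
    by auto
  then show ?thesis
    by (rule countable_subset) simp
qed

section \<open>James' theorem\<close>

context real_vs
begin

lemma env_subseq:
  assumes g: "env (f \<circ> s) g" and s: "strict_mono s" shows "env f g"
  unfolding env_def
proof (intro conjI allI impI)
  show "g a \<le> c" if "\<forall>\<^sub>F k in sequentially. f k a \<le> c" for a c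
    using eventually_subseq[OF s that] by (intro env_upper[OF g]) simp
  show "c \<le> g a" if "\<forall>\<^sub>F k in sequentially. c \<le> f k a" for a c
    using eventually_subseq[OF s that] by (intro env_lower[OF g]) simp
qed

lemma env_shift:
  assumes g: "env f g" shows "env (f \<circ> (+) k) g"
  unfolding env_def
proof (intro conjI allI impI)
  show "g a \<le> c" if "\<forall>\<^sub>F i in sequentially. (f \<circ> (+) k) i a \<le> c" for a c
    using that eventually_sequentially_seg[of "\<lambda>i. f i a \<le> c" k]
    by (intro env_upper[OF g]) (simp add: add.commute)
  show "c \<le> g a" if "\<forall>\<^sub>F i in sequentially. c \<le> (f \<circ> (+) k) i a" for a c
    using that eventually_sequentially_seg[of "\<lambda>i. c \<le> f i a" k]
    by (intro env_lower[OF g]) (simp add: add.commute)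
qed

lemma env_abs_le:
  assumes "env f g" "\<And>k. \<bar>f k a\<bar> \<le> c" shows "\<bar>g a\<bar> \<le> c"
proof -
  have "f k a \<le> c" "- c \<le> f k a" for k
    using assms(2)[of k] by auto
  then have "g a \<le> c" "- c \<le> g a"
    using env_upper[OF assms(1), of a c] env_lower[OF assms(1), of "- c" a] by simp_all
  then show ?thesis
    by (simp add: abs_le_iff)
qed

lemma env_convex:
  assumes c: "\<And>n. rcone f n (c n) 1" and g: "env c g" shows "env f g"
  unfolding env_def
proof (intro conjI allI impI)
  fix a b
  show "g a \<le> b" if ev: "\<forall>\<^sub>F k in sequentially. f k a \<le> b"
  proof (rule env_upper[OF g])
    obtain N where "\<And>k. N \<le> k \<Longrightarrow> f k a \<le> b"
      using ev by (auto simp: eventually_sequentially)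
    then have "c n a \<le> b" if "N \<le> n" for n
      using rcone_upper[OF c[of n], of a b] that by simp
    then show "\<forall>\<^sub>F k in sequentially. c k a \<le> b"
      by (auto simp: eventually_sequentially)
  qed
  show "b \<le> g a" if ev: "\<forall>\<^sub>F k in sequentially. b \<le> f k a"
  proof (rule env_lower[OF g])
    obtain N where "\<And>k. N \<le> k \<Longrightarrow> b \<le> f k a"
      using ev by (auto simp: eventually_sequentially)
    then have "b \<le> c n a" if "N \<le> n" for n
      using rcone_lower[OF c[of n], of b a] that by simp
    then show "\<forall>\<^sub>F k in sequentially. b \<le> c k a"
      by (auto simp: eventually_sequentially)
  qed
qed

end

context complete_seminormed
begin

lemma uball_generalised_limit:
  fixes f :: "nat \<Rightarrow> 'v \<Rightarrow> real"
  assumes f: "\<And>k. f k \<in> uball"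
  shows "\<exists>g. lin g \<and> env f g \<and> (\<forall>x. \<bar>g x\<bar> \<le> q x)"
proof -
  obtain g where g: "lin g" "env f g"
    by (rule exists_generalised_limit[of f q]) (use f uball_lin uball_le that in auto)
  have "\<bar>g x\<bar> \<le> q x" for x
    by (rule env_abs_le[OF g(2)]) (use f uball_le in blast)
  then show ?thesis
    using g by blast
qed

lemma uball_bounded_abs_on:
  assumes M: "\<And>a. a \<in> A \<Longrightarrow> q a \<le> M" and f: "\<And>x. \<bar>f x\<bar> \<le> q x" shows "bounded_abs_on A f"
  by (rule bounded_abs_onI[of _ _ M]) (use M f order_trans in blast)

text \<open>Choose the subsequence so that the lower bound of \<open>sup (h - \<sigma> g)\<close> over all generalised limits
  \<open>g\<close> is almost as large as any subsequence can make it. A value \<open>h a - \<sigma> g a\<close> exceeding it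
  noticeably would become such a lower bound along a subsequence on which \<open>f\<^sub>k a\<close> stays near or below \<open>g a\<close>.\<close>

lemma small_oscillation_subsequence:
  fixes f :: "nat \<Rightarrow> 'v \<Rightarrow> real"
  assumes A: "A \<noteq> {}" "\<And>a. a \<in> A \<Longrightarrow> q a \<le> M" and f: "\<And>k. f k \<in> uball"
    and h: "bounded_abs_on A h" and \<sigma>: "0 \<le> \<sigma>" and \<delta>: "0 < \<delta>"
  shows "\<exists>s. strict_mono s \<and> (\<forall>g g'. env (f \<circ> s) g \<longrightarrow> env (f \<circ> s) g' \<longrightarrow>
      supr A (\<lambda>x. h x - \<sigma> * g x) \<le> supr A (\<lambda>x. h x - \<sigma> * g' x) + \<delta>)"
proof -
  let ?p = "\<lambda>g. supr A (\<lambda>x. h x - \<sigma> * g x)"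
  have fa: "\<bar>f k a\<bar> \<le> M" if "a \<in> A" for k a
    using uball_le[OF f, of k a] A(2)[OF that] by linarith
  have env_sub: "env f g" if "env (f \<circ> s) g" "strict_mono s" for s g
    using env_subseq that .
  have ga: "\<bar>g a\<bar> \<le> M" if "env f g" "a \<in> A" for g a
    by (rule env_abs_le[OF that(1)]) (rule fa[OF that(2)])
  obtain H where H: "\<And>a. a \<in> A \<Longrightarrow> \<bar>h a\<bar> \<le> H"
    using h by (auto simp: bounded_abs_on_def)
  have val: "\<bar>h a - \<sigma> * g a\<bar> \<le> H + \<sigma> * M" if "env f g" "a \<in> A" for g a
  proof -
    have "\<bar>\<sigma> * g a\<bar> \<le> \<sigma> * M"
      using ga[OF that] \<sigma> by (simp add: abs_mult mult_left_mono)
    then show ?thesis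
      using H[OF that(2)] by linarith
  qed
  have bnd: "bounded_abs_on A (\<lambda>x. h x - \<sigma> * g x)" if "env f g" for g
    using val[OF that] by (rule bounded_abs_onI)
  have p_le: "?p g \<le> H + \<sigma> * M" if "env f g" for g
    using val[OF that] by (intro supr_least A(1)) (use abs_le_D1 in blast)
  define S where "S = {v. \<exists>s. strict_mono s \<and> (\<forall>g. env (f \<circ> s) g \<longrightarrow> v \<le> ?p g)}"
  have "bdd_above S"
  proof (rule bdd_aboveI)
    fix v assume "v \<in> S"
    then obtain s where s: "strict_mono s" "\<And>g. env (f \<circ> s) g \<Longrightarrow> v \<le> ?p g"
      by (auto simp: S_def)
    have "(f \<circ> s) k \<in> uball" for k
      by (simp add: f)
    then obtain g where g: "env (f \<circ> s) g"
      using uball_generalised_limit[of "f \<circ> s"] by blast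
    then show "v \<le> H + \<sigma> * M"
      using s(2) p_le[OF env_sub[OF g s(1)]] by force
  qed
  have lower: "h a - \<sigma> * g a \<le> Sup S" if s: "strict_mono s" and g: "env (f \<circ> s) g" and a: "a \<in> A" for s g a
  proof (rule field_le_epsilon)
    fix e :: real assume "0 < e"
    define e' where "e' = e / (\<sigma> + 1)"
    have e': "0 < e'" "\<sigma> * e' \<le> e"
      using \<open>0 < e\<close> \<sigma> by (auto simp: e'_def field_simps)
    have "\<not> (\<forall>\<^sub>F k in sequentially. g a + e' \<le> (f \<circ> s) k a)"
      using env_lower[OF g, of "g a + e'" a] e' by auto
    then have "infinite {k. (f \<circ> s) k a < g a + e'}"
      by (auto simp: eventually_sequentially infinite_nat_iff_unbounded_le not_le)
    then obtain t :: "nat \<Rightarrow> nat" where t: "strict_mono t" "\<And>n. t n \<in> {k. (f \<circ> s) k a < g a + e'}"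
      using infinite_enumerate by blast
    have st: "strict_mono (s \<circ> t)"
      using s t(1) by (rule strict_mono_o)
    have "h a - \<sigma> * g a - \<sigma> * e' \<in> S"
      unfolding S_def
    proof (intro CollectI exI conjI allI impI)
      show "strict_mono (s \<circ> t)" by (rule st)
      fix g' assume g': "env (f \<circ> (s \<circ> t)) g'"
      have "g' a \<le> g a + e'"
        using t(2) by (intro env_upper[OF g']) (auto simp: less_imp_le)
      then have "\<sigma> * g' a \<le> \<sigma> * (g a + e')"
        using \<sigma> by (rule mult_left_mono)
      then have "h a - \<sigma> * g a - \<sigma> * e' \<le> h a - \<sigma> * g' a"
        by (simp add: algebra_simps)
      also have "\<dots> \<le> ?p g'"
        using supr_upper[OF bnd[OF env_sub[OF g' st]] a] by simp
      finally show "h a - \<sigma> * g a - \<sigma> * e' \<le> ?p g'" .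
    qed
    then have "h a - \<sigma> * g a - \<sigma> * e' \<le> Sup S"
      using \<open>bdd_above S\<close> by (rule cSup_upper)
    then show "h a - \<sigma> * g a \<le> Sup S + e"
      using e'(2) by linarith
  qed
  have "- (H + \<sigma> * M) \<in> S"
    unfolding S_def
  proof (intro CollectI exI[of _ id] conjI allI impI)
    show "strict_mono (id :: nat \<Rightarrow> nat)"
      by (simp add: strict_mono_def)
    fix g assume "env (f \<circ> id) g"
    then have g: "env f g" by simp
    obtain a where a: "a \<in> A" using A(1) by blast
    show "- (H + \<sigma> * M) \<le> ?p g"
      using supr_upper[OF bnd[OF g] a] val[OF g a] by linarith
  qed
  then have "S \<noteq> {}" by blast
  moreover have "Sup S - \<delta> < Sup S"
    using \<delta> by simp
  ultimately obtain v where v: "v \<in> S" "Sup S - \<delta> < v"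
    by (meson less_cSupD)
  then obtain s where s: "strict_mono s" "\<And>g. env (f \<circ> s) g \<Longrightarrow> v \<le> ?p g"
    by (auto simp: S_def)
  have "?p g \<le> ?p g' + \<delta>" if "env (f \<circ> s) g" "env (f \<circ> s) g'" for g g'
  proof -
    have "?p g \<le> Sup S"
      using lower[OF s(1) that(1)] by (intro supr_least A(1))
    then show ?thesis
      using s(2)[OF that(2)] v(2) by linarith
  qed
  then show ?thesis
    using s(1) by blast
qed

text \<open>Diagonalisation over the countable cone and over \<open>\<delta> = 1/m\<close>.\<close>

lemma stable_subsequence:
  fixes f :: "nat \<Rightarrow> 'v \<Rightarrow> real"
  assumes A: "A \<noteq> {}" "\<And>a. a \<in> A \<Longrightarrow> q a \<le> M" and f: "\<And>k. f k \<in> uball"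
  shows "\<exists>r. strict_mono r \<and>
    (\<forall>h \<sigma> g g'. rcone (f \<circ> r) 0 h \<sigma> \<longrightarrow> env (f \<circ> r) g \<longrightarrow> env (f \<circ> r) g' \<longrightarrow>
      supr A (\<lambda>x. h x - \<sigma> * g x) = supr A (\<lambda>x. h x - \<sigma> * g' x))"
proof -
  define E where "E = {(h, \<sigma>). rcone f 0 h \<sigma>}"
  have E: "countable E" "E \<noteq> {}"
    unfolding E_def using countable_rcone rcone.zero[of f 0] by auto
  define e where "e n = from_nat_into E (fst (prod_decode n))" for n
  define P where "P n s \<longleftrightarrow> (\<forall>g g'. env (f \<circ> s) g \<longrightarrow> env (f \<circ> s) g' \<longrightarrow>
      supr A (\<lambda>x. fst (e n) x - snd (e n) * g x) \<le>
      supr A (\<lambda>x. fst (e n) x - snd (e n) * g' x) + inverse (real (Suc (snd (prod_decode n)))))"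
    for n s
  have fa: "bounded_abs_on A (f k)" for k
    by (rule uball_bounded_abs_on[OF A(2)]) (use uball_le[OF f] in auto)
  have rb: "bounded_abs_on A h" if "rcone f 0 h \<sigma>" for h \<sigma>
    using that
  proof (induction rule: rcone.induct)
    case zero
    show ?case by (rule bounded_abs_onI[of _ _ 0]) simp
  next
    case (step c k h \<sigma>)
    then show ?case
      using bounded_abs_on_comb[OF fa, of h "of_rat c" k 1] by simp
  qed
  interpret subseqs P
  proof
    fix n and s :: "nat \<Rightarrow> nat" assume "strict_mono s"
    have "e n \<in> E"
      unfolding e_def using E(2) by (rule from_nat_into)
    then have en: "rcone f 0 (fst (e n)) (snd (e n))"
      by (auto simp: E_def)
    have fs: "(f \<circ> s) k \<in> uball" for k
      by (simp add: f)
    have "0 < inverse (real (Suc (snd (prod_decode n))))"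
      by simp
    from small_oscillation_subsequence[where f = "f \<circ> s", OF A fs rb[OF en] rcone_nonneg[OF en] this]
    show "\<exists>r'. strict_mono r' \<and> P n (s \<circ> r')"
      by (simp add: P_def comp_assoc)
  qed
  have P: "P n (diagseq \<circ> (+) (Suc n))" for n
  proof (rule diagseq_holds)
    fix r s :: "nat \<Rightarrow> nat" and n
    assume "strict_mono r" "P n s"
    then show "P n (s \<circ> r)"
      unfolding P_def comp_assoc[symmetric] using env_subseq by blast
  qed
  have le: "supr A (\<lambda>x. h x - \<sigma> * g x) \<le> supr A (\<lambda>x. h x - \<sigma> * g' x)"
    if h: "rcone (f \<circ> diagseq) 0 h \<sigma>" and g: "env (f \<circ> diagseq) g" "env (f \<circ> diagseq) g'" for h \<sigma> g g'
  proof (rule LIMSEQ_le_const)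
    have "(h, \<sigma>) \<in> E"
      using rcone_subseq[OF h] by (simp add: E_def)
    then obtain i where i: "from_nat_into E i = (h, \<sigma>)"
      using from_nat_into_surj[OF E(1)] by blast
    have "supr A (\<lambda>x. h x - \<sigma> * g x) \<le> supr A (\<lambda>x. h x - \<sigma> * g' x) + inverse (real (Suc m))" for m
      using P[of "prod_encode (i, m)"] env_shift[OF g(1)] env_shift[OF g(2)]
      by (simp add: P_def e_def i comp_assoc)
    then show "\<exists>N. \<forall>n\<ge>N. supr A (\<lambda>x. h x - \<sigma> * g x) \<le> supr A (\<lambda>x. h x - \<sigma> * g' x) + inverse (real (Suc n))"
      by blast
    show "(\<lambda>n. supr A (\<lambda>x. h x - \<sigma> * g' x) + inverse (real (Suc n))) \<longlonglongrightarrow> supr A (\<lambda>x. h x - \<sigma> * g' x)"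
      using tendsto_add[OF tendsto_const LIMSEQ_inverse_real_of_nat] by force
  qed
  show ?thesis
    using subseq_diagseq le by (meson antisym)
qed

text \<open>James' theorem, following Pryce. If \<open>\<phi>\<close> were not represented, pass to a stable subsequence of
  the array. Every \<open>c\<close> in its rational convex hull and every generalised limit \<open>g\<close> satisfy
  \<open>sup (c - g) \<ge> \<theta>\<close>. Steps of geometric length \<open>\<rho>\<^sup>n\<close> in directions \<open>c\<^sub>n - g\<close> therefore keep raising the
  supremum at rate \<open>\<theta>/2\<close>, and by stability this does not depend on \<open>g\<close>; so \<open>g\<close> may be chosen in
  hindsight as a generalised limit of the \<open>c\<^sub>n\<close> themselves. If \<open>\<Sum> \<rho>\<^sup>n (c\<^sub>n - g)\<close> attained its supremum
  at \<open>a\<close>, every step would have to gain at \<open>a\<close> itself, so \<open>c\<^sub>n a \<ge> g a + \<theta>/4\<close> for all \<open>n\<close>, and \<open>g\<close> could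
  not be a generalised limit of the \<open>c\<^sub>n\<close>.\<close>

theorem james:
  assumes attain: "\<And>f. f \<in> dual \<Longrightarrow> \<exists>a\<in>A. \<forall>b\<in>A. f b \<le> f a"
    and \<phi>: "bidual_closure A \<phi>"
  shows "represented \<phi>"
proof (rule ccontr)
  assume "\<not> represented \<phi>"
  then obtain \<theta> F x where \<theta>: "0 < \<theta>" and F: "\<And>n::nat. F n \<in> uball" and x: "\<And>n::nat. x n \<in> A"
    and big: "\<And>m n. m \<le> n \<Longrightarrow> \<theta> < F m (x n)" and zero: "\<And>m n. n < m \<Longrightarrow> F m (x n) = 0"
    using james_array[OF \<phi>] by blast
  have A: "A \<noteq> {}" using x by blast
  obtain M0 where "\<And>a. a \<in> A \<Longrightarrow> q a \<le> M0"
    using uniform_boundedness[of A] attain by metis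
  define M where "M = max 1 M0"
  have M: "0 < M" "\<And>a. a \<in> A \<Longrightarrow> q a \<le> M"
    using \<open>\<And>a. a \<in> A \<Longrightarrow> q a \<le> M0\<close> by (auto simp: M_def le_max_iff_disj)
  obtain r where r: "strict_mono r"
    and stable_r: "\<forall>h \<sigma> g g'. rcone (F \<circ> r) 0 h \<sigma> \<longrightarrow> env (F \<circ> r) g \<longrightarrow> env (F \<circ> r) g' \<longrightarrow>
      supr A (\<lambda>x. h x - \<sigma> * g x) = supr A (\<lambda>x. h x - \<sigma> * g' x)"
    using stable_subsequence[where f = F and M = M, OF A _ F] M(2) by (elim meta_impE exE conjE) (assumption | rule that)+
  define f where "f = F \<circ> r"
  have stable: "supr A (\<lambda>x. h x - \<sigma> * g x) = supr A (\<lambda>x. h x - \<sigma> * g' x)"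
    if "rcone f 0 h \<sigma>" "env f g" "env f g'" for h \<sigma> g g'
    using stable_r[folded f_def] that by iprover
  have f: "f k \<in> uball" for k
    by (simp add: f_def F)
  have bnd: "bounded_abs_on A g" if "\<And>x. \<bar>g x\<bar> \<le> q x" for g
    by (rule uball_bounded_abs_on[OF M(2) that])
  have rc: "lin h \<and> (\<forall>x. \<bar>h x\<bar> \<le> \<sigma> * q x)" if "rcone f n h \<sigma>" for n h \<sigma>
    using that
  proof (induction rule: rcone.induct)
    case zero
    show ?case by (simp add: lin_def)
  next
    case (step c k h \<sigma>)
    have "\<bar>of_rat c * f k x + h x\<bar> \<le> (of_rat c + \<sigma>) * q x" for x
    proof -
      have "\<bar>of_rat c * f k x\<bar> \<le> of_rat c * q x"
        using uball_le[OF f, of k x] step.hyps(1) by (simp add: abs_mult mult_left_mono)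
      then show ?thesis
        using step.IH by (smt (verit) distrib_right)
    qed
    then show ?case
      using lin_comb[OF uball_lin[OF f], of h "of_rat c" k 1] step.IH by simp
  qed
  have hull_uball: "c \<in> uball" if "rcone f n c 1" for n c
    using rc[OF that] by (simp add: uball_def)
  obtain G where G: "env f G" "\<And>x. \<bar>G x\<bar> \<le> q x"
    using uball_generalised_limit[of f] f by blast
  have gap: "\<theta> \<le> supr A (\<lambda>x. c x - G x)" if c: "rcone f n c 1" for n c
  proof -
    have "\<exists>N. \<forall>i\<ge>N. \<sigma> * \<theta> \<le> h (x i)" if "rcone f n h \<sigma>" for h \<sigma>
      using that
    proof (induction rule: rcone.induct)
      case (step c k h \<sigma>)
      then obtain N where N: "\<And>i. N \<le> i \<Longrightarrow> \<sigma> * \<theta> \<le> h (x i)"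
        by blast
      have "(of_rat c + \<sigma>) * \<theta> \<le> of_rat c * f k (x i) + h (x i)" if "max N (r k) \<le> i" for i
      proof -
        have "of_rat c * \<theta> \<le> of_rat c * f k (x i)"
          using big[of "r k" i] that step.hyps(1) by (intro mult_left_mono) (auto simp: f_def)
        then show ?thesis
          using N[of i] that by (simp add: distrib_right)
      qed
      then show ?case
        by blast
    qed simp
    then obtain i where i: "\<theta> \<le> c (x i)"
      using c by fastforce
    have "f k (x i) = 0" if "Suc i \<le> k" for k
      using zero[of i "r k"] strict_mono_imp_increasing[OF r, of k] that by (simp add: f_def)
    then have "\<forall>\<^sub>F k in sequentially. f k (x i) \<le> 0"
      by (auto simp: eventually_sequentially intro!: exI[of _ "Suc i"])
    then have "G (x i) \<le> 0"
      by (rule env_upper[OF G(1)])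
    moreover have "bounded_abs_on A (\<lambda>x. c x - 1 * G x)"
      by (intro bounded_abs_on_diff bnd uball_le hull_uball[OF c] G(2))
    ultimately show ?thesis
      using supr_upper[of A "\<lambda>x. c x - G x" "x i"] x[of i] i by simp
  qed
  define \<alpha> where "\<alpha> = \<theta> / 2"
  have \<alpha>: "0 < \<alpha>" "\<alpha> < \<theta>"
    using \<theta> by (auto simp: \<alpha>_def)
  \<comment> \<open>Two tails of the series, each at most \<open>2 M \<rho>\<^sup>n\<^sup>+\<^sup>1 / (1 - \<rho>) \<le> 4 M \<rho> \<rho>\<^sup>n\<close>, must not consume more than half
    of the gain \<open>\<alpha> \<rho>\<^sup>n\<close>.\<close>
  have "0 < min (1/2) (\<alpha> / (16 * M))"
    using \<alpha> M by simp
  from of_rat_dense[OF this] obtain \<rho>q :: rat where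
    \<rho>q: "0 < (of_rat \<rho>q :: real)" "of_rat \<rho>q < min (1/2) (\<alpha> / (16 * M))"
    by (elim exE conjE) (rule that)
  define \<rho> :: real where "\<rho> = of_rat \<rho>q"
  have \<rho>: "0 < \<rho>" "\<rho> < 1/2" "\<rho> < \<alpha> / (16 * M)"
    using \<rho>q by (simp_all add: \<rho>_def)
  have hull_convex: "rcone f n (\<lambda>x. (c x + \<rho> * d x) / (1 + \<rho>)) 1"
    if "rcone f n c 1" "rcone f n d 1" for n c d
  proof -
    have "0 \<le> \<rho>q"
      using \<rho>(1) by (simp add: \<rho>_def)
    then have "0 \<le> 1 / (1 + \<rho>q)"
      by simp
    from rcone_scale[OF rcone_add[OF that(1) rcone_scale[OF that(2) \<open>0 \<le> \<rho>q\<close>]] this]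
    moreover have "1 + \<rho> \<noteq> 0"
      using \<rho>(1) by simp
    ultimately show ?thesis
      by (simp add: \<rho>_def of_rat_divide of_rat_add)
  qed
  define S where "S n = (\<Sum>i<n. \<rho> ^ i)" for n
  define D where "D n = {\<lambda>x. c x - G x | c. rcone f n c 1}" for n
  define V where "V n h = (\<lambda>x. h x - S n * G x)" for n and h :: "'v \<Rightarrow> real"
  let ?P = "\<lambda>n h. rcone f 0 h (S n) \<and>
    (\<exists>\<alpha>'>\<alpha>. \<forall>d\<in>D n. \<alpha>' * \<rho> ^ n + supr A (V n h) \<le> supr A (\<lambda>x. V n h x + \<rho> ^ n * d x))"
  let ?Q = "\<lambda>n h h'. \<exists>c. rcone f n c 1 \<and> h' = (\<lambda>x. h x + \<rho> ^ n * c x) \<and>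
    \<alpha> * \<rho> ^ n + supr A (V n h) \<le> supr A (V (Suc n) h')"
  have V_step: "V (Suc n) (\<lambda>x. h x + \<rho> ^ n * c x) = (\<lambda>x. V n h x + \<rho> ^ n * (c x - G x))" for n h c
    by (simp add: V_def S_def fun_eq_iff algebra_simps)
  have "\<exists>h. \<forall>n. ?P n (h n) \<and> ?Q n (h n) (h (Suc n))"
  proof (rule dependent_nat_choice)
    have "supr A (V 0 (\<lambda>x. 0)) \<le> 0"
      by (rule supr_least[OF A]) (simp add: V_def S_def)
    moreover have "\<theta> \<le> supr A d" if "d \<in> D 0" for d
      using that gap by (auto simp: D_def)
    ultimately have "\<theta> * \<rho> ^ 0 + supr A (V 0 (\<lambda>x. 0)) \<le> supr A (\<lambda>x. V 0 (\<lambda>x. 0) x + \<rho> ^ 0 * d x)"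
      if "d \<in> D 0" for d
      using that by (fastforce simp: V_def S_def)
    then show "\<exists>h. ?P 0 h"
      using rcone.zero[of f 0] \<alpha>(2) by (intro exI[of _ "\<lambda>x. 0"]) (auto simp: S_def)
  next
    fix h n
    assume "?P n h"
    then obtain \<alpha>' where h: "rcone f 0 h (S n)" and \<alpha>': "\<alpha> < \<alpha>'"
      and rate: "\<And>d. d \<in> D n \<Longrightarrow> \<alpha>' * \<rho> ^ n + supr A (V n h) \<le> supr A (\<lambda>x. V n h x + \<rho> ^ n * d x)"
      by blast
    have "bounded_abs_on A h"
    proof (rule bounded_abs_onI)
      fix a assume "a \<in> A"
      have "\<bar>h a\<bar> \<le> S n * q a"
        using rc[OF h] by blast
      also have "\<dots> \<le> S n * M"
        using M(2)[OF \<open>a \<in> A\<close>] rcone_nonneg[OF h] by (rule mult_left_mono)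
      finally show "\<bar>h a\<bar> \<le> S n * M" .
    qed
    then have bV: "bounded_abs_on A (V n h)"
      unfolding V_def using bnd[OF G(2)] by (rule bounded_abs_on_diff)
    have bD: "bounded_abs_on A d" if d: "d \<in> D n" for d
    proof -
      obtain c where c: "rcone f n c 1" "d = (\<lambda>x. c x - 1 * G x)"
        using d by (auto simp: D_def)
      show ?thesis
        unfolding c(2) by (intro bounded_abs_on_diff bnd uball_le hull_uball[OF c(1)] G(2))
    qed
    have "\<exists>d0\<in>D n. \<exists>\<alpha>''>\<alpha>. \<forall>d\<in>D n. \<alpha>'' * (\<rho> * \<rho> ^ n) + supr A (\<lambda>x. V n h x + \<rho> ^ n * d0 x) \<le>
        supr A (\<lambda>x. V n h x + \<rho> ^ n * d0 x + (\<rho> * \<rho> ^ n) * d x)"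
    proof (rule pryce_step[OF A bV])
      show "D n \<noteq> {}"
        using rcone_generator[of n n f] by (auto simp: D_def)
      show "(\<lambda>x. (c x + \<rho> * d x) / (1 + \<rho>)) \<in> D n" if cd: "c \<in> D n" "d \<in> D n" for c d
      proof -
        obtain c' d' where c': "rcone f n c' 1" "c = (\<lambda>x. c' x - G x)"
          and d': "rcone f n d' 1" "d = (\<lambda>x. d' x - G x)"
          using cd by (auto simp: D_def)
        have "(\<lambda>x. (c x + \<rho> * d x) / (1 + \<rho>)) = (\<lambda>x. (c' x + \<rho> * d' x) / (1 + \<rho>) - G x)"
          using \<rho>(1) by (auto simp: fun_eq_iff c'(2) d'(2) field_simps)
        then show ?thesis
          using hull_convex[OF c'(1) d'(1)] by (auto simp: D_def)
      qed
      show "0 < \<rho> ^ n"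
        using \<rho>(1) by simp
    qed (fact bD \<rho>(1) \<alpha>' rate)+
    then obtain d0 \<alpha>'' where d0: "d0 \<in> D n" "\<alpha> < \<alpha>''"
      "\<And>d. d \<in> D n \<Longrightarrow> \<alpha>'' * (\<rho> * \<rho> ^ n) + supr A (\<lambda>x. V n h x + \<rho> ^ n * d0 x) \<le>
        supr A (\<lambda>x. V n h x + \<rho> ^ n * d0 x + (\<rho> * \<rho> ^ n) * d x)"
      by blast
    then obtain c where c: "rcone f n c 1" "d0 = (\<lambda>x. c x - G x)"
      by (auto simp: D_def)
    define h' where "h' = (\<lambda>x. h x + \<rho> ^ n * c x)"
    have V': "V (Suc n) h' = (\<lambda>x. V n h x + \<rho> ^ n * d0 x)"
      unfolding h'_def V_step c(2) ..
    have "rcone f 0 (\<lambda>x. of_rat (\<rho>q ^ n) * c x) (of_rat (\<rho>q ^ n) * 1)"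
      using \<rho>(1) rcone_antimono[OF c(1)] by (intro rcone_scale) (auto simp: \<rho>_def)
    then have "rcone f 0 h' (S (Suc n))"
      using rcone_add[OF h, of "\<lambda>x. \<rho> ^ n * c x" "\<rho> ^ n"]
      by (simp add: h'_def S_def \<rho>_def of_rat_power)
    moreover have "\<alpha>'' * \<rho> ^ Suc n + supr A (V (Suc n) h') \<le> supr A (\<lambda>x. V (Suc n) h' x + \<rho> ^ Suc n * d x)"
      if "d \<in> D (Suc n)" for d
    proof -
      have "d \<in> D n"
        using that rcone_antimono[of f "Suc n" _ 1 n] by (auto simp: D_def)
      then show ?thesis
        using d0(3) by (simp add: V')
    qed
    moreover have "\<alpha> * \<rho> ^ n + supr A (V n h) \<le> supr A (V (Suc n) h')"
    proof -
      have "\<alpha> * \<rho> ^ n \<le> \<alpha>' * \<rho> ^ n"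
        using \<alpha>' \<rho>(1) by (intro mult_right_mono) auto
      then show ?thesis
        using rate[OF d0(1)] unfolding V' by linarith
    qed
    ultimately show "\<exists>h'. ?P (Suc n) h' \<and> ?Q n h h'"
      using d0(2) c(1) by (intro exI[of _ h'] conjI exI[of _ \<alpha>''] exI[of _ c]) (auto simp: h'_def)
  qed
  then obtain h where h: "\<And>n. rcone f 0 (h n) (S n)" and hQ: "\<And>n. ?Q n (h n) (h (Suc n))"
    by blast
  from hQ obtain c where c: "\<And>n. rcone f n (c n) 1" "\<And>n. h (Suc n) = (\<lambda>x. h n x + \<rho> ^ n * c n x)"
    and gain: "\<And>n. \<alpha> * \<rho> ^ n + supr A (V n (h n)) \<le> supr A (V (Suc n) (h (Suc n)))"
    by metis
  obtain g where g: "lin g" "env c g" "\<And>x. \<bar>g x\<bar> \<le> q x"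
    using uball_generalised_limit[of c] hull_uball[OF c(1)] by blast
  have "env f g"
    using c(1) g(2) by (rule env_convex)
  define W where "W n x = h n x - S n * g x" for n x
  have V_W: "supr A (V n (h n)) = supr A (W n)" for n
    unfolding V_def W_def[abs_def] using stable[OF h G(1) \<open>env f g\<close>] .
  have W0: "W 0 b = h 0 b" and W_Suc: "W (Suc n) b = W n b + \<rho> ^ n * (c n b - g b)" for n b
    by (simp_all add: W_def S_def c(2) algebra_simps)
  have "h 0 b = 0" for b
    using rc[OF h, of 0] by (simp add: S_def)
  then have W_sum: "W n b = (\<Sum>i<n. \<rho> ^ i * (c i b - g b))" for n b
    by (induction n) (simp_all add: W0 W_Suc)
  have cg: "\<bar>c i b - g b\<bar> \<le> 2 * q b" for i b
    using uball_le[OF hull_uball[OF c(1)], of i b] g(3)[of b] by linarith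
  obtain U where U: "U \<in> dual" "\<And>b. (\<lambda>i. \<rho> ^ i * (c i b - g b)) sums U b"
  proof (rule geometric_series_dual[of "\<lambda>i b. c i b - g b" 2 "\<lambda>i. \<rho> ^ i" \<rho>])
    show "lin (\<lambda>b. c i b - g b)" for i
      using lin_comb[OF uball_lin[OF hull_uball[OF c(1)]] g(1), of 1 i "-1"] by simp
  qed (use cg \<rho> that in auto)
  have term_le: "\<bar>\<rho> ^ i * (c i b - g b)\<bar> \<le> 2 * M * \<rho> ^ i" if "b \<in> A" for b i
  proof -
    have "\<bar>c i b - g b\<bar> \<le> 2 * M"
      using cg[of i b] M(2)[OF that] by linarith
    then show ?thesis
      using \<rho>(1) by (simp add: abs_mult mult.commute mult_right_mono)
  qed
  have tail: "\<bar>U b - W n b\<bar> \<le> 4 * M * \<rho> ^ n" if "b \<in> A" for b n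
  proof -
    from geometric_tail_bound[OF U(2) term_le[OF that]]
    have "\<bar>U b - W n b\<bar> \<le> 2 * M * \<rho> ^ n / (1 - \<rho>)"
      using \<rho> by (simp add: W_sum)
    also have "\<dots> \<le> 2 * M * \<rho> ^ n / (1/2)"
      using \<rho> M(1) by (intro divide_left_mono) auto
    finally show ?thesis
      by simp
  qed
  obtain a where a: "a \<in> A" "\<And>b. b \<in> A \<Longrightarrow> U b \<le> U a"
    using attain[OF U(1)] by blast
  have far: "g a + \<alpha> / 2 \<le> c n a" for n
  proof -
    have bW: "bounded_abs_on A (W n)"
    proof (rule bounded_abs_onI)
      fix b assume "b \<in> A"
      have "\<bar>W n b\<bar> \<le> (\<Sum>i<n. \<bar>\<rho> ^ i * (c i b - g b)\<bar>)"
        unfolding W_sum by (rule sum_abs)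
      also have "\<dots> \<le> (\<Sum>i<n. 2 * M * \<rho> ^ i)"
        by (intro sum_mono term_le \<open>b \<in> A\<close>)
      finally show "\<bar>W n b\<bar> \<le> (\<Sum>i<n. 2 * M * \<rho> ^ i)" .
    qed
    have "W n a + \<alpha> * \<rho> ^ n \<le> supr A (W (Suc n))"
      using supr_upper[OF bW a(1)] gain[of n] by (simp add: V_W)
    also have "\<dots> \<le> U a + 4 * M * \<rho> ^ Suc n"
    proof (rule supr_least[OF A])
      fix b assume "b \<in> A"
      then show "W (Suc n) b \<le> U a + 4 * M * \<rho> ^ Suc n"
        using tail[of b "Suc n"] a(2)[of b] by linarith
    qed
    also have "\<dots> \<le> W (Suc n) a + 8 * M * \<rho> ^ Suc n"
      using tail[OF a(1), of "Suc n"] by linarith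
    finally have "\<alpha> * \<rho> ^ n \<le> \<rho> ^ n * (c n a - g a) + (8 * M * \<rho>) * \<rho> ^ n"
      by (simp add: W_Suc)
    also have "(8 * M * \<rho>) * \<rho> ^ n \<le> (\<alpha> / 2) * \<rho> ^ n"
      using \<rho> M(1) by (intro mult_right_mono) (auto simp: field_simps)
    finally have "\<rho> ^ n * (\<alpha> / 2) \<le> \<rho> ^ n * (c n a - g a)"
      by (simp add: algebra_simps)
    then have "\<alpha> / 2 \<le> c n a - g a"
      using \<rho>(1) by simp
    then show ?thesis
      by simp
  qed
  have "g a + \<alpha> / 2 \<le> g a"
    by (rule env_lower[OF g(2)]) (simp add: far)
  then show False
    using \<alpha>(1) by simp
qed

end

section \<open>Real parts of scalars\<close>

lemma additive_isometry_real:
  fixes T :: "real \<Rightarrow> 'k::real_normed_field"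
  assumes add: "\<And>x y. T (x + y) = T x + T y" and one: "T 1 = 1" and norm: "\<And>x. norm (T x) = \<bar>x\<bar>"
  shows "T c = of_real c"
proof -
  have zero: "T 0 = 0"
    using add[of 0 0] by simp
  have minus: "T (- x) = - T x" for x
    using add[of x "- x"] zero by (simp add: eq_neg_iff_add_eq_0 add.commute)
  have nat: "T (real n * x) = of_nat n * T x" for n x
    by (induction n) (simp_all add: zero add distrib_right)
  have int: "T (of_int m) = of_int m" for m
  proof (cases m)
    case (nonneg n)
    then show ?thesis
      using nat[of n 1] one by simp
  next
    case (neg n)
    then show ?thesis
      using nat[of "Suc n" 1] one minus[of "real (Suc n)"] by simp
  qed
  \<comment> \<open>\<open>T\<close> fixes the integer part of \<open>n c\<close> and is isometric on the fractional part, so the error at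
    \<open>n c\<close>, which is \<open>n\<close> times the error at \<open>c\<close>, stays below 2.\<close>
  have bound: "real n * norm (T c - of_real c) \<le> 2" for n
  proof -
    define m where "m = \<lfloor>real n * c\<rfloor>"
    have m: "\<bar>real n * c - of_int m\<bar> \<le> 1"
      unfolding m_def by linarith
    have "T (real n * c) = T (real n * c - of_int m) + of_int m"
      using add[of "real n * c - of_int m" "of_int m"] int by simp
    then have "of_nat n * (T c - of_real c) = T (real n * c - of_int m) - of_real (real n * c - of_int m)"
      using nat[of n c] by (simp add: algebra_simps)
    then have "real n * norm (T c - of_real c) = norm (T (real n * c - of_int m) - of_real (real n * c - of_int m))"
      by (metis norm_mult norm_of_nat)
    also have "\<dots> \<le> norm (T (real n * c - of_int m)) + norm (of_real (real n * c - of_int m) :: 'k)"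
      by (rule norm_triangle_ineq4)
    also have "\<dots> \<le> 2"
      using m by (simp only: norm norm_of_real)
    finally show ?thesis .
  qed
  have "norm (T c - of_real c) = 0"
  proof (rule ccontr)
    assume "norm (T c - of_real c) \<noteq> 0"
    then obtain n where "2 < real n * norm (T c - of_real c)"
      using reals_Archimedean3[of "norm (T c - of_real c)"] by auto
    then show False
      using bound[of n] by linarith
  qed
  then show ?thesis by simp
qed

text \<open>The properties of the real part that allow real functionals to replace scalar ones. Here \<open>e\<close> is
  \<open>1\<close> for the real and the imaginary unit for the complex numbers; the last clause represents real
  functionals of scalars, and thereby recovers a scalar functional from its real part.\<close>

definition real_part :: "('k::real_or_complex \<Rightarrow> real) \<Rightarrow> 'k \<Rightarrow> bool"
  where "real_part re e \<longleftrightarrow>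
    (\<forall>a b. re (a + b) = re a + re b) \<and> (\<forall>c a. re (of_real c * a) = c * re a) \<and>
    (\<forall>a. \<bar>re a\<bar> \<le> norm a) \<and> (\<forall>a. \<exists>u. norm u = 1 \<and> re (u * a) = norm a) \<and>
    (\<forall>a. norm a \<le> \<bar>re a\<bar> + \<bar>re (e * a)\<bar>) \<and>
    (\<forall>l :: 'k \<Rightarrow> real. (\<forall>a b. l (a + b) = l a + l b) \<longrightarrow> (\<forall>c a. l (of_real c * a) = c * l a) \<longrightarrow>
      (\<exists>w. \<forall>a. l a = re (a * w)))"

lemma exists_real_part: "\<exists>re e. real_part (re :: 'k::real_or_complex \<Rightarrow> real) e"
  using real_or_complex[where 'a = 'k]
proof (elim disjE exE conjE)
  fix \<phi> :: "real \<Rightarrow> 'k"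
  assume bij: "bij \<phi>" and hom: "\<forall>x y. \<phi> (x + y) = \<phi> x + \<phi> y \<and> \<phi> (x * y) = \<phi> x * \<phi> y"
    and norm: "\<forall>x. norm (\<phi> x) = norm x"
  have "\<phi> 1 \<noteq> 0"
    using norm by (metis norm_one norm_zero zero_neq_one)
  then have one: "\<phi> 1 = 1"
    using hom by (metis mult_cancel_right1 mult_1)
  have \<phi>: "\<phi> c = of_real c" for c
    by (rule additive_isometry_real) (use hom norm one in auto)
  define re where "re = inv \<phi>"
  have of_re: "of_real (re a) = a" for a
    using bij \<phi>[of "re a"] by (simp add: re_def bij_is_surj surj_f_inv_f)
  have re_of: "re (of_real c) = c" for c
    using bij \<phi>[of c] by (simp add: re_def bij_is_inj inv_f_eq)
  have re_norm: "norm a = \<bar>re a\<bar>" for a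
    by (metis of_re norm_of_real)
  have re_add: "re (a + b) = re a + re b" and re_mult: "re (a * b) = re a * re b" for a b
    by (metis of_re re_of of_real_add of_real_mult)+
  have "real_part re 1"
    unfolding real_part_def
  proof (intro conjI allI impI)
    fix a
    show "\<exists>u. norm u = 1 \<and> re (u * a) = norm a"
      by (rule exI[of _ "if 0 \<le> re a then 1 else - 1"])
        (use re_mult[of "-1" a] re_of[of "-1"] in \<open>auto simp: re_norm[of a]\<close>)
  next
    fix l :: "'k \<Rightarrow> real"
    assume l: "\<forall>c a. l (of_real c * a) = c * l a"
    have "l a = re (a * of_real (l 1))" for a
      using l[rule_format, of "re a" 1] by (simp add: of_re re_mult re_of)
    then show "\<exists>w. \<forall>a. l a = re (a * w)" by blast
  qed (simp_all add: re_add re_mult re_of re_norm)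
  then show ?thesis by blast
next
  fix \<phi> :: "complex \<Rightarrow> 'k"
  assume bij: "bij \<phi>" and hom: "\<forall>x y. \<phi> (x + y) = \<phi> x + \<phi> y \<and> \<phi> (x * y) = \<phi> x * \<phi> y"
    and norm: "\<forall>x. norm (\<phi> x) = norm x"
  have "\<phi> 1 \<noteq> 0"
    using norm by (metis norm_one norm_zero zero_neq_one)
  then have one: "\<phi> 1 = 1"
    using hom by (metis mult_cancel_right1 mult_1)
  have \<phi>: "\<phi> (complex_of_real c) = of_real c" for c
    by (rule additive_isometry_real[of "\<lambda>c. \<phi> (complex_of_real c)"]) (use hom norm one in auto)
  define \<psi> where "\<psi> = inv \<phi>"
  have \<phi>\<psi>: "\<phi> (\<psi> a) = a" for a
    using bij by (simp add: \<psi>_def bij_is_surj surj_f_inv_f)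
  have \<psi>\<phi>: "\<psi> (\<phi> z) = z" for z
    using bij by (simp add: \<psi>_def bij_is_inj inv_f_f)
  have \<psi>_add: "\<psi> (a + b) = \<psi> a + \<psi> b" and \<psi>_mult: "\<psi> (a * b) = \<psi> a * \<psi> b" for a b
    using hom by (metis \<phi>\<psi> \<psi>\<phi>)+
  have \<psi>_of: "\<psi> (of_real c) = complex_of_real c" for c
    by (metis \<phi> \<psi>\<phi>)
  have \<psi>_norm: "norm (\<psi> a) = norm a" for a
    by (metis norm \<phi>\<psi>)
  have "real_part (\<lambda>a. Re (\<psi> a)) (\<phi> \<i>)"
    unfolding real_part_def
  proof (intro conjI allI impI)
    fix a
    show "\<bar>Re (\<psi> a)\<bar> \<le> norm a"
      using abs_Re_le_cmod[of "\<psi> a"] by (simp add: \<psi>_norm)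
    show "norm a \<le> \<bar>Re (\<psi> a)\<bar> + \<bar>Re (\<psi> (\<phi> \<i> * a))\<bar>"
      using cmod_le[of "\<psi> a"] by (simp add: \<psi>_norm \<psi>_mult \<psi>\<phi>)
    show "\<exists>u. norm u = 1 \<and> Re (\<psi> (u * a)) = norm a"
    proof (cases "a = 0")
      case True
      then show ?thesis
        using \<psi>_norm[of 0] by (intro exI[of _ 1]) simp
    next
      case False
      define w where "w = cnj (\<psi> a) / complex_of_real (norm a)"
      have "w * \<psi> a = complex_of_real (norm a)"
        using False complex_norm_square[of "\<psi> a"] by (simp add: w_def \<psi>_norm power2_eq_square field_simps)
      moreover have "norm w = 1"
        using False by (simp add: w_def norm_divide \<psi>_norm)
      ultimately show ?thesis
        using norm by (intro exI[of _ "\<phi> w"]) (simp add: \<psi>_mult \<psi>\<phi>)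
    qed
  next
    fix l :: "'k \<Rightarrow> real"
    assume l: "\<forall>a b. l (a + b) = l a + l b" "\<forall>c a. l (of_real c * a) = c * l a"
    have "l a = Re (\<psi> (a * \<phi> (Complex (l 1) (- l (\<phi> \<i>)))))" for a
    proof -
      have "a = of_real (Re (\<psi> a)) * 1 + of_real (Im (\<psi> a)) * \<phi> \<i>"
        using hom \<phi> \<phi>\<psi>[of a] complex_eq[of "\<psi> a"] by (metis mult.commute mult_1_right)
      then have "l a = Re (\<psi> a) * l 1 + Im (\<psi> a) * l (\<phi> \<i>)"
        using l by metis
      then show ?thesis
        by (simp add: \<psi>_mult \<psi>\<phi>)
    qed
    then show "\<exists>w. \<forall>a. l a = Re (\<psi> (a * w))" by blast
  qed (simp_all add: \<psi>_add \<psi>_mult \<psi>_of)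
  then show ?thesis by blast
qed

section \<open>The weak topology through real functionals\<close>

locale extended_banach_real_part = extended_banach_space scl nrm
  for scl :: "'k::real_or_complex \<Rightarrow> 'v::ab_group_add \<Rightarrow> 'v" and nrm :: "'v \<Rightarrow> ennreal" +
  fixes re :: "'k \<Rightarrow> real" and e :: 'k
  assumes real_part: "real_part re e"
begin

lemma re_add: "re (a + b) = re a + re b"
  and re_of_real_mult: "re (of_real c * a) = c * re a"
  and abs_re_le: "\<bar>re a\<bar> \<le> norm a"
  and norm_le_re: "norm a \<le> \<bar>re a\<bar> + \<bar>re (e * a)\<bar>"
  using real_part by (auto simp: real_part_def)

lemma re_rotate: "\<exists>u. norm u = 1 \<and> re (u * a) = norm a"
  using real_part by (simp add: real_part_def)

lemma re_represent:
  assumes "\<And>a b. l (a + b) = l a + l b" "\<And>c a. l (of_real c * a) = c * l a"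
  shows "\<exists>w. \<forall>a. l a = re (a * w)"
  using real_part assms by (simp add: real_part_def)

lemma re_minus: "re (- a) = - re a"
  using re_of_real_mult[of "-1" a] by simp

lemma re_diff: "re (a - b) = re a - re b"
  using re_add[of a "- b"] by (simp add: re_minus)

definition sr :: "real \<Rightarrow> 'v \<Rightarrow> 'v"
  where "sr c x = scl (of_real c) x"

sublocale rv: real_vs sr
  by unfold_locales (simp_all add: sr_def scale_right_distrib scale_left_distrib)

definition Xfin :: "'v set"
  where "Xfin = finite_part nrm"

text \<open>Off the finite part this takes the default value \<open>0\<close>.\<close>

definition qn :: "'v \<Rightarrow> real"
  where "qn x = enn2real (nrm x)"

lemma nrm_qn: "x \<in> Xfin \<Longrightarrow> nrm x = ennreal (qn x)"
  by (simp add: Xfin_def finite_part_def qn_def)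

lemma qn_nonneg: "0 \<le> qn x"
  by (simp add: qn_def)

lemma in_Xfin_iff: "x \<in> Xfin \<longleftrightarrow> nrm x < \<infinity>"
  by (simp add: Xfin_def finite_part_def)

lemma Xfin_add: "x \<in> Xfin \<Longrightarrow> y \<in> Xfin \<Longrightarrow> x + y \<in> Xfin"
  unfolding in_Xfin_iff using nrm_triangle[of x y] by (simp add: le_less_trans)

lemma Xfin_scl: "x \<in> Xfin \<Longrightarrow> scl a x \<in> Xfin"
  by (simp add: in_Xfin_iff nrm_scale ennreal_mult_less_top)

lemma Xfin_diff: "x \<in> Xfin \<Longrightarrow> y \<in> Xfin \<Longrightarrow> x - y \<in> Xfin"
  using Xfin_add[of x "scl (-1) y"] Xfin_scl[of y "-1"] by simp

lemma Xfin_zero: "0 \<in> Xfin"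
  using nrm_eq_0_iff[of 0] by (simp add: in_Xfin_iff)

lemma Xfin_subspace: "rv.subspace Xfin"
  by (simp add: rv.subspace_def Xfin_zero Xfin_add sr_def Xfin_scl)

lemma qn_scl: "qn (scl a x) = norm a * qn x"
  by (simp add: qn_def nrm_scale enn2real_mult)

lemma qn_sr: "qn (sr c x) = \<bar>c\<bar> * qn x"
  by (simp add: sr_def qn_scl)

lemma qn_add: "x \<in> Xfin \<Longrightarrow> y \<in> Xfin \<Longrightarrow> qn (x + y) \<le> qn x + qn y"
  using nrm_triangle[of x y] Xfin_add[of x y] by (simp add: nrm_qn ennreal_plus[symmetric] qn_nonneg del: ennreal_plus)

lemma qn_eq_0: "x \<in> Xfin \<Longrightarrow> qn x = 0 \<longleftrightarrow> x = 0"
  using nrm_eq_0_iff[of x] by (simp add: nrm_qn qn_nonneg)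

lemma ext_dist_less:
  assumes "ext_dist nrm x y < r" "r \<le> 1" shows "x - y \<in> Xfin" "qn (x - y) < r"
proof -
  have "min 1 (nrm (x - y)) < top"
    by (simp add: min_less_iff_disj)
  then have "min 1 (nrm (x - y)) = ennreal (ext_dist nrm x y)"
    unfolding ext_dist_def by (rule ennreal_enn2real[symmetric])
  also have "\<dots> < ennreal r"
    using assms(1) by (intro ennreal_lessI) (auto simp: ext_dist_def intro: le_less_trans[OF enn2real_nonneg])
  finally have "min 1 (nrm (x - y)) < ennreal r" .
  then have *: "nrm (x - y) < ennreal r"
    using assms(2) by (auto simp: min_def split: if_splits)
  then show "x - y \<in> Xfin"
    by (simp add: in_Xfin_iff less_trans)
  then show "qn (x - y) < r"
    using * by (simp add: nrm_qn ennreal_less_iff qn_nonneg)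
qed

lemma ext_dist_le:
  assumes "x - y \<in> Xfin" shows "ext_dist nrm x y \<le> qn (x - y)"
  using assms unfolding ext_dist_def qn_def
  by (intro enn2real_mono) (auto simp: in_Xfin_iff)

text \<open>Points at distance less than \<open>1\<close> differ by an element of the finite part, so continuity of a linear
  functional is a condition on its restriction to the finite part.\<close>

lemma cont_dual_iff:
  assumes f: "Vector_Spaces.linear scl (*) f"
  shows "f \<in> cont_dual scl nrm \<longleftrightarrow> (\<exists>C. \<forall>x\<in>Xfin. norm (f x) \<le> C * qn x)"
proof
  interpret M: Metric_space UNIV "ext_dist nrm"
    by (rule Metric_space_ext_dist)
  have f_add: "f (x + y) = f x + f y" and f_scl: "f (scl a x) = a * f x" for x y a
    using f by (auto simp: Vector_Spaces.linear_iff)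
  have f_0: "f 0 = 0"
    using f_add[of 0 0] by simp
  have f_diff: "f (x - y) = f x - f y" for x y
    using f_add[of "x - y" y] by simp
  {
    assume "f \<in> cont_dual scl nrm"
    then have "continuous_map M.mtopology euclidean f"
      by (simp add: cont_dual_def norm_topology_def)
    then have "openin M.mtopology {x \<in> topspace M.mtopology. f x \<in> ball 0 1}"
      by (rule openin_continuous_map_preimage) simp
    moreover have "0 \<in> {x \<in> topspace M.mtopology. f x \<in> ball 0 1}"
      by (simp add: f_0)
    ultimately obtain r where r: "0 < r" "M.mball 0 r \<subseteq> {x \<in> topspace M.mtopology. f x \<in> ball 0 1}"
      unfolding M.openin_mtopology by blast
    have "norm (f x) \<le> (2 / r) * qn x" if x: "x \<in> Xfin" for x
    proof (cases "x = 0")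
      case False
      then have qx: "0 < qn x"
        using qn_eq_0[OF x] qn_nonneg[of x] by simp
      define t where "t = r / (2 * qn x)"
      have t: "0 < t" "t * qn x = r / 2"
        using qx r(1) by (auto simp: t_def)
      have "0 - sr t x = scl (- of_real t) x"
        by (simp add: sr_def)
      moreover have "scl (- of_real t) x \<in> Xfin" "qn (scl (- of_real t) x) = r / 2"
        using Xfin_scl[OF x, of "- of_real t"] qn_scl[of "- of_real t" x] t
        by (simp_all del: scale_minus_left)
      ultimately have "0 - sr t x \<in> Xfin" "qn (0 - sr t x) = r / 2"
        by metis+
      then have "sr t x \<in> M.mball 0 r"
        using ext_dist_le[of 0 "sr t x"] r(1) by (simp add: M.mball_def)
      then have "norm (f (sr t x)) < 1"
        using r(2) by auto
      then have "t * norm (f x) < 1"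
        using t(1) by (simp add: sr_def f_scl norm_mult)
      then show ?thesis
        using qx r(1) by (simp add: t_def field_simps)
    qed (use qn_nonneg[of 0] r(1) in \<open>simp add: f_0\<close>)
    then show "\<exists>C. \<forall>x\<in>Xfin. norm (f x) \<le> C * qn x"
      by blast
  }
  {
    assume "\<exists>C. \<forall>x\<in>Xfin. norm (f x) \<le> C * qn x"
    then obtain C where C: "\<And>x. x \<in> Xfin \<Longrightarrow> norm (f x) \<le> C * qn x"
      by blast
    have "continuous_map M.mtopology euclidean f"
      unfolding continuous_map_def
    proof (intro conjI allI impI)
      fix U :: "'k set" assume "openin euclidean U"
      then have U: "open U" by simp
      have "\<exists>r>0. M.mball x r \<subseteq> {x. f x \<in> U}" if fx: "f x \<in> U" for x
      proof -
        obtain \<epsilon> where \<epsilon>: "0 < \<epsilon>" "ball (f x) \<epsilon> \<subseteq> U"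
          using openE[OF U fx] by metis
        define r where "r = min 1 (\<epsilon> / (\<bar>C\<bar> + 1))"
        have "0 < \<bar>C\<bar> + 1"
          by simp
        then have "\<epsilon> / (\<bar>C\<bar> + 1) * (\<bar>C\<bar> + 1) = \<epsilon>" "0 < \<epsilon> / (\<bar>C\<bar> + 1)"
          using \<epsilon>(1) by simp_all
        moreover have "r * (\<bar>C\<bar> + 1) \<le> \<epsilon> / (\<bar>C\<bar> + 1) * (\<bar>C\<bar> + 1)"
          unfolding r_def by (rule mult_right_mono) auto
        ultimately have r: "0 < r" "r \<le> 1" "r * (\<bar>C\<bar> + 1) \<le> \<epsilon>"
          by (simp_all add: r_def)
        have "f y \<in> U" if "ext_dist nrm x y < r" for y
        proof -
          have y: "x - y \<in> Xfin" "qn (x - y) < r"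
            using ext_dist_less[OF that r(2)] by auto
          have "norm (f x - f y) \<le> (\<bar>C\<bar> + 1) * qn (x - y)"
            using C[OF y(1)] mult_right_mono[of C "\<bar>C\<bar> + 1" "qn (x - y)"] qn_nonneg[of "x - y"]
            unfolding f_diff by linarith
          also have "\<dots> < (\<bar>C\<bar> + 1) * r"
            using y(2) by (intro mult_strict_left_mono) auto
          finally have "f y \<in> ball (f x) \<epsilon>"
            using r(3) by (simp add: dist_norm mult.commute)
          then show ?thesis
            using \<epsilon>(2) by blast
        qed
        then show ?thesis
          using r(1) by (auto simp: M.mball_def)
      qed
      then show "openin M.mtopology {x \<in> topspace M.mtopology. f x \<in> U}"
        by (simp add: M.openin_mtopology)
    qed simp
    then show "f \<in> cont_dual scl nrm"
      using f by (simp add: cont_dual_def norm_topology_def)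
  }
qed

lemma cont_dual_linear:
  assumes "f \<in> cont_dual scl nrm"
  shows "f (x + y) = f x + f y" "f (scl a x) = a * f x" "f (x - y) = f x - f y"
proof -
  have f: "Vector_Spaces.linear scl (*) f"
    using assms by (simp add: cont_dual_def)
  show "f (x + y) = f x + f y" "f (scl a x) = a * f x"
    using f by (auto simp: Vector_Spaces.linear_iff)
  have "f (u + v) = f u + f v" for u v
    using f by (auto simp: Vector_Spaces.linear_iff)
  from this[of "x - y" y] show "f (x - y) = f x - f y"
    by simp
qed

definition real_dual :: "('v \<Rightarrow> real) set"
  where "real_dual = {g. rv.lin g \<and> (\<exists>C. \<forall>x\<in>Xfin. \<bar>g x\<bar> \<le> C * qn x)}"

lemma real_dual_lin: "g \<in> real_dual \<Longrightarrow> rv.lin g"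
  by (simp add: real_dual_def)

lemma re_cont_dual:
  assumes f: "f \<in> cont_dual scl nrm" shows "(\<lambda>x. re (f x)) \<in> real_dual"
proof -
  obtain C where "\<And>x. x \<in> Xfin \<Longrightarrow> norm (f x) \<le> C * qn x"
    using f cont_dual_iff[of f] by (auto simp: cont_dual_def)
  then have "\<forall>x\<in>Xfin. \<bar>re (f x)\<bar> \<le> C * qn x"
    using abs_re_le order_trans by blast
  then show ?thesis
    using cont_dual_linear[OF f] by (auto simp: real_dual_def rv.lin_def re_add sr_def re_of_real_mult)
qed

lemma cont_dual_mult:
  assumes f: "f \<in> cont_dual scl nrm" shows "(\<lambda>x. a * f x) \<in> cont_dual scl nrm"
proof -
  have f': "Vector_Spaces.linear scl (*) f"
    using f by (simp add: cont_dual_def)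
  then have l: "Vector_Spaces.linear scl (*) (\<lambda>x. a * f x)"
    by (simp add: Vector_Spaces.linear_iff algebra_simps)
  obtain C where C: "\<And>x. x \<in> Xfin \<Longrightarrow> norm (f x) \<le> C * qn x"
    using f cont_dual_iff[OF f'] by auto
  have "norm (a * f x) \<le> (norm a * C) * qn x" if "x \<in> Xfin" for x
    using mult_left_mono[OF C[OF that], of "norm a"] by (simp add: norm_mult algebra_simps)
  then show ?thesis
    using cont_dual_iff[OF l] by blast
qed

text \<open>The functional \<open>f\<close> with real part \<open>g\<close> has \<open>f x = w\<close>, where \<open>w\<close> represents \<open>a \<mapsto> g (a x)\<close>.\<close>

lemma real_dual_is_real_part:
  assumes g: "g \<in> real_dual"
  obtains f where "f \<in> cont_dual scl nrm" "g = (\<lambda>x. re (f x))"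
proof -
  note gl = rv.lin_add[OF real_dual_lin[OF g]] rv.lin_sc[OF real_dual_lin[OF g]]
  have "\<exists>w. \<forall>a. g (scl a x) = re (a * w)" for x
  proof (rule re_represent)
    fix a b show "g (scl (a + b) x) = g (scl a x) + g (scl b x)"
      by (simp add: scale_left_distrib gl)
    fix c show "g (scl (of_real c * a) x) = c * g (scl a x)"
      using gl(2)[of c "scl a x"] by (simp add: sr_def)
  qed
  then obtain f where f: "\<And>x a. g (scl a x) = re (a * f x)"
    by metis
  have unique: "w = w'" if "\<And>a. re (a * w) = re (a * w')" for w w'
  proof -
    obtain u where "re (u * (w - w')) = norm (w - w')"
      using re_rotate by blast
    then show ?thesis
      using that[of u] by (simp add: right_diff_distrib re_diff)
  qed
  have "vector_space ((*) :: 'k \<Rightarrow> 'k \<Rightarrow> 'k)"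
    by unfold_locales (auto simp: algebra_simps)
  moreover have "f (x + y) = f x + f y" for x y
    by (rule unique) (simp add: f[symmetric] distrib_left re_add scale_right_distrib gl)
  moreover have "f (scl b x) = b * f x" for b x
    by (rule unique) (simp add: f[symmetric] mult.assoc[symmetric])
  ultimately have l: "Vector_Spaces.linear scl (*) f"
    using vector_space_axioms by (simp add: Vector_Spaces.linear_iff)
  obtain C where C: "\<And>x. x \<in> Xfin \<Longrightarrow> \<bar>g x\<bar> \<le> C * qn x"
    using g by (auto simp: real_dual_def)
  have "norm (f x) \<le> C * qn x" if x: "x \<in> Xfin" for x
  proof -
    obtain u where u: "norm u = 1" "re (u * f x) = norm (f x)"
      using re_rotate by blast
    then show ?thesis
      using C[OF Xfin_scl[OF x, of u]] f[of u x] by (simp add: qn_scl)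
  qed
  then have "f \<in> cont_dual scl nrm"
    using cont_dual_iff[OF l] by blast
  then show ?thesis
    using that f[of 1] by auto
qed

definition ev :: "'v \<Rightarrow> ('v \<Rightarrow> real) \<Rightarrow> real"
  where "ev x = (\<lambda>g\<in>real_dual. g x)"

abbreviation prodtop :: "(('v \<Rightarrow> real) \<Rightarrow> real) topology"
  where "prodtop \<equiv> product_topology (\<lambda>_. euclideanreal) real_dual"

abbreviation weak :: "'v topology"
  where "weak \<equiv> weak_topology scl nrm"

lemma continuous_weak_cont_dual:
  assumes f: "f \<in> cont_dual scl nrm" shows "continuous_map weak euclidean f"
  unfolding continuous_map_def
proof (intro conjI allI impI)
  fix U :: "'k set" assume "openin euclidean U"
  then have U: "open U" by simp
  show "openin weak {x \<in> topspace weak. f x \<in> U}"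
  proof (subst openin_subopen, intro ballI)
    fix x assume "x \<in> {x \<in> topspace weak. f x \<in> U}"
    then obtain \<epsilon> where \<epsilon>: "0 < \<epsilon>" "ball (f x) \<epsilon> \<subseteq> U"
      using U open_contains_ball by blast
    let ?B = "{y. norm (f (y - x)) < \<epsilon>}"
    have "openin weak ?B"
      unfolding weak_topology_def using f \<epsilon>(1) by (intro topology_generated_by_Basis) blast
    moreover have "x \<in> ?B"
      using \<epsilon>(1) cont_dual_linear(3)[OF f, of x x] by simp
    moreover have "?B \<subseteq> {x \<in> topspace weak. f x \<in> U}"
      using \<epsilon>(2) by (auto simp: topspace_weak_topology cont_dual_linear(3)[OF f] dist_norm norm_minus_commute)
    ultimately show "\<exists>T. openin weak T \<and> x \<in> T \<and> T \<subseteq> {x \<in> topspace weak. f x \<in> U}"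
      by blast
  qed
qed simp

lemma continuous_weak_real_dual:
  assumes "g \<in> real_dual" shows "continuous_map weak euclideanreal g"
proof -
  obtain f where f: "f \<in> cont_dual scl nrm" "g = (\<lambda>x. re (f x))"
    using real_dual_is_real_part[OF assms] by blast
  have "continuous_on UNIV re"
  proof (rule continuous_onI)
    fix a and \<epsilon> :: real assume "0 < \<epsilon>"
    then show "\<exists>d>0. \<forall>b\<in>UNIV. dist b a < d \<longrightarrow> dist (re b) (re a) \<le> \<epsilon>"
      using abs_re_le by (intro exI[of _ \<epsilon>]) (force simp: dist_norm re_diff[symmetric] intro: order_trans less_imp_le)
  qed
  then have "continuous_map euclidean euclideanreal re"
    by simp
  from continuous_map_compose[OF continuous_weak_cont_dual[OF f(1)] this] show ?thesis
    by (simp add: f(2) o_def)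
qed

lemma weak_eq_pullback: "weak = pullback_topology UNIV ev prodtop"
proof -
  let ?pb = "pullback_topology UNIV ev prodtop"
  have ext: "ev x \<in> extensional real_dual" for x
    by (simp add: ev_def)
  have top: "topspace ?pb = UNIV"
    using ext by (auto simp: topspace_pullback_topology PiE_def)
  have ev_weak: "continuous_map weak prodtop ev"
    unfolding continuous_map_componentwise
  proof (intro conjI ballI)
    show "ev ` topspace weak \<subseteq> extensional real_dual"
      using ext by auto
    show "continuous_map weak euclideanreal (\<lambda>x. ev x g)" if "g \<in> real_dual" for g
      using continuous_weak_real_dual[OF that] that by (simp add: ev_def)
  qed
  have ev_pb: "continuous_map ?pb prodtop ev"
    using continuous_map_pullback[OF continuous_map_id, of UNIV ev prodtop] by simp
  have g_pb: "continuous_map ?pb euclideanreal g" if "g \<in> real_dual" for g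
    using continuous_map_compose[OF ev_pb continuous_map_product_projection[OF that]] that
    by (simp add: o_def ev_def)
  have id_pb: "continuous_map ?pb weak id"
    unfolding weak_topology_def
  proof (rule continuous_on_generated_topo)
    fix B assume "B \<in> {{y. norm (f (y - x)) < r} | f x r. f \<in> cont_dual scl nrm \<and> 0 < r}"
    then obtain f x r where B: "B = {y. norm (f (y - x)) < r}" and f: "f \<in> cont_dual scl nrm" and "0 < r"
      by blast
    define g where "g = (\<lambda>x. re (f x))"
    define g' where "g' = (\<lambda>x. re (e * f x))"
    have gX: "g \<in> real_dual" "g' \<in> real_dual"
      unfolding g_def g'_def using re_cont_dual[OF f] re_cont_dual[OF cont_dual_mult[OF f]] by auto
    have "openin ?pb B"
    proof (subst openin_subopen, intro ballI)
      fix y assume y: "y \<in> B"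
      define s where "s = (r - norm (f (y - x))) / 2"
      have s: "0 < s"
        using y by (simp add: s_def B)
      let ?T = "{z \<in> topspace ?pb. g z \<in> ball (g y) s} \<inter> {z \<in> topspace ?pb. g' z \<in> ball (g' y) s}"
      have "openin ?pb ?T"
        using openin_continuous_map_preimage[OF g_pb[OF gX(1)], of "ball (g y) s"]
          openin_continuous_map_preimage[OF g_pb[OF gX(2)], of "ball (g' y) s"]
        by (intro openin_Int) (simp_all)
      moreover have "y \<in> ?T"
        using s by (simp add: top)
      moreover have "z \<in> B" if z: "z \<in> ?T" for z
      proof -
        have "\<bar>re (f (z - y))\<bar> < s" "\<bar>re (e * f (z - y))\<bar> < s"
          using z by (simp_all add: g_def g'_def dist_real_def cont_dual_linear(3)[OF f] right_diff_distrib re_diff abs_minus_commute)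
        then have "norm (f (z - y)) < 2 * s"
          using norm_le_re[of "f (z - y)"] by linarith
        moreover have "f (z - x) = f (z - y) + f (y - x)"
          by (simp add: cont_dual_linear(3)[OF f])
        ultimately show ?thesis
          using norm_triangle_ineq[of "f (z - y)" "f (y - x)"] by (simp add: B s_def)
      qed
      ultimately show "\<exists>T. openin ?pb T \<and> y \<in> T \<and> T \<subseteq> B"
        by blast
    qed
    then show "openin ?pb (id -` B \<inter> topspace ?pb)"
      by (simp add: top)
  next
    show "id ` topspace ?pb \<subseteq> \<Union> {{y. norm (f (y - x)) < r} | f x r. f \<in> cont_dual scl nrm \<and> 0 < r}"
      using topspace_weak_topology unfolding weak_topology_def topology_generated_by_topspace by auto
  qed
  show ?thesis
    unfolding topology_eq
  proof (intro allI iffI)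
    fix S assume "openin weak S"
    then have "openin ?pb {x \<in> topspace ?pb. id x \<in> S}"
      by (rule openin_continuous_map_preimage[OF id_pb])
    then show "openin ?pb S"
      by (simp add: top)
  next
    fix S assume "openin ?pb S"
    then obtain U where "openin prodtop U" "S = ev -` U"
      by (auto simp: openin_pullback_topology)
    moreover from this have "openin weak {x \<in> topspace weak. ev x \<in> U}"
      using openin_continuous_map_preimage[OF ev_weak] by blast
    ultimately show "openin weak S"
      by (simp add: topspace_weak_topology vimage_def)
  qed
qed

lemma openin_weak_iff: "openin weak S \<longleftrightarrow> (\<exists>U. openin prodtop U \<and> S = ev -` U)"
  unfolding weak_eq_pullback openin_pullback_topology by simp

lemma limitin_weakI:
  assumes "\<And>g. g \<in> real_dual \<Longrightarrow> (\<lambda>n. g (\<sigma> n)) \<longlonglongrightarrow> g l"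
  shows "limitin weak \<sigma> l sequentially"
proof -
  have lim: "limitin prodtop (ev \<circ> \<sigma>) (ev l) sequentially"
    unfolding limitin_componentwise using assms by (auto simp: ev_def)
  show ?thesis
    unfolding limitin_def
  proof (intro conjI allI impI)
    show "l \<in> topspace weak"
      by (simp add: topspace_weak_topology)
    fix S assume "openin weak S \<and> l \<in> S"
    then obtain U where "openin prodtop U" "S = ev -` U" "ev l \<in> U"
      by (auto simp: openin_weak_iff)
    then show "\<forall>\<^sub>F n in sequentially. \<sigma> n \<in> S"
      using lim by (auto simp: limitin_def)
  qed
qed

lemma openin_weak_basic:
  assumes "finite G" "G \<subseteq> real_dual" "0 < \<epsilon>" shows "openin weak {y. \<forall>g\<in>G. \<bar>g y - g x\<bar> < \<epsilon>}"
proof (cases "G = {}")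
  case True
  then show ?thesis
    using openin_topspace[of weak] by (simp add: topspace_weak_topology)
next
  case False
  have "openin weak {y. \<bar>g y - g x\<bar> < \<epsilon>}" if "g \<in> G" for g
  proof -
    have "openin weak {y \<in> topspace weak. g y \<in> ball (g x) \<epsilon>}"
      using that assms(2) by (intro openin_continuous_map_preimage[OF continuous_weak_real_dual]) (auto)
    then show ?thesis
      by (simp add: topspace_weak_topology dist_real_def abs_minus_commute)
  qed
  then have "openin weak (\<Inter>g\<in>G. {y. \<bar>g y - g x\<bar> < \<epsilon>})"
    using False assms(1) by (intro openin_Inter) auto
  moreover have "(\<Inter>g\<in>G. {y. \<bar>g y - g x\<bar> < \<epsilon>}) = {y. \<forall>g\<in>G. \<bar>g y - g x\<bar> < \<epsilon>}"
    by auto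
  ultimately show ?thesis
    by simp
qed

end

section \<open>Reduction to complete seminormed spaces\<close>

context extended_banach_real_part
begin

text \<open>Here \<open>P\<close> projects onto a subspace that contains the finite part, and \<open>q\<close> is a complete norm on this
  subspace, extended to all vectors through \<open>P\<close>. The last two clauses say that, on the subspace, the
  \<open>q\<close>-bounded functionals are the real parts of the continuous ones.\<close>

definition adapted :: "('v \<Rightarrow> 'v) \<Rightarrow> ('v \<Rightarrow> real) \<Rightarrow> bool"
  where "adapted P q \<longleftrightarrow> complete_seminormed sr q \<and>
    (\<forall>x y. P (x + y) = P x + P y) \<and> (\<forall>c x. P (sr c x) = sr c (P x)) \<and> (\<forall>x. P (P x) = P x) \<and>
    (\<forall>x. q x = 0 \<longleftrightarrow> P x = 0) \<and> (\<forall>x\<in>Xfin. P x = x) \<and>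
    (\<forall>g\<in>real_dual. (\<lambda>x. g (P x)) \<in> complete_seminormed.dual sr q) \<and> complete_seminormed.dual sr q \<subseteq> real_dual"

lemma adaptedD:
  assumes "adapted P q"
  shows "complete_seminormed sr q" "P (x + y) = P x + P y" "P (sr c x) = sr c (P x)"
    "P (P x) = P x" "q x = 0 \<longleftrightarrow> P x = 0" "x \<in> Xfin \<Longrightarrow> P x = x"
    "g \<in> real_dual \<Longrightarrow> (\<lambda>x. g (P x)) \<in> complete_seminormed.dual sr q"
    "complete_seminormed.dual sr q \<subseteq> real_dual"
  using assms unfolding adapted_def by blast+

lemma fixed_subspace: "adapted P q \<Longrightarrow> rv.subspace {x. P x = x}"
  using adaptedD(2)[of P q] adaptedD(3)[of P q] adaptedD(6)[of P q 0] Xfin_zero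
  by (simp add: rv.subspace_def)

lemma complete_seminormedI:
  assumes "\<And>x y. q (x + y) \<le> q x + q y" "\<And>c x. q (sr c x) = \<bar>c\<bar> * q x"
    "\<And>\<sigma>. (\<And>e. 0 < e \<Longrightarrow> \<exists>N::nat. \<forall>m\<ge>N. \<forall>n\<ge>N. q (\<sigma> m - \<sigma> n) < e) \<Longrightarrow> \<exists>x. (\<lambda>n. q (\<sigma> n - x)) \<longlonglongrightarrow> 0"
  shows "complete_seminormed sr q"
  by unfold_locales (use assms in auto)

lemma Xfin_complete:
  fixes \<tau> :: "nat \<Rightarrow> 'v"
  assumes \<tau>: "\<And>n. \<tau> n \<in> Xfin" and cauchy: "\<And>e. 0 < e \<Longrightarrow> \<exists>N. \<forall>m\<ge>N. \<forall>n\<ge>N. qn (\<tau> m - \<tau> n) < e"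
  shows "\<exists>x\<in>Xfin. (\<lambda>n. qn (\<tau> n - x)) \<longlonglongrightarrow> 0"
proof -
  interpret M: Metric_space UNIV "ext_dist nrm"
    by (rule Metric_space_ext_dist)
  have "M.MCauchy \<tau>"
    unfolding M.MCauchy_def
  proof (intro conjI allI impI)
    fix \<epsilon> :: real assume "0 < \<epsilon>"
    then obtain N where N: "\<forall>m\<ge>N. \<forall>n\<ge>N. qn (\<tau> m - \<tau> n) < \<epsilon>"
      using cauchy by blast
    have "ext_dist nrm (\<tau> n) (\<tau> n') < \<epsilon>" if "N \<le> n" "N \<le> n'" for n n'
      using ext_dist_le[OF Xfin_diff[OF \<tau> \<tau>], of n n'] N that by (meson le_less_trans)
    then show "\<exists>N. \<forall>n n'. N \<le> n \<longrightarrow> N \<le> n' \<longrightarrow> ext_dist nrm (\<tau> n) (\<tau> n') < \<epsilon>"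
      by blast
  qed simp
  then obtain x where x: "limitin M.mtopology \<tau> x sequentially"
    using complete by (auto simp: M.mcomplete_def)
  have ev: "\<forall>\<^sub>F n in sequentially. ext_dist nrm (\<tau> n) x < r" if "0 < r" for r
    using x that by (simp add: M.limitin_metric)
  have "\<forall>\<^sub>F n in sequentially. ext_dist nrm (\<tau> n) x < 1"
    by (rule ev) simp
  then obtain n where "ext_dist nrm (\<tau> n) x < 1"
    using eventually_happens by force
  then have "\<tau> n - x \<in> Xfin"
    by (rule ext_dist_less) simp
  then have "x \<in> Xfin"
    using Xfin_diff[OF \<tau>[of n], of "\<tau> n - x"] by simp
  moreover have "(\<lambda>n. qn (\<tau> n - x)) \<longlonglongrightarrow> 0"
  proof (rule order_tendstoI)
    show "\<forall>\<^sub>F n in sequentially. a < qn (\<tau> n - x)" if "a < 0" for a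
      using that qn_nonneg by (auto intro: always_eventually less_le_trans)
    fix a :: real assume "0 < a"
    then have "\<forall>\<^sub>F n in sequentially. ext_dist nrm (\<tau> n) x < min 1 a"
      by (intro ev) simp
    then show "\<forall>\<^sub>F n in sequentially. qn (\<tau> n - x) < a"
      by eventually_elim (use ext_dist_less(2) in fastforce)
  qed
  ultimately show ?thesis
    by (rule bexI[rotated])
qed

lemma adapted_finite_part: "\<exists>P q. adapted P q"
proof -
  interpret pr: vector_space_pair sr sr
    by unfold_locales
  have "Vector_Spaces.linear sr sr (\<lambda>x. x)"
    by (auto simp: Vector_Spaces.linear_iff rv.vector_space_axioms)
  from pr.linear_exists_left_inverse_on[OF this Xfin_subspace]
  obtain P where P: "range P \<subseteq> Xfin" "\<And>x. x \<in> Xfin \<Longrightarrow> P x = x" "Vector_Spaces.linear sr sr P"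
    by (auto simp: inj_on_def)
  have PY: "P x \<in> Xfin" for x
    using P(1) by blast
  have P_add: "P (x + y) = P x + P y" and P_sr: "P (sr c x) = sr c (P x)" for x y c
    using P(3) by (auto simp: Vector_Spaces.linear_iff)
  have P_diff: "P (x - y) = P x - P y" for x y
    using P_add[of "x - y" y] by simp
  define q where "q x = qn (P x)" for x
  have cs: "complete_seminormed sr q"
  proof (rule complete_seminormedI)
    show "q (x + y) \<le> q x + q y" "q (sr c x) = \<bar>c\<bar> * q x" for x y c
      by (simp_all add: q_def P_add P_sr qn_add PY qn_sr)
    fix \<sigma> :: "nat \<Rightarrow> 'v"
    assume cauchy: "\<And>e. 0 < e \<Longrightarrow> \<exists>N. \<forall>m\<ge>N. \<forall>n\<ge>N. q (\<sigma> m - \<sigma> n) < e"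
    have "\<exists>x\<in>Xfin. (\<lambda>n. qn (P (\<sigma> n) - x)) \<longlonglongrightarrow> 0"
      by (rule Xfin_complete[OF PY]) (use cauchy in \<open>simp add: q_def P_diff\<close>)
    then obtain x where x: "x \<in> Xfin" "(\<lambda>n. qn (P (\<sigma> n) - x)) \<longlonglongrightarrow> 0"
      by blast
    then show "\<exists>x. (\<lambda>n. q (\<sigma> n - x)) \<longlonglongrightarrow> 0"
      by (intro exI[of _ x]) (simp add: q_def P_diff P(2))
  qed
  interpret q: complete_seminormed sr q by (rule cs)
  have "adapted P q"
    unfolding adapted_def
  proof (intro conjI allI ballI subsetI)
    show "q x = 0 \<longleftrightarrow> P x = 0" for x
      by (simp add: q_def qn_eq_0 PY)
    fix g
    {
      assume g: "g \<in> real_dual"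
      obtain C where "\<And>x. x \<in> Xfin \<Longrightarrow> \<bar>g x\<bar> \<le> C * qn x"
        using g by (auto simp: real_dual_def)
      then have "\<forall>x. \<bar>g (P x)\<bar> \<le> C * q x"
        by (simp add: q_def PY)
      moreover have "rv.lin (\<lambda>x. g (P x))"
        using real_dual_lin[OF g] by (simp add: rv.lin_def P_add P_sr)
      ultimately show "(\<lambda>x. g (P x)) \<in> q.dual"
        unfolding q.dual_def by blast
    }
    {
      assume g: "g \<in> q.dual"
      obtain C where "\<And>x. \<bar>g x\<bar> \<le> C * q x"
        using q.dualE[OF g] by blast
      then have "\<forall>x\<in>Xfin. \<bar>g x\<bar> \<le> C * qn x"
        by (metis P(2) q_def)
      then show "g \<in> real_dual"
        using q.dual_lin[OF g] by (auto simp: real_dual_def)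
    }
  qed (use cs P_add P_sr P(2) PY in auto)
  then show ?thesis by blast
qed

text \<open>Adjoining one vector to the range of \<open>P\<close>: with \<open>t\<close> the coordinate along \<open>m = s - P s\<close>, the seminorm
  \<open>q + \<bar>t\<bar>\<close> stays complete because the coordinates of a Cauchy sequence converge separately. Since \<open>t\<close>
  vanishes on the finite part, no new restriction on functionals arises there.\<close>

lemma adapted_extend:
  assumes ad: "adapted P q" and s: "P s \<noteq> s"
  shows "\<exists>P' q'. adapted P' q' \<and> P' s = s \<and> (\<forall>x. P x = x \<longrightarrow> P' x = x)"
proof -
  interpret q: complete_seminormed sr q
    using ad by (rule adaptedD)
  note P_add = adaptedD(2)[OF ad] and P_sr = adaptedD(3)[OF ad] and P_P = adaptedD(4)[OF ad]
    and q_0_iff = adaptedD(5)[OF ad] and P_Y = adaptedD(6)[OF ad]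
  have P_diff: "P (x - y) = P x - P y" for x y
    using P_add[of "x - y" y] by simp
  have q_P: "q (P x) = q x" for x
  proof -
    have "q (x - P x) = 0" "q (P x - x) = 0"
      by (simp_all add: q_0_iff P_diff P_P)
    then show ?thesis
      using q.q_add[of "P x" "x - P x"] q.q_add[of x "P x - x"] by simp
  qed
  define m where "m = s - P s"
  have m: "m \<noteq> 0" "P m = 0"
    using s by (simp_all add: m_def P_diff P_P)
  have vs: "vector_space ((*) :: real \<Rightarrow> real \<Rightarrow> real)"
    by unfold_locales (auto simp: algebra_simps)
  interpret pr: vector_space_pair sr "(*) :: real \<Rightarrow> real \<Rightarrow> real"
    using rv.vector_space_axioms vs by (rule vector_space_pair.intro)
  have "rv.independent {m}"
    using m(1) by simp
  from pr.linear_independent_extend[OF this, of "\<lambda>_. 1"]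
  obtain t0 where t0: "Vector_Spaces.linear sr (*) t0" "t0 m = 1"
    by auto
  have t0_lin: "rv.lin t0"
    using t0(1) by (simp add: rv.lin_eq_linear)
  define t where "t x = t0 (x - P x)" for x
  have t_lin: "rv.lin t"
    unfolding rv.lin_def t_def P_add P_sr
    by (simp add: rv.lin_diff[OF t0_lin] rv.lin_add[OF t0_lin] rv.lin_sc[OF t0_lin] algebra_simps)
  have t_P: "t (P x) = 0" for x
    by (simp add: t_def P_P rv.lin_0[OF t0_lin])
  have t_m: "t m = 1"
    by (simp add: t_def m t0(2))
  have t_fix: "t x = 0" if "P x = x" for x
    using t_P[of x] that by simp
  note t_simps = rv.lin_add[OF t_lin] rv.lin_sc[OF t_lin] rv.lin_diff[OF t_lin] t_P t_m
  define P' where "P' x = P x + sr (t x) m" for x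
  define q' where "q' x = q x + \<bar>t x\<bar>" for x
  have P'_add: "P' (x + y) = P' x + P' y" for x y
    by (simp add: P'_def P_add t_simps rv.scale_left_distrib algebra_simps)
  have P'_sr: "P' (sr c x) = sr c (P' x)" for c x
    by (simp add: P'_def P_sr t_simps rv.scale_right_distrib)
  have P_P': "P (P' x) = P x" and t_P': "t (P' x) = t x" for x
    by (simp_all add: P'_def P_add P_sr P_P m(2) t_simps)
  have P'_fix: "P' x = x" if "P x = x" for x
    using that t_fix[OF that] by (simp add: P'_def)
  have cs: "complete_seminormed sr q'"
  proof (rule complete_seminormedI)
    show "q' (x + y) \<le> q' x + q' y" for x y
      using q.q_add[of x y] by (simp add: q'_def t_simps)
    show "q' (sr c x) = \<bar>c\<bar> * q' x" for c x
      by (simp add: q'_def q.q_sc t_simps abs_mult distrib_left)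
    fix \<sigma> :: "nat \<Rightarrow> 'v"
    assume cauchy: "\<And>e. 0 < e \<Longrightarrow> \<exists>N. \<forall>k\<ge>N. \<forall>n\<ge>N. q' (\<sigma> k - \<sigma> n) < e"
    have "\<exists>x. (\<lambda>n. q (\<sigma> n - x)) \<longlonglongrightarrow> 0"
    proof (rule q.complete)
      fix e :: real assume "0 < e"
      have "q x \<le> q' x" for x
        by (simp add: q'_def)
      then show "\<exists>N. \<forall>k\<ge>N. \<forall>n\<ge>N. q (\<sigma> k - \<sigma> n) < e"
        using cauchy[OF \<open>0 < e\<close>] by (meson le_less_trans)
    qed
    then obtain x where x: "(\<lambda>n. q (\<sigma> n - x)) \<longlonglongrightarrow> 0"
      by blast
    have "Cauchy (\<lambda>n. t (\<sigma> n))"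
    proof (rule CauchyI)
      fix e :: real assume "0 < e"
      have "norm (t k - t n) \<le> q' (k - n)" for k n
        by (simp add: q'_def t_simps q.q_nonneg)
      then show "\<exists>N. \<forall>k\<ge>N. \<forall>n\<ge>N. norm (t (\<sigma> k) - t (\<sigma> n)) < e"
        using cauchy[OF \<open>0 < e\<close>] by (meson le_less_trans)
    qed
    then obtain l where l: "(\<lambda>n. t (\<sigma> n)) \<longlonglongrightarrow> l"
      using Cauchy_convergent convergent_def by blast
    define z where "z = P x + sr l m"
    have t_z: "t z = l" and P_z: "P z = P x"
      by (simp_all add: z_def t_simps P_add P_sr P_P m(2))
    have "q (\<sigma> n - z) = q (\<sigma> n - x)" for n
      using q_P[of "\<sigma> n - z"] q_P[of "\<sigma> n - x"] by (simp add: P_diff P_z)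
    moreover have "(\<lambda>n. q (\<sigma> n - x) + \<bar>t (\<sigma> n) - l\<bar>) \<longlonglongrightarrow> 0 + \<bar>l - l\<bar>"
      by (intro tendsto_intros x l)
    ultimately have "(\<lambda>n. q' (\<sigma> n - z)) \<longlonglongrightarrow> 0"
      by (simp add: q'_def t_simps t_z)
    then show "\<exists>x. (\<lambda>n. q' (\<sigma> n - x)) \<longlonglongrightarrow> 0"
      by blast
  qed
  interpret q': complete_seminormed sr q' by (rule cs)
  have "adapted P' q'"
    unfolding adapted_def
  proof (intro conjI allI ballI subsetI)
    show "P' (P' x) = P' x" for x
      by (simp add: P'_def[of "P' x"] P_P' t_P') (simp add: P'_def)
    show "q' x = 0 \<longleftrightarrow> P' x = 0" for x
    proof
      assume "q' x = 0"
      then have "q x = 0" "t x = 0"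
        using q.q_nonneg[of x] by (simp_all add: q'_def add_nonneg_eq_0_iff)
      then show "P' x = 0"
        by (simp add: P'_def q_0_iff)
    next
      assume "P' x = 0"
      then have "t x = 0" "P x = 0"
        using t_P'[of x] P_P'[of x] rv.lin_0[OF t_lin] P_add[of 0 0] by auto
      then show "q' x = 0"
        by (simp add: q'_def q_0_iff)
    qed
    fix g
    {
      assume g: "g \<in> real_dual"
      note g_simps = rv.lin_add[OF real_dual_lin[OF g]] rv.lin_sc[OF real_dual_lin[OF g]]
      obtain C where C: "0 < C" "\<And>x. \<bar>g (P x)\<bar> \<le> C * q x"
        using q.dualE[OF adaptedD(7)[OF ad g]] by blast
      have "\<bar>g (P' x)\<bar> \<le> (C + \<bar>g m\<bar>) * q' x" for x
      proof -
        have "\<bar>g (P' x)\<bar> \<le> C * q x + \<bar>t x\<bar> * \<bar>g m\<bar>"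
          using C(2)[of x] abs_triangle_ineq[of "g (P x)" "t x * g m"] by (simp add: P'_def g_simps abs_mult)
        also have "\<dots> \<le> (C + \<bar>g m\<bar>) * q' x"
          using C(1) q.q_nonneg[of x] by (simp add: q'_def algebra_simps)
        finally show ?thesis .
      qed
      moreover have "rv.lin (\<lambda>x. g (P' x))"
        using real_dual_lin[OF g] by (simp add: rv.lin_def P'_add P'_sr)
      ultimately show "(\<lambda>x. g (P' x)) \<in> q'.dual"
        unfolding q'.dual_def by blast
    }
    {
      assume g: "g \<in> q'.dual"
      obtain C where "\<And>x. \<bar>g x\<bar> \<le> C * q' x"
        using q'.dualE[OF g] by blast
      then have "\<bar>g (P x)\<bar> \<le> C * q x" for x
        by (metis add.right_neutral abs_zero q'_def q_P t_P)
      moreover have "rv.lin (\<lambda>x. g (P x))"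
        using q'.dual_lin[OF g] by (simp add: rv.lin_def P_add P_sr)
      ultimately have "(\<lambda>x. g (P x)) \<in> q.dual"
        unfolding q.dual_def by blast
      then have "(\<lambda>x. g (P x)) \<in> real_dual"
        using adaptedD(8)[OF ad] by blast
      then show "g \<in> real_dual"
        using q'.dual_lin[OF g] by (auto simp: real_dual_def P_Y)
    }
  qed (use cs P'_add P'_sr P'_fix P_Y in auto)
  moreover have "P' s = s"
  proof -
    have "t s = t (m + P s)"
      by (simp add: m_def)
    then have "t s = 1"
      unfolding t_simps by simp
    then show ?thesis
      by (simp add: P'_def m_def)
  qed
  ultimately show ?thesis
    using P'_fix by blast
qed

lemma adapted_finite:
  assumes "finite S" shows "\<exists>P q. adapted P q \<and> (\<forall>s\<in>S. P s = s)"
  using assms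
proof (induction S rule: finite_induct)
  case empty
  then show ?case using adapted_finite_part by simp
next
  case (insert s S)
  then obtain P q where P: "adapted P q" "\<forall>s\<in>S. P s = s"
    by blast
  show ?case
  proof (cases "P s = s")
    case True
    then show ?thesis using P by auto
  next
    case False
    then show ?thesis
      using adapted_extend[OF P(1) False] P(2) by auto
  qed
qed

text \<open>A functional vanishing on the finite part is continuous whatever its values elsewhere, so a set on
  which all continuous functionals are bounded is finite-dimensional modulo the finite part.\<close>

lemma weakly_bounded_finite_dimensional:
  assumes bounded: "\<And>g. g \<in> real_dual \<Longrightarrow> \<exists>C. \<forall>a\<in>A. \<bar>g a\<bar> \<le> C"
  shows "\<exists>S. finite S \<and> A \<subseteq> rv.span (Xfin \<union> S)"
proof -
  obtain B0 where B0: "B0 \<subseteq> Xfin" "rv.independent B0" "Xfin \<subseteq> rv.span B0"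
    using rv.maximal_independent_subset[of Xfin] by blast
  obtain B where B: "B0 \<subseteq> B" "B \<subseteq> B0 \<union> A" "rv.independent B" "B0 \<union> A \<subseteq> rv.span B"
    using rv.maximal_independent_subset_extend[of B0 "B0 \<union> A"] B0(2) by blast
  have "finite (B - B0)"
  proof (rule ccontr)
    assume "infinite (B - B0)"
    then obtain b :: "nat \<Rightarrow> 'v" where b: "inj b" "range b \<subseteq> B - B0"
      using infinite_countable_subset by blast
    have vs: "vector_space ((*) :: real \<Rightarrow> real \<Rightarrow> real)"
      by unfold_locales (auto simp: algebra_simps)
    interpret pr: vector_space_pair sr "(*) :: real \<Rightarrow> real \<Rightarrow> real"
      using rv.vector_space_axioms vs by (rule vector_space_pair.intro)
    obtain g where g: "Vector_Spaces.linear sr (*) g"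
      "\<forall>x\<in>B. g x = (if x \<in> range b then real (inv b x) else 0)"
      using pr.linear_independent_extend[OF B(3), of "\<lambda>x. if x \<in> range b then real (inv b x) else 0"] by metis
    have g_lin: "rv.lin g"
      using g(1) by (simp add: rv.lin_eq_linear)
    have "rv.span B0 \<subseteq> {x. g x = 0}"
    proof (rule rv.span_minimal)
      show "B0 \<subseteq> {x. g x = 0}"
      proof
        fix x assume "x \<in> B0"
        then have "x \<in> B" "x \<notin> range b"
          using B(1) b(2) by blast+
        then show "x \<in> {x. g x = 0}"
          using g(2) by simp
      qed
      show "rv.subspace {x. g x = 0}"
        by (simp add: rv.subspace_def rv.lin_0[OF g_lin] rv.lin_add[OF g_lin] rv.lin_sc[OF g_lin])
    qed
    then have "\<forall>x\<in>Xfin. \<bar>g x\<bar> \<le> 0 * qn x"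
      using B0(3) by auto
    then have "g \<in> real_dual"
      using g_lin unfolding real_dual_def by blast
    then obtain C where C: "\<forall>a\<in>A. \<bar>g a\<bar> \<le> C"
      using bounded by blast
    obtain n where "C < real n"
      using reals_Archimedean2 by blast
    moreover have "g (b n) = real n"
      using g(2) b by (auto simp: image_subset_iff)
    moreover have "b n \<in> A"
      using b(2) B(2) by blast
    ultimately show False
      using C by force
  qed
  moreover have "A \<subseteq> rv.span (Xfin \<union> (B - B0))"
    using B(4) B0(1) rv.span_mono[of B "Xfin \<union> (B - B0)"] by blast
  ultimately show ?thesis by blast
qed

lemma adapted_weakly_bounded:
  assumes "\<And>g. g \<in> real_dual \<Longrightarrow> \<exists>C. \<forall>a\<in>A. \<bar>g a\<bar> \<le> C"
  shows "\<exists>P q. adapted P q \<and> (\<forall>a\<in>A. P a = a)"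
proof -
  obtain S where S: "finite S" "A \<subseteq> rv.span (Xfin \<union> S)"
    using weakly_bounded_finite_dimensional[OF assms] by blast
  obtain P q where P: "adapted P q" "\<forall>s\<in>S. P s = s"
    using adapted_finite[OF S(1)] by blast
  have "rv.span (Xfin \<union> S) \<subseteq> {x. P x = x}"
    using P adaptedD(6)[OF P(1)] by (intro rv.span_minimal fixed_subspace[OF P(1)]) auto
  then show ?thesis
    using P(1) S(2) by blast
qed

lemma real_dual_separates:
  assumes "x \<noteq> 0" obtains g where "g \<in> real_dual" "g x \<noteq> 0"
proof -
  obtain P q where P: "adapted P q" "P x = x"
    using adapted_finite[of "{x}"] by auto
  interpret q: complete_seminormed sr q
    using P(1) by (rule adaptedD)
  obtain f where f: "f \<in> q.uball" "f x = q x"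
    using q.norming_functional by blast
  have "q x \<noteq> 0"
    using adaptedD(5)[OF P(1), of x] P(2) assms by simp
  then show ?thesis
    using that[of f] f adaptedD(8)[OF P(1)] q.uball_dual by auto
qed

section \<open>Compactness notions for the weak topology\<close>

lemma Hausdorff_weak: "Hausdorff_space weak"
proof (rule Hausdorff_space_injective_preimage)
  show "Hausdorff_space prodtop"
    by (simp add: Hausdorff_space_product_topology)
  show "continuous_map weak prodtop ev"
    unfolding continuous_map_def
  proof (intro conjI allI impI)
    show "ev \<in> topspace weak \<rightarrow> topspace prodtop"
      by (auto simp: ev_def)
    show "openin weak {x \<in> topspace weak. ev x \<in> U}" if "openin prodtop U" for U
      using that by (auto simp: openin_weak_iff topspace_weak_topology)
  qed
  show "inj_on ev (topspace weak)"
  proof (rule inj_onI, rule ccontr)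
    fix x y assume eq: "ev x = ev y" and "x \<noteq> y"
    then obtain g where g: "g \<in> real_dual" "g (x - y) \<noteq> 0"
      using real_dual_separates[of "x - y"] by auto
    then show False
      using fun_cong[OF eq, of g] rv.lin_diff[OF real_dual_lin[OF g(1)]] by (simp add: ev_def)
  qed
qed

lemma countably_compact_seq_accumulating:
  assumes cc: "countably_compactin weak A" shows "seq_accumulating real_dual A"
  unfolding seq_accumulating_def
proof (intro allI impI)
  fix \<sigma> :: "nat \<Rightarrow> 'v" assume \<sigma>: "range \<sigma> \<subseteq> A"
  show "\<exists>z. accumulates real_dual \<sigma> z"
  proof (cases "finite (range \<sigma>)")
    case True
    then obtain k where k: "infinite {n. \<sigma> n = \<sigma> k}"
      using pigeonhole_infinite[of UNIV \<sigma>] by auto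
    have "accumulates real_dual \<sigma> (\<sigma> k)"
      unfolding accumulates_def
    proof (intro allI impI)
      fix G and \<epsilon> :: real
      assume "0 < \<epsilon>"
      then have "{n. \<sigma> n = \<sigma> k} \<subseteq> {n. \<forall>g\<in>G. \<bar>g (\<sigma> n) - g (\<sigma> k)\<bar> < \<epsilon>}"
        by auto
      then show "\<exists>\<^sub>\<infinity>n. \<forall>g\<in>G. \<bar>g (\<sigma> n) - g (\<sigma> k)\<bar> < \<epsilon>"
        using k unfolding INFM_iff_infinite by (rule infinite_super)
    qed
    then show ?thesis by blast
  next
    case False
    then have "weak derived_set_of (range \<sigma>) \<noteq> {}"
      using cc \<sigma> by (simp add: countably_compactin_def)
    then obtain z where "z \<in> weak derived_set_of (range \<sigma>)"
      by blast
    then have inf: "infinite (range \<sigma> \<inter> U)" if "openin weak U" "z \<in> U" for U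
      using that by (simp add: derived_set_of_infinite_openin[OF Hausdorff_weak])
    have "accumulates real_dual \<sigma> z"
      unfolding accumulates_def
    proof (intro allI impI)
      fix G and \<epsilon> :: real
      assume G: "finite G" "G \<subseteq> real_dual" and "0 < \<epsilon>"
      let ?U = "{y. \<forall>g\<in>G. \<bar>g y - g z\<bar> < \<epsilon>}"
      have "infinite (range \<sigma> \<inter> ?U)"
        using \<open>0 < \<epsilon>\<close> by (intro inf openin_weak_basic[OF G]) auto
      moreover have "range \<sigma> \<inter> ?U = \<sigma> ` {n. \<sigma> n \<in> ?U}"
        by auto
      ultimately have "infinite {n. \<sigma> n \<in> ?U}"
        using finite_imageI[of "{n. \<sigma> n \<in> ?U}" \<sigma>] by argo
      then show "\<exists>\<^sub>\<infinity>n. \<forall>g\<in>G. \<bar>g (\<sigma> n) - g z\<bar> < \<epsilon>"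
        by (simp add: INFM_iff_infinite)
    qed
    then show ?thesis by blast
  qed
qed

lemma seq_accumulating_seq_compact:
  assumes acc: "seq_accumulating real_dual A" shows "seq_compactin weak A"
  unfolding seq_compactin_def
proof (intro allI impI)
  fix \<sigma> :: "nat \<Rightarrow> 'v" assume \<sigma>: "range \<sigma> \<subseteq> A"
  have "\<exists>C. \<forall>a\<in>A. \<bar>g a\<bar> \<le> C" if "g \<in> real_dual" for g
    using seq_accumulating_bounded[OF acc that] by metis
  then obtain P q where P: "adapted P q" "\<forall>a\<in>A. P a = a"
    using adapted_weakly_bounded by blast
  interpret q: complete_seminormed sr q
    using P(1) by (rule adaptedD)
  obtain r z where r: "strict_mono (r :: nat \<Rightarrow> nat)" "\<And>f. f \<in> q.dual \<Longrightarrow> (\<lambda>n. f (\<sigma> (r n))) \<longlonglongrightarrow> f z"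
    using q.seq_accumulating_convergent_subsequence[OF seq_accumulating_mono[OF acc adaptedD(8)[OF P(1)]] \<sigma>]
    by metis
  have "limitin weak (\<sigma> \<circ> r) (P z) sequentially"
  proof (rule limitin_weakI)
    fix g assume g: "g \<in> real_dual"
    have "P (\<sigma> (r n)) = \<sigma> (r n)" for n
      using P(2) \<sigma> by blast
    then show "(\<lambda>n. g ((\<sigma> \<circ> r) n)) \<longlonglongrightarrow> g (P z)"
      using r(2)[OF adaptedD(7)[OF P(1) g]] by simp
  qed
  then show "\<exists>l r. strict_mono (r :: nat \<Rightarrow> nat) \<and> limitin weak (\<sigma> \<circ> r) l sequentially"
    using r(1) by blast
qed

lemma seq_compact_countably_compact:
  assumes sc: "seq_compactin weak A" shows "countably_compactin weak A"
  unfolding countably_compactin_def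
proof (intro allI impI)
  fix B assume B: "B \<subseteq> A" "countable B \<and> infinite B"
  then obtain \<sigma> :: "nat \<Rightarrow> 'v" where \<sigma>: "inj \<sigma>" "range \<sigma> \<subseteq> B"
    using infinite_countable_subset by blast
  then obtain l r where r: "strict_mono (r :: nat \<Rightarrow> nat)" "limitin weak (\<sigma> \<circ> r) l sequentially"
    using sc B(1) unfolding seq_compactin_def by (meson subset_trans)
  have "l \<in> weak derived_set_of B"
    unfolding in_derived_set_of
  proof (intro conjI allI impI)
    show "l \<in> topspace weak"
      by (simp add: topspace_weak_topology)
    fix T assume "l \<in> T \<and> openin weak T"
    then obtain N where N: "\<And>n. N \<le> n \<Longrightarrow> \<sigma> (r n) \<in> T"
      using r(2) by (auto simp: limitin_def eventually_sequentially)
    have "\<sigma> (r N) \<noteq> \<sigma> (r (Suc N))"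
      using \<sigma>(1) strict_monoD[OF r(1), of N "Suc N"] by (metis inj_eq lessI less_irrefl)
    then show "\<exists>y. y \<noteq> l \<and> y \<in> B \<and> y \<in> T"
      using N[of N] N[of "Suc N"] \<sigma>(2) by (metis le_refl le_SucI range_subsetD)
  qed
  then show "weak derived_set_of B \<noteq> {}"
    by blast
qed

text \<open>Tychonoff's theorem: \<open>ev A\<close> lies in a product of compact intervals, and it is closed there because
  the points of its closure are, on the functionals bounded by \<open>q\<close>, evaluations.\<close>

lemma compact_if_closure_represented:
  assumes cl: "closedin weak A" and ad: "adapted P q" and PA: "\<And>a. a \<in> A \<Longrightarrow> P a = a"
    and bounded: "\<And>g. g \<in> real_dual \<Longrightarrow> \<exists>C. \<forall>a\<in>A. \<bar>g a\<bar> \<le> C"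
    and rep: "\<And>\<phi>. complete_seminormed.bidual_closure sr q A \<phi> \<Longrightarrow> complete_seminormed.represented sr q \<phi>"
  shows "compactin weak A"
proof -
  interpret q: complete_seminormed sr q
    using ad by (rule adaptedD)
  define K where "K = prodtop closure_of (ev ` A)"
  obtain C where C: "\<And>g a. g \<in> real_dual \<Longrightarrow> a \<in> A \<Longrightarrow> \<bar>g a\<bar> \<le> C g"
    using bounded by metis
  have box: "compactin prodtop (\<Pi>\<^sub>E g\<in>real_dual. {- C g..C g})"
    by (simp add: compactin_PiE)
  have "ev ` A \<subseteq> (\<Pi>\<^sub>E g\<in>real_dual. {- C g..C g})"
    using C by (fastforce simp: ev_def abs_le_iff)
  then have "K \<subseteq> (\<Pi>\<^sub>E g\<in>real_dual. {- C g..C g})"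
    unfolding K_def by (rule closure_of_minimal) (simp add: closedin_product_topology)
  then have K: "compactin prodtop K"
    unfolding K_def by (rule closed_compactin[OF box]) simp
  have approx: "\<exists>a\<in>A. \<forall>g\<in>G. \<bar>g a - \<phi> g\<bar> < \<epsilon>" if \<phi>: "\<phi> \<in> K" and G: "finite G" "G \<subseteq> real_dual" and "0 < \<epsilon>" for \<phi> G \<epsilon>
  proof -
    let ?V = "\<lambda>g. {\<psi> \<in> topspace prodtop. \<psi> g \<in> ball (\<phi> g) \<epsilon>}"
    have "openin prodtop (\<Inter> (insert (topspace prodtop) (?V ` G)))"
    proof (rule openin_Inter)
      fix V assume "V \<in> insert (topspace prodtop) (?V ` G)"
      then consider "V = topspace prodtop" | g where "g \<in> real_dual" "V = ?V g"
        using G(2) by blast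
      then show "openin prodtop V"
      proof cases
        case 2
        then show ?thesis
          using openin_continuous_map_preimage[OF continuous_map_product_projection[OF 2(1)], of "\<lambda>_. euclideanreal" "ball (\<phi> g) \<epsilon>"]
          by simp
      qed (simp only: openin_topspace)
    qed (use G(1) in auto)
    moreover have "\<phi> \<in> \<Inter> (insert (topspace prodtop) (?V ` G))"
      using \<phi> \<open>0 < \<epsilon>\<close> unfolding K_def in_closure_of by auto
    ultimately obtain \<psi> where "\<psi> \<in> ev ` A" "\<psi> \<in> \<Inter> (insert (topspace prodtop) (?V ` G))"
      using \<phi> unfolding K_def in_closure_of by blast
    then obtain a where "a \<in> A" "\<forall>g\<in>G. ev a g \<in> ball (\<phi> g) \<epsilon>"
      by auto
    then show ?thesis
      using G(2) by (intro bexI[of _ a]) (auto simp: ev_def dist_real_def abs_minus_commute subset_iff)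
  qed
  have "K \<subseteq> ev ` A"
  proof
    fix \<phi> assume \<phi>: "\<phi> \<in> K"
    have "q.bidual_closure A \<phi>"
      unfolding q.bidual_closure_def using approx[OF \<phi>] adaptedD(8)[OF ad] by (meson subset_trans)
    then have "q.represented \<phi>"
      by (rule rep)
    then obtain x where x: "\<And>f. f \<in> q.dual \<Longrightarrow> \<phi> f = f x"
      by (auto simp: q.represented_def)
    have "\<phi> g = g (P x)" if g: "g \<in> real_dual" for g
    proof -
      let ?gP = "\<lambda>x. g (P x)"
      have gP: "?gP \<in> q.dual" "?gP \<in> real_dual"
        using adaptedD(7)[OF ad g] adaptedD(8)[OF ad] by auto
      have "\<bar>\<phi> g - \<phi> ?gP\<bar> \<le> 0 + \<epsilon>" if "0 < \<epsilon>" for \<epsilon>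
      proof -
        obtain a where a: "a \<in> A" "\<forall>h\<in>{g, ?gP}. \<bar>h a - \<phi> h\<bar> < \<epsilon>/2"
          using approx[OF \<phi>, of "{g, ?gP}" "\<epsilon>/2"] g gP(2) \<open>0 < \<epsilon>\<close> by auto
        then have "\<bar>g a - \<phi> g\<bar> < \<epsilon>/2" "\<bar>g a - \<phi> ?gP\<bar> < \<epsilon>/2"
          using PA[OF a(1)] by auto
        then show ?thesis
          by linarith
      qed
      then have "\<bar>\<phi> g - \<phi> ?gP\<bar> \<le> 0"
        by (rule field_le_epsilon)
      then show ?thesis
        using x[OF gP(1)] by simp
    qed
    moreover have "\<phi> \<in> extensional real_dual"
      using \<phi> unfolding K_def in_closure_of by (auto simp: PiE_def)
    ultimately have \<phi>_ev: "\<phi> = ev (P x)"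
      by (auto simp: ev_def fun_eq_iff extensional_def)
    have "P x \<in> A"
    proof (rule ccontr)
      assume "P x \<notin> A"
      have "openin weak (UNIV - A)"
        using cl by (simp add: closedin_def topspace_weak_topology)
      then obtain U where U: "openin prodtop U" "UNIV - A = ev -` U"
        by (auto simp: openin_weak_iff)
      then have "\<phi> \<in> U"
        using \<open>P x \<notin> A\<close> \<phi>_ev by blast
      then obtain a where "a \<in> A" "ev a \<in> U"
        using \<phi> U(1) unfolding K_def in_closure_of by blast
      then show False
        using U(2) by blast
    qed
    then show "\<phi> \<in> ev ` A"
      using \<phi>_ev by blast
  qed
  moreover have "ev ` A \<subseteq> K"
    unfolding K_def by (rule closure_of_subset) (auto simp: ev_def)
  ultimately have compact: "compactin prodtop (ev ` A)"
    using K by (metis subset_antisym)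
  show ?thesis
    unfolding compactin_def
  proof (intro conjI allI impI)
    show "A \<subseteq> topspace weak"
      by (simp add: topspace_weak_topology)
    fix \<U> assume \<U>: "Ball \<U> (openin weak) \<and> A \<subseteq> \<Union>\<U>"
    then have "\<forall>S\<in>\<U>. \<exists>U. openin prodtop U \<and> S = ev -` U"
      by (auto simp: openin_weak_iff)
    then obtain u where u: "\<And>S. S \<in> \<U> \<Longrightarrow> openin prodtop (u S)" "\<And>S. S \<in> \<U> \<Longrightarrow> S = ev -` u S"
      by metis
    have "ev ` A \<subseteq> \<Union> (u ` \<U>)"
      using \<U> u(2) by blast
    moreover have "\<And>U. U \<in> u ` \<U> \<Longrightarrow> openin prodtop U"
      using u(1) by blast
    ultimately have "\<exists>\<F>. finite \<F> \<and> \<F> \<subseteq> u ` \<U> \<and> ev ` A \<subseteq> \<Union>\<F>"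
      by (intro compactinD[OF compact])
    then obtain \<F> where \<F>: "finite \<F>" "\<F> \<subseteq> u ` \<U>" "ev ` A \<subseteq> \<Union>\<F>"
      by blast
    then obtain \<U>' where "\<U>' \<subseteq> \<U>" "finite \<U>'" "\<F> = u ` \<U>'"
      by (meson finite_subset_image)
    then show "\<exists>\<F>. finite \<F> \<and> \<F> \<subseteq> \<U> \<and> A \<subseteq> \<Union>\<F>"
      using \<F>(3) u(2) by (intro exI[of _ \<U>']) blast
  qed
qed

lemma seq_accumulating_compact:
  assumes cl: "closedin weak A" and acc: "seq_accumulating real_dual A" shows "compactin weak A"
proof -
  have bounded: "\<exists>C. \<forall>a\<in>A. \<bar>g a\<bar> \<le> C" if "g \<in> real_dual" for g
    using seq_accumulating_bounded[OF acc that] by metis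
  then obtain P q where P: "adapted P q" "\<forall>a\<in>A. P a = a"
    using adapted_weakly_bounded by blast
  interpret q: complete_seminormed sr q
    using P(1) by (rule adaptedD)
  show ?thesis
  proof (rule compact_if_closure_represented[OF cl P(1)])
    show "q.represented \<phi>" if "q.bidual_closure A \<phi>" for \<phi>
      using q.seq_accumulating_represented[OF seq_accumulating_mono[OF acc adaptedD(8)[OF P(1)]] that] .
  qed (use P(2) bounded in auto)
qed

lemma compact_attains:
  assumes compact: "compactin weak A" and "A \<noteq> {}" and f: "f \<in> cont_dual scl nrm"
  shows "attains_sup_norm f A"
proof -
  have "continuous_map euclidean euclideanreal (norm :: 'k \<Rightarrow> real)"
    by (simp add: continuous_on_norm)
  from continuous_map_compose[OF continuous_weak_cont_dual[OF f] this]
  have "continuous_map weak euclideanreal (\<lambda>x. norm (f x))"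
    by (simp add: o_def)
  from image_compactin[OF compact this] have "compact ((\<lambda>x. norm (f x)) ` A)"
    by simp
  then obtain a where a: "a \<in> A" "\<And>x. x \<in> A \<Longrightarrow> norm (f x) \<le> norm (f a)"
    using compact_attains_sup[of "(\<lambda>x. norm (f x)) ` A"] \<open>A \<noteq> {}\<close> by auto
  have "ereal (norm (f a)) = (SUP x\<in>A. ereal (norm (f x)))"
    using a by (intro antisym SUP_upper SUP_least) auto
  then show ?thesis
    using a(1) unfolding attains_sup_norm_def by blast
qed

text \<open>On the union of the rotations of \<open>A\<close>, the real part of a functional attains its supremum
  at a rotation of a point where the functional has its largest modulus on \<open>A\<close>. James' theorem therefore
  represents the pointwise closure of this larger set, and with it that of \<open>A\<close>.\<close>

lemma attains_compact:
  assumes cl: "closedin weak A" and att: "\<And>f. f \<in> cont_dual scl nrm \<Longrightarrow> attains_sup_norm f A"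
  shows "compactin weak A"
proof -
  define B where "B = {scl u a | u a. norm u = 1 \<and> a \<in> A}"
  have AB: "A \<subseteq> B"
  proof
    fix a assume "a \<in> A"
    then show "a \<in> B"
      unfolding B_def by (intro CollectI exI[of _ 1] exI[of _ a]) simp
  qed
  have attain: "\<exists>b\<in>B. \<forall>c\<in>B. \<bar>g c\<bar> \<le> g b" if g: "g \<in> real_dual" for g
  proof -
    obtain f where f: "f \<in> cont_dual scl nrm" "g = (\<lambda>x. re (f x))"
      using real_dual_is_real_part[OF g] by blast
    obtain a where a: "a \<in> A" "ereal (norm (f a)) = (SUP x\<in>A. ereal (norm (f x)))"
      using att[OF f(1)] by (auto simp: attains_sup_norm_def)
    have max: "norm (f x) \<le> norm (f a)" if "x \<in> A" for x
    proof -
      have "ereal (norm (f x)) \<le> ereal (norm (f a))"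
        unfolding a(2) using that by (rule SUP_upper)
      then show ?thesis by simp
    qed
    obtain u where u: "norm u = 1" "re (u * f a) = norm (f a)"
      using re_rotate by blast
    have "\<bar>g c\<bar> \<le> g (scl u a)" if c: "c \<in> B" for c
    proof -
      obtain v x where "norm v = 1" "x \<in> A" "c = scl v x"
        using c by (auto simp: B_def)
      then have "\<bar>g c\<bar> \<le> norm (f x)"
        using abs_re_le[of "v * f x"] by (simp add: f(2) cont_dual_linear(2)[OF f(1)] norm_mult)
      also have "\<dots> \<le> g (scl u a)"
        using max[OF \<open>x \<in> A\<close>] by (simp add: f(2) cont_dual_linear(2)[OF f(1)] u(2))
      finally show ?thesis .
    qed
    moreover have "scl u a \<in> B"
      using u(1) a(1) by (auto simp: B_def)
    ultimately show ?thesis by blast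
  qed
  have bounded: "\<exists>C. \<forall>b\<in>B. \<bar>g b\<bar> \<le> C" if "g \<in> real_dual" for g
    using attain[OF that] by blast
  then obtain P q where P: "adapted P q" "\<forall>b\<in>B. P b = b"
    using adapted_weakly_bounded[of B] by blast
  interpret q: complete_seminormed sr q
    using P(1) by (rule adaptedD)
  show ?thesis
  proof (rule compact_if_closure_represented[OF cl P(1)])
    show "P a = a" if "a \<in> A" for a
      using P(2) AB that by blast
    show "\<exists>C. \<forall>a\<in>A. \<bar>g a\<bar> \<le> C" if "g \<in> real_dual" for g
      using bounded[OF that] AB by blast
    fix \<phi> assume "q.bidual_closure A \<phi>"
    then have "q.bidual_closure B \<phi>"
      using AB unfolding q.bidual_closure_def by blast
    moreover have "\<exists>a\<in>B. \<forall>b\<in>B. f b \<le> f a" if "f \<in> q.dual" for f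
      using attain[of f] adaptedD(8)[OF P(1)] that abs_le_D1 by blast
    ultimately show "q.represented \<phi>"
      by (intro q.james)
  qed
qed

end

section \<open>Weak compactness in extended Banach spaces\<close>

theorem theorem4p8:
  fixes scl :: "'k::real_or_complex \<Rightarrow> 'v::ab_group_add \<Rightarrow> 'v"
    and nrm :: "'v \<Rightarrow> ennreal"
    and M A :: "'v set"
  assumes "extended_banach_space scl nrm"
    and "direct_sum_decomposition scl (finite_part nrm) M"
    and "closedin (weak_topology scl nrm) A"
  shows "(compactin (weak_topology scl nrm) A \<longleftrightarrow> seq_compactin (weak_topology scl nrm) A) \<and>
    (seq_compactin (weak_topology scl nrm) A \<longleftrightarrow> countably_compactin (weak_topology scl nrm) A) \<and>
    (A \<noteq> {} \<longrightarrow> countably_compactin (weak_topology scl nrm) A \<longrightarrow>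
      (\<forall>f\<in>cont_dual scl nrm. attains_sup_norm f A)) \<and>
    (convex_wrt scl A \<longrightarrow> (\<forall>f\<in>cont_dual scl nrm. attains_sup_norm f A) \<longrightarrow>
      compactin (weak_topology scl nrm) A)"
proof -
  obtain re :: "'k \<Rightarrow> real" and e where "real_part re e"
    using exists_real_part by blast
  with assms(1) interpret extended_banach_real_part scl nrm re e
    by (intro extended_banach_real_part.intro extended_banach_real_part_axioms.intro)
  have "countably_compactin weak A" if "compactin weak A"
    using compactin_imp_Bolzano_Weierstrass[OF that] unfolding countably_compactin_def by blast
  moreover have "seq_accumulating real_dual A" if "countably_compactin weak A"
    using that by (rule countably_compact_seq_accumulating)
  moreover have "compactin weak A" if "seq_accumulating real_dual A"
    using assms(3) that by (rule seq_accumulating_compact)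
  moreover have "seq_compactin weak A" if "seq_accumulating real_dual A"
    using that by (rule seq_accumulating_seq_compact)
  moreover have "countably_compactin weak A" if "seq_compactin weak A"
    using that by (rule seq_compact_countably_compact)
  ultimately show ?thesis
    using compact_attains attains_compact[OF assms(3)] by blast
qed

end
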